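(* Let $\Lambda$ be a finitely aligned $k$-graph and let $X=\bigsqcup_{n\in\mathbb N^k}X_n$ be its boundary-path product system of Hilbert $C_0(\partial\Lambda)$-bimodules. Then $X$ is compactly aligned: for all $m,n\in\mathbb N^k$, all $S\in\mathcal K(X_m)$ and all $T\in\mathcal K(X_n)$, we have $\iota_m^{m\vee n}(S)\,\iota_n^{m\vee n}(T)\in\mathcal K(X_{m\vee n})$.
   Context: **$k$-graphs.** $\mathbb N=\{0,1,2,\dots\}$; $\mathbb N^k$ is ordered coordinatewise and $m\vee n$ is the coordinatewise maximum. A $k$-graph is a countable category $\Lambda$ with a functor $d:\Lambda\to\mathbb N^k$ such that whenever $d(\lambda)=m+n$ there are unique $\mu,\nu\in\Lambda$ with $d(\mu)=m$, $d(\nu)=n$, $\lambda=\mu\nu$. $\Lambda^n=d^{-1}(n)$; $\Lambda^0$ is identified with the objects; $r,s$ are the codomain and domain maps, so $\lambda\mu$ is defined iff $s(\lambda)=r(\mu)$; $v\Lambda=\{\lambda:r(\lambda)=v\}$. For $\lambda,\mu\in\Lambda$, $\Lambda^{\min}(\lambda,\mu)=\{(\alpha,\beta):\lambda\alpha=\mu\beta,\ d(\lambda\alpha)=d(\lambda)\vee d(\mu)\}$. $\Lambda$ is finitely aligned if every $\Lambda^{\min}(\lambda,\mu)$ is finite. $E\subseteq v\Lambda$ is exhaustive if for every $\mu\in v\Lambda$ there is $\lambda\in E$ with $\Lambda^{\min}(\lambda,\mu)\ne\emptyset$; $v\mathcal{FE}(\Lambda)$ is the set of finite exhaustive subsets of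 $v\Lambda$. **Boundary paths.** For $m\in(\mathbb N\cup\{\infty\})^k$, $\Omega_{k,m}$ is the $k$-graph with objects $\{p\in\mathbb N^k:p\le m\}$, morphisms $(p,q)$ with $p\le q\le m$, $r(p,q)=p$, $s(p,q)=q$, $d(p,q)=q-p$, $(p,q)(q,t)=(p,t)$. A graph morphism is a degree-preserving functor $x:\Omega_{k,m}\to\Lambda$; $d(x)=m$, $r(x)=x(0)$. $\partial\Lambda$ is the set of graph morphisms $x$ such that for all $n\in\mathbb N^k$ with $n\le d(x)$ and all $E\in x(n)\mathcal{FE}(\Lambda)$ there is $\lambda\in E$ with $x(n,n+d(\lambda))=\lambda$. Put $D_\lambda=\{x\in\partial\Lambda:x(0,d(\lambda))=\lambda\}$ and, for finite $F\subseteq s(\lambda)\Lambda$, $D_{\lambda F}=\bigcup_{\nu\in F}D_{\lambda\nu}$. The sets $D_\lambda\setminus D_{\lambda F}$ form a basis of compact open sets for a locally compact Hausdorff topology on $\partial\Lambda$. $\partial\Lambda^{\ge n}=\{x\in\partial\Lambda:d(x)\ge n\}$ (an open subset), and $\sigma_n:\partial\Lambda^{\ge n}\to\partial\Lambda$ is the shift $\sigma_n(x)(p,q)=x(p+n,q+n)$. **Boundary-path product system.** Let $A=C_0(\partial\Lambda)$. If $\partial\Lambda^{\ge n}\neq\emptyset$, $X_n$ is the Hilbert $A$-bimodule obtained by completing $C_c(\partial\Lambda^{\ge n})$ for the norm given by the inner product $\langle f,g\rangle_n(x)=\sum_{\sigma_n(y)=x}\overline{f(y)}g(y)$, with right action $(f\cdot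 a)(x)=f(x)a(\sigma_n(x))$ and left action $\phi_n:A\to\mathcal L(X_n)$, $(\phi_n(a)f)(x)=a(x)f(x)$; if $\partial\Lambda^{\ge n}=\emptyset$, $X_n=\{0\}$. $X_0=A$. The multiplication $X_m\times X_n\to X_{m+n}$ is determined by $(fg)(x)=f(x)g(\sigma_m(x))$ for $f\in C_c(\partial\Lambda^{\ge m})$, $g\in C_c(\partial\Lambda^{\ge n})$; it induces isomorphisms $X_m\otimes_AX_n\cong X_{m+n}$. **Compact operators and $\iota$.** $\mathcal L(X_p)$ is the algebra of adjointable operators; $\Theta_{x,y}(z)=x\cdot\langle y,z\rangle_p$; $\mathcal K(X_p)=\overline{\mathrm{span}}\{\Theta_{x,y}:x,y\in X_p\}$. For $0\ne p\le q$, $\iota_p^q:\mathcal L(X_p)\to\mathcal L(X_q)$ is the homomorphism characterised by $\iota_p^q(S)(xy)=(Sx)y$ for $x\in X_p,y\in X_{q-p}$; for $p=0$, $\mathcal K(X_0)\cong A$ (with $\Theta_{a,b}\leftrightarrow ab^*$) and $\iota_0^q:=\phi_q$ on $\mathcal K(X_0)$. *)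

theory Defs
  imports "HOL-Analysis.Analysis" "HOL-Library.Function_Algebras"
begin

section \<open>k-graphs\<close>

text \<open>
  Elements of \<open>\<nat>\<^sup>k\<close> are functions \<open>'k \<Rightarrow> nat\<close> on a finite index type with \<open>k\<close> elements, with the
  pointwise order, sum, difference and maximum \<open>sup\<close>.  A small category is given by its set of
  morphisms, the objects being identified with the identity morphisms; \<open>cmp \<Lambda> \<lambda> \<mu>\<close> is the
  composite \<open>\<lambda>\<mu>\<close>, which is meaningful only if \<open>src \<Lambda> \<lambda> = rng \<Lambda> \<mu>\<close>.
\<close>

record ('a, 'k) kgraph =
  mor :: "'a set"
  rng :: "'a \<Rightarrow> 'a"
  src :: "'a \<Rightarrow> 'a"
  cmp :: "'a \<Rightarrow> 'a \<Rightarrow> 'a"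
  deg :: "'a \<Rightarrow> 'k \<Rightarrow> nat"

definition is_category :: "('a, 'k) kgraph \<Rightarrow> bool" where
  "is_category \<Lambda> \<longleftrightarrow>
     (\<forall>l\<in>mor \<Lambda>. rng \<Lambda> l \<in> mor \<Lambda> \<and> src \<Lambda> l \<in> mor \<Lambda>
        \<and> rng \<Lambda> (rng \<Lambda> l) = rng \<Lambda> l \<and> src \<Lambda> (rng \<Lambda> l) = rng \<Lambda> l
        \<and> rng \<Lambda> (src \<Lambda> l) = src \<Lambda> l \<and> src \<Lambda> (src \<Lambda> l) = src \<Lambda> l
        \<and> cmp \<Lambda> (rng \<Lambda> l) l = l \<and> cmp \<Lambda> l (src \<Lambda> l) = l) \<and>
     (\<forall>l\<in>mor \<Lambda>. \<forall>m\<in>mor \<Lambda>. src \<Lambda> l = rng \<Lambda> m \<longrightarrow>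
        cmp \<Lambda> l m \<in> mor \<Lambda> \<and> rng \<Lambda> (cmp \<Lambda> l m) = rng \<Lambda> l \<and> src \<Lambda> (cmp \<Lambda> l m) = src \<Lambda> m) \<and>
     (\<forall>l\<in>mor \<Lambda>. \<forall>m\<in>mor \<Lambda>. \<forall>n\<in>mor \<Lambda>. src \<Lambda> l = rng \<Lambda> m \<and> src \<Lambda> m = rng \<Lambda> n \<longrightarrow>
        cmp \<Lambda> (cmp \<Lambda> l m) n = cmp \<Lambda> l (cmp \<Lambda> m n))"

definition k_graph :: "('a, 'k::finite) kgraph \<Rightarrow> bool" where
  "k_graph \<Lambda> \<longleftrightarrow>
     is_category \<Lambda> \<and> countable (mor \<Lambda>) \<and>
     (\<forall>l\<in>mor \<Lambda>. deg \<Lambda> (rng \<Lambda> l) = 0 \<and> deg \<Lambda> (src \<Lambda> l) = 0) \<and>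
     (\<forall>l\<in>mor \<Lambda>. \<forall>m\<in>mor \<Lambda>. src \<Lambda> l = rng \<Lambda> m \<longrightarrow>
        deg \<Lambda> (cmp \<Lambda> l m) = deg \<Lambda> l + deg \<Lambda> m) \<and>
     (\<forall>l\<in>mor \<Lambda>. \<forall>m n. deg \<Lambda> l = m + n \<longrightarrow>
        (\<exists>!p. fst p \<in> mor \<Lambda> \<and> snd p \<in> mor \<Lambda> \<and> deg \<Lambda> (fst p) = m \<and> deg \<Lambda> (snd p) = n
             \<and> src \<Lambda> (fst p) = rng \<Lambda> (snd p) \<and> l = cmp \<Lambda> (fst p) (snd p)))"

text \<open>\<open>v\<Lambda>\<close>\<close>
definition from_vertex :: "('a, 'k) kgraph \<Rightarrow> 'a \<Rightarrow> 'a set" where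
  "from_vertex \<Lambda> v = {l \<in> mor \<Lambda>. rng \<Lambda> l = v}"

definition min_ext :: "('a, 'k) kgraph \<Rightarrow> 'a \<Rightarrow> 'a \<Rightarrow> ('a \<times> 'a) set" where
  "min_ext \<Lambda> l m = {(\<alpha>, \<beta>). \<alpha> \<in> mor \<Lambda> \<and> \<beta> \<in> mor \<Lambda>
      \<and> src \<Lambda> l = rng \<Lambda> \<alpha> \<and> src \<Lambda> m = rng \<Lambda> \<beta>
      \<and> cmp \<Lambda> l \<alpha> = cmp \<Lambda> m \<beta> \<and> deg \<Lambda> (cmp \<Lambda> l \<alpha>) = sup (deg \<Lambda> l) (deg \<Lambda> m)}"

definition finitely_aligned :: "('a, 'k) kgraph \<Rightarrow> bool" where
  "finitely_aligned \<Lambda> \<longleftrightarrow> (\<forall>l\<in>mor \<Lambda>. \<forall>m\<in>mor \<Lambda>. finite (min_ext \<Lambda> l m))"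

definition finite_exhaustive :: "('a, 'k) kgraph \<Rightarrow> 'a \<Rightarrow> 'a set set" where
  "finite_exhaustive \<Lambda> v = {E. E \<subseteq> from_vertex \<Lambda> v \<and> finite E
      \<and> (\<forall>m\<in>from_vertex \<Lambda> v. \<exists>l\<in>E. min_ext \<Lambda> l m \<noteq> {})}"

section \<open>Boundary paths\<close>

definition env :: "('k \<Rightarrow> nat) \<Rightarrow> 'k \<Rightarrow> enat" where
  "env n = (\<lambda>i. enat (n i))"

definition Omega :: "('k \<Rightarrow> enat) \<Rightarrow> (('k \<Rightarrow> nat) \<times> ('k \<Rightarrow> nat), 'k) kgraph" where
  "Omega m = \<lparr> mor = {(p, q). p \<le> q \<and> env q \<le> m},
               rng = (\<lambda>(p, q). (p, p)),
               src = (\<lambda>(p, q). (q, q)),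
               cmp = (\<lambda>(p, q) (q', t). (p, t)),
               deg = (\<lambda>(p, q). q - p) \<rparr>"

definition graph_morphism :: "('b, 'k) kgraph \<Rightarrow> ('a, 'k) kgraph \<Rightarrow> ('b \<Rightarrow> 'a) \<Rightarrow> bool" where
  "graph_morphism \<Gamma> \<Lambda> x \<longleftrightarrow>
     (\<forall>e\<in>mor \<Gamma>. x e \<in> mor \<Lambda> \<and> rng \<Lambda> (x e) = x (rng \<Gamma> e) \<and> src \<Lambda> (x e) = x (src \<Gamma> e)
        \<and> deg \<Lambda> (x e) = deg \<Gamma> e) \<and>
     (\<forall>e\<in>mor \<Gamma>. \<forall>f\<in>mor \<Gamma>. src \<Gamma> e = rng \<Gamma> f \<longrightarrow> x (cmp \<Gamma> e f) = cmp \<Lambda> (x e) (x f))"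

text \<open>
  A path is the pair of its degree \<open>m\<close> and a functor on \<open>\<Omega>\<^bsub>k,m\<^esub>\<close>, made \<open>extensional\<close> so that
  equality of pairs is equality of functors.
\<close>

type_synonym ('a, 'k) path = "('k \<Rightarrow> enat) \<times> (('k \<Rightarrow> nat) \<times> ('k \<Rightarrow> nat) \<Rightarrow> 'a)"

definition paths :: "('a, 'k) kgraph \<Rightarrow> ('a, 'k) path set" where
  "paths \<Lambda> = {(m, x). x \<in> extensional (mor (Omega m)) \<and> graph_morphism (Omega m) \<Lambda> x}"

text \<open>In \<open>x(n, n + d(\<lambda>)) = \<lambda>\<close> it is understood that \<open>n + d(\<lambda>) \<le> d(x)\<close>; the vertex \<open>x(n)\<close> is
  \<open>snd x (n, n)\<close>.\<close>

definition boundary :: "('a, 'k) kgraph \<Rightarrow> ('a, 'k) path set" where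
  "boundary \<Lambda> = {x \<in> paths \<Lambda>. \<forall>n. env n \<le> fst x \<longrightarrow>
      (\<forall>E\<in>finite_exhaustive \<Lambda> (snd x (n, n)).
         \<exists>l\<in>E. env (n + deg \<Lambda> l) \<le> fst x \<and> snd x (n, n + deg \<Lambda> l) = l)}"

definition cylinder :: "('a, 'k) kgraph \<Rightarrow> 'a \<Rightarrow> ('a, 'k) path set" where
  "cylinder \<Lambda> l = {x \<in> boundary \<Lambda>. env (deg \<Lambda> l) \<le> fst x \<and> snd x (0, deg \<Lambda> l) = l}"

definition basic_set :: "('a, 'k) kgraph \<Rightarrow> 'a \<Rightarrow> 'a set \<Rightarrow> ('a, 'k) path set" where
  "basic_set \<Lambda> l F = cylinder \<Lambda> l - (\<Union>\<nu>\<in>F. cylinder \<Lambda> (cmp \<Lambda> l \<nu>))"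

definition boundary_top :: "('a, 'k) kgraph \<Rightarrow> ('a, 'k) path topology" where
  "boundary_top \<Lambda> = topology_generated_by
     {basic_set \<Lambda> l F | l F. l \<in> mor \<Lambda> \<and> finite F \<and> F \<subseteq> from_vertex \<Lambda> (src \<Lambda> l)}"

definition boundary_ge :: "('a, 'k) kgraph \<Rightarrow> ('k \<Rightarrow> nat) \<Rightarrow> ('a, 'k) path set" where
  "boundary_ge \<Lambda> n = {x \<in> boundary \<Lambda>. env n \<le> fst x}"

definition shift :: "('k \<Rightarrow> nat) \<Rightarrow> ('a, 'k) path \<Rightarrow> ('a, 'k) path" where
  "shift n x = (let m = fst x - env n in
     (m, restrict (\<lambda>(p, q). snd x (p + n, q + n)) (mor (Omega m))))"

section \<open>The boundary-path product system\<close>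

text \<open>Functions on a space \<open>T\<close> are extended by \<open>0\<close> to the whole type.\<close>

definition C0 :: "'x topology \<Rightarrow> ('x \<Rightarrow> complex) set" where
  "C0 T = {f. continuous_map T euclidean f \<and> (\<forall>x. x \<notin> topspace T \<longrightarrow> f x = 0)
      \<and> (\<forall>e>0. compactin T {x \<in> topspace T. e \<le> norm (f x)})}"

definition Cc :: "'x topology \<Rightarrow> ('x \<Rightarrow> complex) set" where
  "Cc T = {f. continuous_map T euclidean f \<and> (\<forall>x. x \<notin> topspace T \<longrightarrow> f x = 0)
      \<and> compactin T (T closure_of {x \<in> topspace T. f x \<noteq> 0})}"

definition Cc_ge :: "('a, 'k) kgraph \<Rightarrow> ('k \<Rightarrow> nat) \<Rightarrow> (('a, 'k) path \<Rightarrow> complex) set" where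
  "Cc_ge \<Lambda> n = Cc (subtopology (boundary_top \<Lambda>) (boundary_ge \<Lambda> n))"

definition fibre :: "('a, 'k) kgraph \<Rightarrow> ('k \<Rightarrow> nat) \<Rightarrow> ('a, 'k) path \<Rightarrow> ('a, 'k) path set" where
  "fibre \<Lambda> n x = {y \<in> boundary_ge \<Lambda> n. shift n y = x}"

definition ip :: "('a, 'k) kgraph \<Rightarrow> ('k \<Rightarrow> nat) \<Rightarrow> (('a, 'k) path \<Rightarrow> complex)
    \<Rightarrow> (('a, 'k) path \<Rightarrow> complex) \<Rightarrow> ('a, 'k) path \<Rightarrow> complex" where
  "ip \<Lambda> n f g x = (\<Sum>\<^sub>\<infinity>y\<in>fibre \<Lambda> n x. cnj (f y) * g y)"

text \<open>\<open>\<parallel>f\<parallel>\<^sub>n = \<parallel>\<langle>f, f\<rangle>\<^sub>n\<parallel>\<^sup>1\<^sup>/\<^sup>2\<close> for the supremum norm; note that \<open>fibre \<Lambda> n x = {}\<close> if \<open>x \<notin> \<partial>\<Lambda>\<close>.\<close>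

definition mod_norm :: "('a, 'k) kgraph \<Rightarrow> ('k \<Rightarrow> nat) \<Rightarrow> (('a, 'k) path \<Rightarrow> complex) \<Rightarrow> real" where
  "mod_norm \<Lambda> n f = sqrt (SUP x. norm (ip \<Lambda> n f f x))"

text \<open>
  All functions on \<open>\<partial>\<Lambda>\<^sup>\<ge>\<^sup>n\<close> with finite norm.  This is a Banach space containing \<open>C\<^sub>c(\<partial>\<Lambda>\<^sup>\<ge>\<^sup>n)\<close>
  (lemmas \<open>fibre_l2_complete\<close> and \<open>Cc_ge_subset_fibre_l2\<close> below), so the completion \<open>X\<^sub>n\<close> of
  \<open>C\<^sub>c(\<partial>\<Lambda>\<^sup>\<ge>\<^sup>n)\<close> is realised as the closure of \<open>C\<^sub>c(\<partial>\<Lambda>\<^sup>\<ge>\<^sup>n)\<close> in it.  Point evaluations are continuous for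
  \<open>\<parallel>\<cdot>\<parallel>\<^sub>n\<close>, so the formulas which define the inner product, the actions and the multiplication on
  compactly supported functions hold verbatim on the completion.
\<close>

definition fibre_l2 :: "('a, 'k) kgraph \<Rightarrow> ('k \<Rightarrow> nat) \<Rightarrow> (('a, 'k) path \<Rightarrow> complex) set" where
  "fibre_l2 \<Lambda> n = {f. (\<forall>y. y \<notin> boundary_ge \<Lambda> n \<longrightarrow> f y = 0)
      \<and> (\<forall>x. (\<lambda>y. (norm (f y))\<^sup>2) summable_on fibre \<Lambda> n x)
      \<and> bdd_above (range (\<lambda>x. \<Sum>\<^sub>\<infinity>y\<in>fibre \<Lambda> n x. (norm (f y))\<^sup>2))}"

definition X :: "('a, 'k) kgraph \<Rightarrow> ('k \<Rightarrow> nat) \<Rightarrow> (('a, 'k) path \<Rightarrow> complex) set" where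
  "X \<Lambda> n = {f \<in> fibre_l2 \<Lambda> n. \<forall>e>0. \<exists>g\<in>Cc_ge \<Lambda> n. mod_norm \<Lambda> n (f - g) < e}"

definition right_act :: "('k \<Rightarrow> nat) \<Rightarrow> (('a, 'k) path \<Rightarrow> complex) \<Rightarrow> (('a, 'k) path \<Rightarrow> complex)
    \<Rightarrow> ('a, 'k) path \<Rightarrow> complex" where
  "right_act n f a = (\<lambda>x. f x * a (shift n x))"

definition left_act :: "('a, 'k) kgraph \<Rightarrow> ('k \<Rightarrow> nat) \<Rightarrow> (('a, 'k) path \<Rightarrow> complex)
    \<Rightarrow> (('a, 'k) path \<Rightarrow> complex) \<Rightarrow> (('a, 'k) path \<Rightarrow> complex)" where
  "left_act \<Lambda> n a = restrict (\<lambda>f x. a x * f x) (X \<Lambda> n)"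

text \<open>The product of \<open>f \<in> X\<^sub>m\<close> and \<open>g \<in> X\<^sub>n\<close> does not depend on \<open>n\<close>.\<close>

definition mult :: "('k \<Rightarrow> nat) \<Rightarrow> (('a, 'k) path \<Rightarrow> complex) \<Rightarrow> (('a, 'k) path \<Rightarrow> complex)
    \<Rightarrow> ('a, 'k) path \<Rightarrow> complex" where
  "mult m f g = (\<lambda>x. f x * g (shift m x))"

section \<open>Adjointable and compact operators\<close>

text \<open>Operators on \<open>X\<^sub>n\<close> are \<open>extensional\<close> functions; their composition is \<open>compose (X \<Lambda> n)\<close>.\<close>

definition adjointable :: "('a, 'k) kgraph \<Rightarrow> ('k \<Rightarrow> nat)
    \<Rightarrow> ((('a, 'k) path \<Rightarrow> complex) \<Rightarrow> (('a, 'k) path \<Rightarrow> complex)) set" where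
  "adjointable \<Lambda> n = {S \<in> X \<Lambda> n \<rightarrow>\<^sub>E X \<Lambda> n. \<exists>S' \<in> X \<Lambda> n \<rightarrow>\<^sub>E X \<Lambda> n.
      \<forall>f\<in>X \<Lambda> n. \<forall>g\<in>X \<Lambda> n. ip \<Lambda> n (S f) g = ip \<Lambda> n f (S' g)}"

definition rank_one :: "('a, 'k) kgraph \<Rightarrow> ('k \<Rightarrow> nat) \<Rightarrow> (('a, 'k) path \<Rightarrow> complex)
    \<Rightarrow> (('a, 'k) path \<Rightarrow> complex) \<Rightarrow> (('a, 'k) path \<Rightarrow> complex) \<Rightarrow> (('a, 'k) path \<Rightarrow> complex)" where
  "rank_one \<Lambda> n f g = restrict (\<lambda>h. right_act n f (ip \<Lambda> n g h)) (X \<Lambda> n)"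

definition finite_rank :: "('a, 'k) kgraph \<Rightarrow> ('k \<Rightarrow> nat)
    \<Rightarrow> ((('a, 'k) path \<Rightarrow> complex) \<Rightarrow> (('a, 'k) path \<Rightarrow> complex)) set" where
  "finite_rank \<Lambda> n = {restrict (\<lambda>h x. \<Sum>i<N. c i * rank_one \<Lambda> n (f i) (g i) h x) (X \<Lambda> n) |
      (N::nat) c f g. (\<forall>i<N. f i \<in> X \<Lambda> n \<and> g i \<in> X \<Lambda> n)}"

text \<open>The closure is taken in \<open>\<L>(X\<^sub>n)\<close> for the operator norm: the last condition says that
  \<open>\<parallel>S - R\<parallel> \<le> e\<close>.\<close>

definition compact_ops :: "('a, 'k) kgraph \<Rightarrow> ('k \<Rightarrow> nat)
    \<Rightarrow> ((('a, 'k) path \<Rightarrow> complex) \<Rightarrow> (('a, 'k) path \<Rightarrow> complex)) set" where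
  "compact_ops \<Lambda> n = {S \<in> adjointable \<Lambda> n. \<forall>e>0. \<exists>R\<in>finite_rank \<Lambda> n.
      \<forall>h\<in>X \<Lambda> n. mod_norm \<Lambda> n (S h - R h) \<le> e * mod_norm \<Lambda> n h}"

text \<open>
  For \<open>p = 0\<close>, the operator \<open>\<Theta>\<^bsub>a,b\<^esub>\<close> on \<open>X\<^sub>0 = A\<close> is left multiplication by \<open>ab\<^sup>*\<close>, so the element of \<open>A\<close>
  which corresponds to \<open>S \<in> \<K>(X\<^sub>0)\<close> is the \<open>a\<close> such that \<open>S\<close> is left multiplication by \<open>a\<close>.
\<close>

definition iota :: "('a, 'k) kgraph \<Rightarrow> ('k \<Rightarrow> nat) \<Rightarrow> ('k \<Rightarrow> nat)
    \<Rightarrow> ((('a, 'k) path \<Rightarrow> complex) \<Rightarrow> (('a, 'k) path \<Rightarrow> complex))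
    \<Rightarrow> ((('a, 'k) path \<Rightarrow> complex) \<Rightarrow> (('a, 'k) path \<Rightarrow> complex))" where
  "iota \<Lambda> p q S =
     (if p = 0 then left_act \<Lambda> q (THE a. a \<in> C0 (boundary_top \<Lambda>) \<and> S = left_act \<Lambda> 0 a)
      else (THE R. R \<in> adjointable \<Lambda> q \<and>
              (\<forall>f\<in>X \<Lambda> p. \<forall>g\<in>X \<Lambda> (q - p). R (mult p f g) = mult p (S f) g)))"

section \<open>The definitions above describe the intended objects\<close>

lemma env_le_trans:
  assumes "p \<le> q" "env q \<le> m"
  shows "env p \<le> m"
proof (rule order_trans[OF _ assms(2)])
  show "env p \<le> env q" using assms(1) by (simp add: env_def le_fun_def)
qed

lemma deg_zero_iff_identity:
  assumes "k_graph \<Lambda>" "l \<in> mor \<Lambda>"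
  shows "deg \<Lambda> l = 0 \<longleftrightarrow> l = rng \<Lambda> l"
proof
  assume l0: "deg \<Lambda> l = 0"
  let ?P = "\<lambda>p. fst p \<in> mor \<Lambda> \<and> snd p \<in> mor \<Lambda> \<and> deg \<Lambda> (fst p) = 0 \<and> deg \<Lambda> (snd p) = 0
             \<and> src \<Lambda> (fst p) = rng \<Lambda> (snd p) \<and> l = cmp \<Lambda> (fst p) (snd p)"
  have ex: "\<exists>!p. ?P p"
  proof -
    have "deg \<Lambda> l = 0 + 0" using l0 by simp
    then show ?thesis using assms unfolding k_graph_def by blast
  qed
  have "?P (rng \<Lambda> l, l)" "?P (l, src \<Lambda> l)"
    using assms l0 unfolding k_graph_def is_category_def by auto
  with ex have "(rng \<Lambda> l, l) = (l, src \<Lambda> l)" by blast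
  then show "l = rng \<Lambda> l" by simp
next
  assume "l = rng \<Lambda> l"
  moreover have "deg \<Lambda> (rng \<Lambda> l) = 0" using assms unfolding k_graph_def by blast
  ultimately show "deg \<Lambda> l = 0" by simp
qed

lemma Omega_k_graph:
  fixes m :: "'k::finite \<Rightarrow> enat"
  shows "k_graph (Omega m)"
  unfolding k_graph_def
proof (intro conjI ballI allI impI)
  show "is_category (Omega m)"
    by (auto simp: is_category_def Omega_def intro: order_trans env_le_trans)
  show "countable (mor (Omega m))"
    by (rule countable_subset[OF subset_UNIV]) (simp add: countableI_type)
  fix l assume l: "l \<in> mor (Omega m)"
  show "deg (Omega m) (rng (Omega m) l) = 0" "deg (Omega m) (src (Omega m) l) = 0"
    by (auto simp: Omega_def fun_eq_iff split: prod.splits)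
  { fix l' assume "l' \<in> mor (Omega m)" "src (Omega m) l = rng (Omega m) l'"
    with l show "deg (Omega m) (cmp (Omega m) l l') = deg (Omega m) l + deg (Omega m) l'"
      by (auto simp: Omega_def fun_eq_iff le_fun_def env_def) }
  fix a b assume d: "deg (Omega m) l = a + b"
  obtain p q where pq: "l = (p, q)" "p \<le> q" "env q \<le> m" using l by (auto simp: Omega_def)
  have q: "q = p + a + b" 
  proof
    fix i have "q i - p i = a i + b i" "p i \<le> q i"
      using d pq by (auto simp: Omega_def fun_eq_iff le_fun_def env_def)
    then show "q i = (p + a + b) i" by simp
  qed
  have le: "enat (p i + a i) \<le> m i" for i
  proof -
    have "enat (p i + a i) \<le> enat (q i)" by (simp add: q)
    also have "\<dots> \<le> m i" using le_funD[OF pq(3), of i] by (simp add: env_def)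
    finally show ?thesis .
  qed
  show "\<exists>!u. fst u \<in> mor (Omega m) \<and> snd u \<in> mor (Omega m) \<and> deg (Omega m) (fst u) = a
     \<and> deg (Omega m) (snd u) = b \<and> src (Omega m) (fst u) = rng (Omega m) (snd u)
     \<and> l = cmp (Omega m) (fst u) (snd u)"
  proof (rule ex1I[of _ "((p, p + a), (p + a, q))"])
    show "fst ((p, p + a), (p + a, q)) \<in> mor (Omega m) \<and> snd ((p, p + a), (p + a, q)) \<in> mor (Omega m) \<and> deg (Omega m) (fst ((p, p + a), (p + a, q))) = a
     \<and> deg (Omega m) (snd ((p, p + a), (p + a, q))) = b \<and> src (Omega m) (fst ((p, p + a), (p + a, q))) = rng (Omega m) (snd ((p, p + a), (p + a, q)))
     \<and> l = cmp (Omega m) (fst ((p, p + a), (p + a, q))) (snd ((p, p + a), (p + a, q)))"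
      using pq le by (auto simp: Omega_def q le_fun_def env_def fun_eq_iff)
  next
    fix u assume "fst u \<in> mor (Omega m) \<and> snd u \<in> mor (Omega m) \<and> deg (Omega m) (fst u) = a
     \<and> deg (Omega m) (snd u) = b \<and> src (Omega m) (fst u) = rng (Omega m) (snd u)
     \<and> l = cmp (Omega m) (fst u) (snd u)"
    then show "u = ((p, p + a), (p + a, q))"
      unfolding pq(1) by (cases u) (auto simp: Omega_def fun_eq_iff le_fun_def env_def; (metis le_add_diff_inverse)?)
  qed
qed

lemma pathsD:
  assumes "x \<in> paths \<Lambda>" "p \<le> q" "env q \<le> fst x"
  shows "snd x (p, q) \<in> mor \<Lambda>" "rng \<Lambda> (snd x (p, q)) = snd x (p, p)"
    "src \<Lambda> (snd x (p, q)) = snd x (q, q)" "deg \<Lambda> (snd x (p, q)) = q - p"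
proof -
  have "graph_morphism (Omega (fst x)) \<Lambda> (snd x)" using assms(1) unfolding paths_def by force
  moreover have "(p, q) \<in> mor (Omega (fst x))" using assms(2,3) by (simp add: Omega_def)
  ultimately have "snd x (p, q) \<in> mor \<Lambda> \<and> rng \<Lambda> (snd x (p, q)) = snd x (rng (Omega (fst x)) (p, q))
    \<and> src \<Lambda> (snd x (p, q)) = snd x (src (Omega (fst x)) (p, q))
    \<and> deg \<Lambda> (snd x (p, q)) = deg (Omega (fst x)) (p, q)"
    unfolding graph_morphism_def by blast
  then show "snd x (p, q) \<in> mor \<Lambda>" "rng \<Lambda> (snd x (p, q)) = snd x (p, p)"
    "src \<Lambda> (snd x (p, q)) = snd x (q, q)" "deg \<Lambda> (snd x (p, q)) = q - p"
    by (simp_all add: Omega_def)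
qed

lemma paths_cmp:
  assumes "x \<in> paths \<Lambda>" "p \<le> q" "q \<le> t" "env t \<le> fst x"
  shows "snd x (p, t) = cmp \<Lambda> (snd x (p, q)) (snd x (q, t))"
proof -
  have "graph_morphism (Omega (fst x)) \<Lambda> (snd x)" using assms(1) unfolding paths_def by force
  moreover have "env q \<le> fst x" using assms(3,4) by (rule env_le_trans)
  then have "(p, q) \<in> mor (Omega (fst x))" "(q, t) \<in> mor (Omega (fst x))"
    "src (Omega (fst x)) (p, q) = rng (Omega (fst x)) (q, t)"
    using assms by (simp_all add: Omega_def)
  ultimately have "snd x (cmp (Omega (fst x)) (p, q) (q, t)) = cmp \<Lambda> (snd x (p, q)) (snd x (q, t))"
    unfolding graph_morphism_def by blast
  then show ?thesis by (simp add: Omega_def)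
qed

lemma env_diff_le_iff:
  assumes "env n \<le> m"
  shows "env q \<le> m - env n \<longleftrightarrow> env (q + n) \<le> m"
proof -
  have "(enat (q i) \<le> m i - enat (n i)) = (enat (q i + n i) \<le> m i)" for i
    using le_funD[OF assms, of i] by (cases "m i") (auto simp: env_def)
  then show ?thesis by (simp add: le_fun_def env_def)
qed

lemma shift_in_boundary:
  assumes x: "x \<in> boundary_ge \<Lambda> n"
  shows "shift n x \<in> boundary \<Lambda>"
proof -
  let ?m = "fst x - env n"
  have xp: "x \<in> paths \<Lambda>" and xn: "env n \<le> fst x" and xb: "x \<in> boundary \<Lambda>"
    using x by (auto simp: boundary_ge_def boundary_def)
  note iff = env_diff_le_iff[OF xn]
  have sn: "snd (shift n x) (p, q) = snd x (p + n, q + n)" if "p \<le> q" "env q \<le> ?m" for p q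
    using that by (simp add: shift_def Let_def Omega_def)
  have fs: "fst (shift n x) = ?m" by (simp add: shift_def Let_def)
  have path: "shift n x \<in> paths \<Lambda>"
  proof -
    have "graph_morphism (Omega ?m) \<Lambda> (snd (shift n x))"
      unfolding graph_morphism_def
    proof (intro conjI ballI impI)
      fix e assume "e \<in> mor (Omega ?m)"
      then obtain p q where e: "e = (p, q)" "p \<le> q" "env q \<le> ?m" by (auto simp: Omega_def)
      have pm: "env p \<le> ?m" using e(2,3) by (rule env_le_trans)
      have le: "p + n \<le> q + n" "env (q + n) \<le> fst x" using e iff by (auto simp: le_fun_def env_def)
      note D = pathsD[OF xp le]
      show "snd (shift n x) e \<in> mor \<Lambda>" 
        "rng \<Lambda> (snd (shift n x) e) = snd (shift n x) (rng (Omega ?m) e)"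
        "src \<Lambda> (snd (shift n x) e) = snd (shift n x) (src (Omega ?m) e)"
        "deg \<Lambda> (snd (shift n x) e) = deg (Omega ?m) e"
        using D e pm by (auto simp: sn Omega_def fun_eq_iff)
      fix f assume "f \<in> mor (Omega ?m)" "src (Omega ?m) e = rng (Omega ?m) f"
      then obtain t where f: "f = (q, t)" "q \<le> t" "env t \<le> ?m" using e by (auto simp: Omega_def)
      have le': "q + n \<le> t + n" "env (t + n) \<le> fst x" using f iff by (auto simp: le_fun_def env_def)
      have "p \<le> t" using e f by simp
      then show "snd (shift n x) (cmp (Omega ?m) e f) = cmp \<Lambda> (snd (shift n x) e) (snd (shift n x) f)"
        using paths_cmp[OF xp le(1) le'] e f by (simp add: sn Omega_def)
    qed
    then show ?thesis by (auto simp: paths_def shift_def Let_def)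
  qed
  moreover have "\<exists>l\<in>E. env (p + deg \<Lambda> l) \<le> fst (shift n x) \<and> snd (shift n x) (p, p + deg \<Lambda> l) = l"
    if p: "env p \<le> fst (shift n x)" and E: "E \<in> finite_exhaustive \<Lambda> (snd (shift n x) (p, p))" for p E
  proof -
    have "env (p + n) \<le> fst x" using p iff fs by simp
    moreover have "E \<in> finite_exhaustive \<Lambda> (snd x (p + n, p + n))" using E p fs by (simp add: sn)
    ultimately obtain l where l: "l \<in> E" "env (p + n + deg \<Lambda> l) \<le> fst x"
      "snd x (p + n, p + n + deg \<Lambda> l) = l"
      using xb unfolding boundary_def by blast
    have eq: "p + n + deg \<Lambda> l = p + deg \<Lambda> l + n" by (simp add: add_ac)
    have le: "env (p + deg \<Lambda> l) \<le> ?m" using l(2) iff unfolding eq by blast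
    have "p \<le> p + deg \<Lambda> l" by (simp add: le_fun_def env_def)
    from sn[OF this le] l(3) have "snd (shift n x) (p, p + deg \<Lambda> l) = l" unfolding eq by simp
    then show ?thesis using l(1) le fs by auto
  qed
  ultimately show ?thesis unfolding boundary_def by blast
qed

lemma shift_zero:
  assumes "x \<in> paths \<Lambda>"
  shows "shift 0 x = x"
proof -
  have "fst x - env 0 = fst x"
    by (auto simp: fun_eq_iff zero_enat_def[symmetric] env_def)
  moreover have "snd x \<in> extensional (mor (Omega (fst x)))" using assms by (auto simp: paths_def)
  moreover have "(\<lambda>(p, q). snd x (p + 0, q + 0)) = snd x" by auto
  ultimately show ?thesis
    unfolding shift_def Let_def by (simp add: extensional_restrict prod_eq_iff)
qed

lemma topspace_boundary_top:
  assumes "k_graph \<Lambda>"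
  shows "topspace (boundary_top \<Lambda>) = boundary \<Lambda>"
proof -
  have "\<Union>{basic_set \<Lambda> l F | l F. l \<in> mor \<Lambda> \<and> finite F \<and> F \<subseteq> from_vertex \<Lambda> (src \<Lambda> l)} = boundary \<Lambda>"
  proof (intro equalityI subsetI)
    fix x assume x: "x \<in> boundary \<Lambda>"
    then have xp: "x \<in> paths \<Lambda>" by (simp add: boundary_def)
    have 0: "env 0 \<le> fst x" by (simp add: le_fun_def env_def zero_enat_def[symmetric])
    note D = pathsD[OF xp order_refl 0]
    have d0: "deg \<Lambda> (snd x (0, 0)) = 0" using D(4) by (simp add: fun_eq_iff)
    have "x \<in> basic_set \<Lambda> (snd x (0, 0)) {}"
      using x 0 by (simp only: basic_set_def cylinder_def d0) simp
    then show "x \<in> \<Union>{basic_set \<Lambda> l F | l F. l \<in> mor \<Lambda> \<and> finite F \<and> F \<subseteq> from_vertex \<Lambda> (src \<Lambda> l)}"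
      using D(1) by blast
  qed (auto simp: basic_set_def cylinder_def)
  then show ?thesis unfolding boundary_top_def topology_generated_by_topspace .
qed

lemma openin_cylinder:
  assumes "l \<in> mor \<Lambda>"
  shows "openin (boundary_top \<Lambda>) (cylinder \<Lambda> l)"
proof -
  have "cylinder \<Lambda> l = basic_set \<Lambda> l {}" by (simp add: basic_set_def)
  then show ?thesis
    unfolding boundary_top_def using assms by (intro topology_generated_by_Basis) blast
qed

lemma boundary_ge_eq_Union_cylinder:
  "boundary_ge \<Lambda> n = (\<Union>l\<in>{l\<in>mor \<Lambda>. deg \<Lambda> l = n}. cylinder \<Lambda> l)"
proof (intro equalityI subsetI)
  fix x assume x: "x \<in> boundary_ge \<Lambda> n"
  then have xp: "x \<in> paths \<Lambda>" and le: "env n \<le> fst x" by (auto simp: boundary_ge_def boundary_def)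
  have "0 \<le> n" by (simp add: le_fun_def env_def)
  note D = pathsD[OF xp this le]
  then have "x \<in> cylinder \<Lambda> (snd x (0, n))" "deg \<Lambda> (snd x (0, n)) = n"
    using x le by (auto simp: cylinder_def boundary_ge_def)
  then show "x \<in> (\<Union>l\<in>{l\<in>mor \<Lambda>. deg \<Lambda> l = n}. cylinder \<Lambda> l)" using D by blast
qed (auto simp: cylinder_def boundary_ge_def)

lemma snd_path_eqI:
  assumes k: "k_graph \<Lambda>" and x: "x \<in> paths \<Lambda>" and y: "y \<in> paths \<Lambda>"
    and m: "fst x = fst y" and t: "env t \<le> fst x" and eq: "snd x (0, t) = snd y (0, t)"
    and pq: "p \<le> q" "q \<le> t"
  shows "snd x (p, q) = snd y (p, q)"
proof -
  have fact: "a = a' \<and> b = b'"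
    if "a \<in> mor \<Lambda>" "b \<in> mor \<Lambda>" "a' \<in> mor \<Lambda>" "b' \<in> mor \<Lambda>" "deg \<Lambda> a = deg \<Lambda> a'" "deg \<Lambda> b = deg \<Lambda> b'"
      "src \<Lambda> a = rng \<Lambda> b" "src \<Lambda> a' = rng \<Lambda> b'" "cmp \<Lambda> a b = cmp \<Lambda> a' b'" for a b a' b'
  proof -
    let ?P = "\<lambda>p. fst p \<in> mor \<Lambda> \<and> snd p \<in> mor \<Lambda> \<and> deg \<Lambda> (fst p) = deg \<Lambda> a \<and> deg \<Lambda> (snd p) = deg \<Lambda> b
             \<and> src \<Lambda> (fst p) = rng \<Lambda> (snd p) \<and> cmp \<Lambda> a b = cmp \<Lambda> (fst p) (snd p)"
    have "cmp \<Lambda> a b \<in> mor \<Lambda>" "deg \<Lambda> (cmp \<Lambda> a b) = deg \<Lambda> a + deg \<Lambda> b"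
      using k that unfolding k_graph_def is_category_def by blast+
    then have ex: "\<exists>!p. ?P p" using k unfolding k_graph_def by blast
    have "?P (a, b)" "?P (a', b')" using that by auto
    with ex have "(a, b) = (a', b')" by blast
    then show ?thesis by simp
  qed
  have split: "snd x (a, b) = snd y (a, b) \<and> snd x (b, c) = snd y (b, c)"
    if "a \<le> b" "b \<le> c" "c \<le> t" "snd x (a, c) = snd y (a, c)" for a b c
  proof -
    have c: "env c \<le> fst x" using that(3) t by (rule env_le_trans)
    have b: "env b \<le> fst x" using that(2) c by (rule env_le_trans)
    note bc = b c b[unfolded m] c[unfolded m]
    show ?thesis
      by (rule fact) (use that bc in \<open>simp_all add: pathsD[OF x] pathsD[OF y] 
            paths_cmp[OF x that(1,2), symmetric] paths_cmp[OF y that(1,2), symmetric]\<close>)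
  qed
  have 0: "0 \<le> p" by (simp add: le_fun_def env_def)
  from split[OF 0 _ order_refl eq] pq have "snd x (p, t) = snd y (p, t)" by simp
  from split[OF pq order_refl this] show ?thesis by simp
qed

lemma shift_inj_on_cylinder:
  assumes k: "k_graph \<Lambda>" and d: "deg \<Lambda> l = n"
  shows "inj_on (shift n) (cylinder \<Lambda> l)"
proof (rule inj_onI)
  fix x y assume x: "x \<in> cylinder \<Lambda> l" and y: "y \<in> cylinder \<Lambda> l" and s: "shift n x = shift n y"
  have xp: "x \<in> paths \<Lambda>" and yp: "y \<in> paths \<Lambda>" using x y by (auto simp: cylinder_def boundary_def)
  have xn: "env n \<le> fst x" and yn: "env n \<le> fst y" using x y d by (auto simp: cylinder_def)
  have fs: "fst x - env n = fst y - env n" using arg_cong[OF s, of fst] by (simp add: shift_def Let_def)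
  have "fst x i = fst y i" for i
    using fun_cong[OF fs, of i] le_funD[OF xn, of i] le_funD[OF yn, of i]
    by (cases "fst x i"; cases "fst y i") (auto simp: env_def)
  then have m: "fst x = fst y" by (rule ext)
  have sn: "snd x (n, t) = snd y (n, t)" if "n \<le> t" "env t \<le> fst x" for t
  proof -
    have t: "t - n + n = t" using that(1) by (auto simp: fun_eq_iff le_fun_def env_def)
    have "env (t - n) \<le> fst x - env n" unfolding env_diff_le_iff[OF xn] t by fact
    then have "(0, t - n) \<in> mor (Omega (fst x - env n))" by (simp add: Omega_def le_fun_def env_def)
    then have "snd (shift n x) (0, t - n) = snd x (0 + n, t - n + n)"
      "snd (shift n y) (0, t - n) = snd y (0 + n, t - n + n)"
      using fs by (simp_all add: shift_def Let_def)
    then show ?thesis using s unfolding t by simp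
  qed
  have "snd x (p, q) = snd y (p, q)" for p q
  proof (cases "(p, q) \<in> mor (Omega (fst x))")
    case True
    then have pq: "p \<le> q" "env q \<le> fst x" by (auto simp: Omega_def)
    let ?t = "sup q n"
    have t: "env ?t \<le> fst x" using pq(2) xn by (auto simp: le_fun_def env_def sup_max max_def)
    have t': "env ?t \<le> fst y" using t m by simp
    have n: "0 \<le> n" "n \<le> ?t" by (simp_all add: le_fun_def env_def)
    have "snd x (0, n) = snd y (0, n)" using x y d by (simp add: cylinder_def)
    then have "snd x (0, ?t) = snd y (0, ?t)"
      unfolding paths_cmp[OF xp n t] paths_cmp[OF yp n t'] using sn[OF n(2) t] by simp
    then show ?thesis by (rule snd_path_eqI[OF k xp yp m t]) (use pq in auto)
  next
    case False
    then show ?thesis using xp yp m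
      by (auto simp: paths_def extensional_def)
  qed
  then show "x = y" using m by (auto simp: prod_eq_iff)
qed

lemma fibre_l2D:
  assumes "f \<in> fibre_l2 \<Lambda> n"
  shows "y \<notin> boundary_ge \<Lambda> n \<Longrightarrow> f y = 0" "(\<lambda>y. (norm (f y))\<^sup>2) summable_on fibre \<Lambda> n x"
    "bdd_above (range (\<lambda>x. \<Sum>\<^sub>\<infinity>y\<in>fibre \<Lambda> n x. (norm (f y))\<^sup>2))"
  using assms unfolding fibre_l2_def by (simp_all del: split_paired_All)

lemma norm_ip_self:
  assumes "(\<lambda>y. (norm (f y))\<^sup>2) summable_on fibre \<Lambda> n x"
  shows "norm (ip \<Lambda> n f f x) = (\<Sum>\<^sub>\<infinity>y\<in>fibre \<Lambda> n x. (norm (f y))\<^sup>2)"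
proof -
  let ?s = "\<Sum>\<^sub>\<infinity>y\<in>fibre \<Lambda> n x. (norm (f y))\<^sup>2"
  have "((\<lambda>y. (norm (f y))\<^sup>2) has_sum ?s) (fibre \<Lambda> n x)" using assms by (rule has_sum_infsum)
  from has_sum_bounded_linear[OF bounded_linear_of_real this]
  have "((\<lambda>y. cnj (f y) * f y) has_sum complex_of_real ?s) (fibre \<Lambda> n x)"
    by (simp add: o_def complex_norm_square[symmetric] mult.commute)
  then have "ip \<Lambda> n f f x = complex_of_real ?s" unfolding ip_def by (rule infsumI)
  moreover have "0 \<le> ?s" by (rule infsum_nonneg) simp
  ultimately show ?thesis by simp
qed

lemma fibre_l2_norm_le_iff:
  assumes "0 \<le> c"
  shows "f \<in> fibre_l2 \<Lambda> n \<and> mod_norm \<Lambda> n f \<le> c \<longleftrightarrow>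
    (\<forall>y. y \<notin> boundary_ge \<Lambda> n \<longrightarrow> f y = 0) \<and>
    (\<forall>x F. finite F \<and> F \<subseteq> fibre \<Lambda> n x \<longrightarrow> (\<Sum>y\<in>F. (norm (f y))\<^sup>2) \<le> c\<^sup>2)" (is "?L \<longleftrightarrow> ?Z \<and> ?R")
proof
  assume L: ?L
  then have Z: ?Z and s: "\<And>x. (\<lambda>y. (norm (f y))\<^sup>2) summable_on fibre \<Lambda> n x"
    and b: "bdd_above (range (\<lambda>x. \<Sum>\<^sub>\<infinity>y\<in>fibre \<Lambda> n x. (norm (f y))\<^sup>2))"
    using fibre_l2D[of f \<Lambda> n] by auto
  have c: "sqrt (SUP x. \<Sum>\<^sub>\<infinity>y\<in>fibre \<Lambda> n x. (norm (f y))\<^sup>2) \<le> c"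
    using L unfolding mod_norm_def norm_ip_self[OF s] by blast
  have "(SUP x. \<Sum>\<^sub>\<infinity>y\<in>fibre \<Lambda> n x. (norm (f y))\<^sup>2) \<le> c\<^sup>2"
    using c by (rule sqrt_le_D)
  then have "(\<Sum>\<^sub>\<infinity>y\<in>fibre \<Lambda> n x. (norm (f y))\<^sup>2) \<le> c\<^sup>2" for x
    using cSUP_upper[OF UNIV_I b, of x] by linarith
  moreover have "(\<Sum>y\<in>F. (norm (f y))\<^sup>2) \<le> (\<Sum>\<^sub>\<infinity>y\<in>fibre \<Lambda> n x. (norm (f y))\<^sup>2)"
    if "finite F" "F \<subseteq> fibre \<Lambda> n x" for F x
    using s that by (intro finite_sum_le_infsum) auto
  ultimately show "?Z \<and> ?R" using Z by (meson order_trans)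
next
  assume R: "?Z \<and> ?R"
  then have s: "(\<lambda>y. (norm (f y))\<^sup>2) summable_on fibre \<Lambda> n x" for x
    by (intro nonneg_bdd_above_summable_on)
       (auto intro!: bdd_aboveI2[of _ _ "c\<^sup>2"] simp del: split_paired_All)
  have le: "(\<Sum>\<^sub>\<infinity>y\<in>fibre \<Lambda> n x. (norm (f y))\<^sup>2) \<le> c\<^sup>2" for x
    using s R by (intro infsum_le_finite_sums) blast+
  then have "f \<in> fibre_l2 \<Lambda> n"
    using R s unfolding fibre_l2_def by (auto intro!: bdd_aboveI2[of _ _ "c\<^sup>2"])
  moreover have "(SUP x. \<Sum>\<^sub>\<infinity>y\<in>fibre \<Lambda> n x. (norm (f y))\<^sup>2) \<le> c\<^sup>2"
    by (rule cSUP_least) (use le in auto)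
  then have "mod_norm \<Lambda> n f \<le> c"
    unfolding mod_norm_def norm_ip_self[OF s] using assms by (intro real_le_lsqrt) auto
  ultimately show ?L by simp
qed

lemma mod_norm_nonneg:
  assumes "f \<in> fibre_l2 \<Lambda> n"
  shows "0 \<le> mod_norm \<Lambda> n f"
proof -
  have "(\<lambda>y. (norm (f y))\<^sup>2) summable_on fibre \<Lambda> n x" 
    "bdd_above (range (\<lambda>x. \<Sum>\<^sub>\<infinity>y\<in>fibre \<Lambda> n x. (norm (f y))\<^sup>2))" for x
    by (rule fibre_l2D[OF assms])+
  then have "bdd_above (range (\<lambda>x. norm (ip \<Lambda> n f f x)))" by (simp add: norm_ip_self)
  then have "norm (ip \<Lambda> n f f undefined) \<le> (SUP x. norm (ip \<Lambda> n f f x))"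
    by (rule cSUP_upper[OF UNIV_I])
  then show ?thesis unfolding mod_norm_def by (simp add: order_trans[OF norm_ge_zero])
qed

lemma fibre_l2_finite_sum_le:
  assumes "f \<in> fibre_l2 \<Lambda> n" "finite F" "F \<subseteq> fibre \<Lambda> n x"
  shows "(\<Sum>y\<in>F. (norm (f y))\<^sup>2) \<le> (mod_norm \<Lambda> n f)\<^sup>2"
  using fibre_l2_norm_le_iff[OF mod_norm_nonneg[OF assms(1)], of f] assms by blast

lemma norm_le_mod_norm:
  assumes "f \<in> fibre_l2 \<Lambda> n"
  shows "norm (f y) \<le> mod_norm \<Lambda> n f"
proof (cases "y \<in> boundary_ge \<Lambda> n")
  case True
  then have "(\<Sum>y\<in>{y}. (norm (f y))\<^sup>2) \<le> (mod_norm \<Lambda> n f)\<^sup>2"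
    by (intro fibre_l2_finite_sum_le[OF assms, of _ "shift n y"]) (auto simp: fibre_def)
  then have "(norm (f y))\<^sup>2 \<le> (mod_norm \<Lambda> n f)\<^sup>2" by simp
  then show ?thesis by (rule power2_le_imp_le) (rule mod_norm_nonneg[OF assms])
next
  case False
  then show ?thesis using mod_norm_nonneg[OF assms] fibre_l2D(1)[OF assms] by simp
qed

lemma fibre_l2_uminus:
  assumes "f \<in> fibre_l2 \<Lambda> n"
  shows "- f \<in> fibre_l2 \<Lambda> n" "mod_norm \<Lambda> n (- f) = mod_norm \<Lambda> n f"
  using assms by (auto simp: fibre_l2_def mod_norm_def ip_def)

lemma fibre_l2_add:
  assumes f: "f \<in> fibre_l2 \<Lambda> n" and g: "g \<in> fibre_l2 \<Lambda> n"
  shows "f + g \<in> fibre_l2 \<Lambda> n" "mod_norm \<Lambda> n (f + g) \<le> mod_norm \<Lambda> n f + mod_norm \<Lambda> n g"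
proof -
  let ?a = "mod_norm \<Lambda> n f" let ?b = "mod_norm \<Lambda> n g"
  have ab: "0 \<le> ?a" "0 \<le> ?b" using f g by (auto intro: mod_norm_nonneg)
  have "(\<Sum>y\<in>F. (norm ((f + g) y))\<^sup>2) \<le> (?a + ?b)\<^sup>2" if F: "finite F" "F \<subseteq> fibre \<Lambda> n x" for x F
  proof -
    have "sqrt (\<Sum>y\<in>F. (norm ((f + g) y))\<^sup>2) \<le> L2_set (\<lambda>y. norm (f y) + norm (g y)) F"
      unfolding L2_set_def
      by (intro real_sqrt_le_mono sum_mono power_mono) (auto intro: norm_triangle_ineq)
    also have "\<dots> \<le> L2_set (\<lambda>y. norm (f y)) F + L2_set (\<lambda>y. norm (g y)) F"
      by (rule L2_set_triangle_ineq)
    also have "\<dots> \<le> ?a + ?b"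
      using fibre_l2_finite_sum_le[OF f F] fibre_l2_finite_sum_le[OF g F] ab
      unfolding L2_set_def by (intro add_mono real_le_lsqrt) auto
    finally show ?thesis by (rule sqrt_le_D)
  qed
  then have "f + g \<in> fibre_l2 \<Lambda> n \<and> mod_norm \<Lambda> n (f + g) \<le> ?a + ?b"
    using f g ab by (subst fibre_l2_norm_le_iff) (auto simp: fibre_l2_def)
  then show "f + g \<in> fibre_l2 \<Lambda> n" "mod_norm \<Lambda> n (f + g) \<le> ?a + ?b" by auto
qed

lemma fibre_l2_diff:
  assumes f: "f \<in> fibre_l2 \<Lambda> n" and g: "g \<in> fibre_l2 \<Lambda> n"
  shows "f - g \<in> fibre_l2 \<Lambda> n" "mod_norm \<Lambda> n (f - g) \<le> mod_norm \<Lambda> n f + mod_norm \<Lambda> n g"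
  using fibre_l2_add[OF f fibre_l2_uminus(1)[OF g]] fibre_l2_uminus(2)[OF g] by auto

lemma fibre_l2_complete:
  assumes u: "\<And>i. u i \<in> fibre_l2 \<Lambda> n"
    and cau: "\<And>e. e > 0 \<Longrightarrow> \<exists>M. \<forall>i\<ge>M. \<forall>j\<ge>M. mod_norm \<Lambda> n (u i - u j) < e"
  obtains f where "f \<in> fibre_l2 \<Lambda> n" "(\<lambda>i. mod_norm \<Lambda> n (u i - f)) \<longlonglongrightarrow> 0"
proof -
  have d: "u i - u j \<in> fibre_l2 \<Lambda> n" for i j using u by (intro fibre_l2_diff)
  have "Cauchy (\<lambda>i. u i y)" for y
  proof (rule metric_CauchyI)
    fix e :: real assume "e > 0"
    from cau[OF this] obtain M where M: "\<forall>i\<ge>M. \<forall>j\<ge>M. mod_norm \<Lambda> n (u i - u j) < e" by blast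
    have "dist (u i y) (u j y) \<le> mod_norm \<Lambda> n (u i - u j)" for i j
      using norm_le_mod_norm[OF d, of i j y] by (simp add: dist_norm)
    then show "\<exists>M. \<forall>i\<ge>M. \<forall>j\<ge>M. dist (u i y) (u j y) < e" using M by (meson le_less_trans)
  qed
  then have "\<exists>l. (\<lambda>i. u i y) \<longlonglongrightarrow> l" for y using Cauchy_convergent convergent_def by blast
  then obtain f where lim: "\<And>y. (\<lambda>i. u i y) \<longlonglongrightarrow> f y" by metis
  have f0: "f y = 0" if "y \<notin> boundary_ge \<Lambda> n" for y
    using lim[of y] fibre_l2D(1)[OF u that] by (simp add: LIMSEQ_const_iff)
  have key: "u i - f \<in> fibre_l2 \<Lambda> n \<and> mod_norm \<Lambda> n (u i - f) \<le> e"
    if e: "e > 0" and M: "\<forall>i\<ge>M. \<forall>j\<ge>M. mod_norm \<Lambda> n (u i - u j) < e" and i: "i \<ge> M" for e M i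
  proof (subst fibre_l2_norm_le_iff)
    have "(\<Sum>y\<in>F. (norm ((u i - f) y))\<^sup>2) \<le> e\<^sup>2" if F: "finite F" "F \<subseteq> fibre \<Lambda> n x" for x F
    proof (rule LIMSEQ_le_const2)
      show "(\<lambda>j. \<Sum>y\<in>F. (norm ((u i - u j) y))\<^sup>2) \<longlonglongrightarrow> (\<Sum>y\<in>F. (norm ((u i - f) y))\<^sup>2)"
        by (auto intro!: tendsto_intros lim)
      have "(\<Sum>y\<in>F. (norm ((u i - u j) y))\<^sup>2) \<le> e\<^sup>2" if "j \<ge> M" for j
        using fibre_l2_finite_sum_le[OF d F, of i j] M i that mod_norm_nonneg[OF d, of i j]
        by (meson less_imp_le order_trans power_mono)
      then show "\<exists>N. \<forall>j\<ge>N. (\<Sum>y\<in>F. (norm ((u i - u j) y))\<^sup>2) \<le> e\<^sup>2" by blast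
    qed
    then show "(\<forall>y. y \<notin> boundary_ge \<Lambda> n \<longrightarrow> (u i - f) y = 0) \<and>
      (\<forall>x F. finite F \<and> F \<subseteq> fibre \<Lambda> n x \<longrightarrow> (\<Sum>y\<in>F. (norm ((u i - f) y))\<^sup>2) \<le> e\<^sup>2)"
      using f0 u by (auto simp: fibre_l2_def)
  qed (use e in simp)
  show thesis
  proof
    obtain M where M: "\<forall>i\<ge>M. \<forall>j\<ge>M. mod_norm \<Lambda> n (u i - u j) < 1" using cau[of 1] by auto
    have "u M - (u M - f) \<in> fibre_l2 \<Lambda> n"
      by (rule fibre_l2_diff(1)[OF u]) (use key[OF _ M order_refl] in simp)
    moreover have "u M - (u M - f) = f" by (rule ext) simp
    ultimately show "f \<in> fibre_l2 \<Lambda> n" by simp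
    show "(\<lambda>i. mod_norm \<Lambda> n (u i - f)) \<longlonglongrightarrow> 0"
    proof (rule metric_LIMSEQ_I)
      fix e :: real assume e: "e > 0"
      then obtain M where M: "\<forall>i\<ge>M. \<forall>j\<ge>M. mod_norm \<Lambda> n (u i - u j) < e/2"
        using cau[of "e/2"] by auto
      have "norm (mod_norm \<Lambda> n (u i - f)) < e" if "i \<ge> M" for i
        using key[OF _ M that] e mod_norm_nonneg[of "u i - f" \<Lambda> n] by auto
      then show "\<exists>M. \<forall>i\<ge>M. dist (mod_norm \<Lambda> n (u i - f)) 0 < e" by auto
    qed
  qed
qed

lemma Cc_ge_subset_fibre_l2:
  assumes k: "k_graph \<Lambda>"
  shows "Cc_ge \<Lambda> n \<subseteq> fibre_l2 \<Lambda> n"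
proof
  fix f assume f: "f \<in> Cc_ge \<Lambda> n"
  let ?T = "subtopology (boundary_top \<Lambda>) (boundary_ge \<Lambda> n)"
  have top: "topspace ?T = boundary_ge \<Lambda> n"
    using topspace_boundary_top[OF k] by (auto simp: boundary_ge_def)
  define K where "K = ?T closure_of {x \<in> topspace ?T. f x \<noteq> 0}"
  have cont: "continuous_map ?T euclidean f" and f0: "\<And>y. y \<notin> boundary_ge \<Lambda> n \<Longrightarrow> f y = 0"
    and K: "compactin ?T K"
    using f unfolding Cc_ge_def Cc_def mem_Collect_eq top K_def by blast+
  have supp: "y \<in> K" if "f y \<noteq> 0" for y
  proof -
    have "y \<in> {x \<in> topspace ?T. f x \<noteq> 0}" using that f0[of y] unfolding top by blast
    moreover have "{x \<in> topspace ?T. f x \<noteq> 0} \<subseteq> K" unfolding K_def by (rule closure_of_subset) blast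
    ultimately show ?thesis by blast
  qed
  have "compactin euclidean (f ` K)" using image_compactin[OF K cont] .
  then have "bounded (f ` K)" by (simp add: compact_imp_bounded)
  then obtain B where B: "\<And>y. y \<in> K \<Longrightarrow> norm (f y) \<le> B" by (auto simp: bounded_iff)
  have B': "norm (f y) \<le> max B 0" for y using B[of y] supp[of y] by (cases "f y = 0") auto
  have "compactin (boundary_top \<Lambda>) K" "K \<subseteq> boundary_ge \<Lambda> n"
    using K by (auto simp: compactin_subtopology)
  then have "\<exists>\<F>. finite \<F> \<and> \<F> \<subseteq> cylinder \<Lambda> ` {l \<in> mor \<Lambda>. deg \<Lambda> l = n} \<and> K \<subseteq> \<Union>\<F>"
    by (intro compactinD) (auto simp: boundary_ge_eq_Union_cylinder intro: openin_cylinder)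
  then obtain \<F> where "finite \<F>" "\<F> \<subseteq> cylinder \<Lambda> ` {l \<in> mor \<Lambda>. deg \<Lambda> l = n}" and KF: "K \<subseteq> \<Union>\<F>"
    by blast
  from finite_subset_image[OF this(1,2)] KF
  obtain L where L: "finite L" "L \<subseteq> {l \<in> mor \<Lambda>. deg \<Lambda> l = n}" "K \<subseteq> (\<Union>l\<in>L. cylinder \<Lambda> l)"
    by blast
  have "(\<Sum>y\<in>F. (norm (f y))\<^sup>2) \<le> (sqrt (real (card L) * (max B 0)\<^sup>2))\<^sup>2"
    if F: "finite F" "F \<subseteq> fibre \<Lambda> n x" for x F
  proof -
    let ?G = "\<lambda>l. F \<inter> cylinder \<Lambda> l"
    have c1: "card (?G l) \<le> 1" if "l \<in> L" for l
    proof -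
      have "inj_on (shift n) (cylinder \<Lambda> l)" using that L k by (intro shift_inj_on_cylinder) auto
      then have "y = z" if "y \<in> ?G l" "z \<in> ?G l" for y z
      proof -
        have "shift n y = shift n z" using that F(2) unfolding fibre_def by blast
        then show ?thesis using \<open>inj_on (shift n) (cylinder \<Lambda> l)\<close> that by (meson IntD2 inj_onD)
      qed
      then show ?thesis using F by (simp add: card_le_Suc0_iff_eq)
    qed
    have "(\<Sum>y\<in>F. (norm (f y))\<^sup>2) = (\<Sum>y\<in>F \<inter> K. (norm (f y))\<^sup>2)"
      by (rule sum.mono_neutral_right) (use F supp in auto)
    also have "\<dots> \<le> real (card (F \<inter> K)) * (max B 0)\<^sup>2"
      using B' by (intro sum_bounded_above) (auto intro!: power_mono)
    also have "card (F \<inter> K) \<le> card (\<Union>l\<in>L. ?G l)"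
      using L F by (intro card_mono) auto
    then have "card (F \<inter> K) \<le> (\<Sum>l\<in>L. card (?G l))"
      using card_UN_le[OF L(1), of ?G] by linarith
    then have "card (F \<inter> K) \<le> card L" using sum_mono[OF c1, of L "\<lambda>l. l"] by simp
    then have "real (card (F \<inter> K)) * (max B 0)\<^sup>2 \<le> real (card L) * (max B 0)\<^sup>2"
      by (intro mult_right_mono) auto
    finally show ?thesis by simp
  qed
  then have "f \<in> fibre_l2 \<Lambda> n \<and> mod_norm \<Lambda> n f \<le> sqrt (real (card L) * (max B 0)\<^sup>2)"
    using f0 by (subst fibre_l2_norm_le_iff) (simp_all only: real_sqrt_ge_zero mult_nonneg_nonneg of_nat_0_le_iff zero_le_power2, blast)
  then show "f \<in> fibre_l2 \<Lambda> n" by simp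
qed

lemma Cc_ge_subset_X:
  assumes "k_graph \<Lambda>"
  shows "Cc_ge \<Lambda> n \<subseteq> X \<Lambda> n"
proof
  fix f assume f: "f \<in> Cc_ge \<Lambda> n"
  have "mod_norm \<Lambda> n (f - f) = 0" by (simp add: mod_norm_def ip_def)
  then show "f \<in> X \<Lambda> n"
    using f Cc_ge_subset_fibre_l2[OF assms] unfolding X_def by force
qed

lemma X_complete:
  assumes k: "k_graph \<Lambda>" and u: "\<And>i. u i \<in> X \<Lambda> n"
    and cau: "\<And>e. e > 0 \<Longrightarrow> \<exists>M. \<forall>i\<ge>M. \<forall>j\<ge>M. mod_norm \<Lambda> n (u i - u j) < e"
  obtains f where "f \<in> X \<Lambda> n" "(\<lambda>i. mod_norm \<Lambda> n (u i - f)) \<longlonglongrightarrow> 0"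
proof -
  have ul: "u i \<in> fibre_l2 \<Lambda> n" for i using u by (auto simp: X_def)
  from fibre_l2_complete[of u \<Lambda> n, OF ul cau] obtain f
    where f: "f \<in> fibre_l2 \<Lambda> n" "(\<lambda>i. mod_norm \<Lambda> n (u i - f)) \<longlonglongrightarrow> 0" by blast
  have "\<exists>g\<in>Cc_ge \<Lambda> n. mod_norm \<Lambda> n (f - g) < e" if e: "e > 0" for e
  proof -
    obtain i where "dist (mod_norm \<Lambda> n (u i - f)) 0 < e/2"
      using metric_LIMSEQ_D[OF f(2), of "e/2"] e by auto
    then have i: "mod_norm \<Lambda> n (u i - f) < e/2" by simp
    obtain g where g: "g \<in> Cc_ge \<Lambda> n" "mod_norm \<Lambda> n (u i - g) < e/2"
      using u[of i] half_gt_zero[OF e] unfolding X_def by blast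
    have "u i - g \<in> fibre_l2 \<Lambda> n" "u i - f \<in> fibre_l2 \<Lambda> n"
      using ul f g Cc_ge_subset_fibre_l2[OF k] by (auto intro: fibre_l2_diff)
    from fibre_l2_diff(2)[OF this] have "mod_norm \<Lambda> n (f - g) < e" using i g by simp
    then show ?thesis using g by blast
  qed
  then show thesis using f that unfolding X_def by blast
qed

lemma X_zero:
  assumes k: "k_graph \<Lambda>"
  shows "X \<Lambda> 0 = C0 (boundary_top \<Lambda>)"
proof -
  let ?T = "boundary_top \<Lambda>"
  note top = topspace_boundary_top[OF k]
  have ge: "boundary_ge \<Lambda> 0 = boundary \<Lambda>"
    by (auto simp: boundary_ge_def le_fun_def env_def zero_enat_def[symmetric])
  have Cc: "Cc_ge \<Lambda> 0 = Cc ?T" unfolding Cc_ge_def ge top[symmetric] by simp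
  have fib: "fibre \<Lambda> 0 x = (if x \<in> boundary \<Lambda> then {x} else {})" for x
  proof -
    have "shift 0 y = y" if "y \<in> boundary \<Lambda>" for y
      using that shift_zero[of y \<Lambda>] by (simp add: boundary_def)
    then show ?thesis unfolding fibre_def ge by auto
  qed
  have l2: "f \<in> fibre_l2 \<Lambda> 0 \<and> mod_norm \<Lambda> 0 f \<le> c \<longleftrightarrow>
      (\<forall>y. y \<notin> boundary \<Lambda> \<longrightarrow> f y = 0) \<and> (\<forall>y. norm (f y) \<le> c)" if "0 \<le> c" for f c
  proof (safe)
    fix y assume f: "f \<in> fibre_l2 \<Lambda> 0" "mod_norm \<Lambda> 0 f \<le> c"
    then show "norm (f y) \<le> c" using norm_le_mod_norm order_trans by blast
    assume "y \<notin> boundary \<Lambda>" then show "f y = 0" using fibre_l2D(1)[OF f(1)] ge by simp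
  next
    assume *: "\<forall>y. y \<notin> boundary \<Lambda> \<longrightarrow> f y = 0" "\<forall>y. norm (f y) \<le> c"
    have "(\<Sum>y\<in>F. (norm (f y))\<^sup>2) \<le> c\<^sup>2" if "finite F" "F \<subseteq> fibre \<Lambda> 0 x" for F x
    proof -
      have "F = {} \<or> F = {x}" using that fib[of x] by (auto split: if_splits)
      then show ?thesis using *(2) by (elim disjE) (simp_all add: power_mono del: split_paired_All)
    qed
    with * have "f \<in> fibre_l2 \<Lambda> 0 \<and> mod_norm \<Lambda> 0 f \<le> c"
      by (subst fibre_l2_norm_le_iff) (auto simp: ge that simp del: split_paired_All)
    then show "f \<in> fibre_l2 \<Lambda> 0" "mod_norm \<Lambda> 0 f \<le> c" by auto
  qed
  have closed: "closedin ?T {x \<in> topspace ?T. e \<le> norm (f x)}" 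
    if "continuous_map ?T euclidean f" for f :: "_ \<Rightarrow> complex" and e
  proof -
    have "closed {z::complex. e \<le> norm z}" by (intro closed_Collect_le continuous_intros)
    from closedin_continuous_map_preimage[OF that closed_closedin[THEN iffD1, OF this]]
    show ?thesis by simp
  qed
  show ?thesis
  proof (intro equalityI subsetI)
    fix f assume f: "f \<in> X \<Lambda> 0"
    then have f0: "f y = 0" if "y \<notin> boundary \<Lambda>" for y
      using f that ge fibre_l2D(1)[of f \<Lambda> 0 y] by (simp add: X_def)
    have app: "\<exists>g\<in>Cc ?T. \<forall>y. norm (f y - g y) < e" if e: "e > 0" for e
    proof -
      obtain g where g: "g \<in> Cc_ge \<Lambda> 0" "mod_norm \<Lambda> 0 (f - g) < e"
        using f e unfolding X_def by blast
      have "f - g \<in> fibre_l2 \<Lambda> 0"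
        using f g(1) Cc_ge_subset_fibre_l2[OF k] by (auto simp: X_def intro: fibre_l2_diff)
      then have "norm ((f - g) y) < e" for y using g norm_le_mod_norm le_less_trans by blast
      then show ?thesis using g Cc by auto
    qed
    have "\<forall>i. \<exists>g\<in>Cc ?T. \<forall>y. norm (f y - g y) < inverse (real (Suc i))"
      by (intro allI app) simp
    then have "\<forall>i. \<exists>g. g \<in> Cc ?T \<and> (\<forall>y. norm (f y - g y) < inverse (real (Suc i)))"
      by blast
    from choice[OF this] obtain G where G: "\<And>i::nat. G i \<in> Cc ?T"
      "\<And>i y. norm (f y - G i y) < inverse (real (Suc i))" by blast
    have cont: "continuous_map ?T euclidean f"
    proof -
      have "continuous_map ?T (Met_TC.mtopology) f"
      proof (rule Met_TC.continuous_map_uniform_limit[where F = sequentially and f = G])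
        show "\<forall>\<^sub>F i in sequentially. continuous_map ?T Met_TC.mtopology (G i)"
          using G by (auto simp: Cc_def)
        fix e :: real assume "0 < e"
        then have "\<forall>\<^sub>F i in sequentially. inverse (real (Suc i)) < e"
          using LIMSEQ_inverse_real_of_nat order_tendstoD(2) by blast
        then show "\<forall>\<^sub>F i in sequentially. \<forall>x\<in>topspace ?T. f x \<in> UNIV \<and> dist (G i x) (f x) < e"
          by (rule eventually_mono) (metis G(2) UNIV_I dist_commute dist_norm less_trans)
      qed simp
      then show ?thesis by simp
    qed
    have "compactin ?T {x \<in> topspace ?T. e \<le> norm (f x)}" if e: "e > 0" for e
    proof -
      obtain g where g: "g \<in> Cc ?T" "\<And>y. norm (f y - g y) < e" using app[OF e] by blast
      have "{x \<in> topspace ?T. e \<le> norm (f x)} \<subseteq> {x \<in> topspace ?T. g x \<noteq> 0}"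
        using g(2) by (auto) (metis diff_zero not_le)
      also have "\<dots> \<subseteq> ?T closure_of {x \<in> topspace ?T. g x \<noteq> 0}" by (rule closure_of_subset) auto
      finally show ?thesis
        using g(1) closed[OF cont] by (auto simp: Cc_def intro: closed_compactin)
    qed
    then show "f \<in> C0 ?T" using cont f0 top by (auto simp: C0_def)
  next
    fix f assume f: "f \<in> C0 ?T"
    then have cont: "continuous_map ?T euclidean f" and f0: "\<And>y. y \<notin> boundary \<Lambda> \<Longrightarrow> f y = 0"
      and cp: "\<And>e. e > 0 \<Longrightarrow> compactin ?T {x \<in> topspace ?T. e \<le> norm (f x)}"
      using top by (auto simp: C0_def)
    have app: "\<exists>g\<in>Cc ?T. \<forall>y. norm (f y - g y) \<le> e" if e: "e > 0" for e
    proof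
      let ?h = "\<lambda>z::complex. z * complex_of_real (max 0 (norm z - e) / max e (norm z))"
      let ?g = "?h \<circ> f"
      have h: "norm (z - ?h z) \<le> e" for z :: complex
      proof (cases "norm z \<le> e")
        case True then show ?thesis by simp
      next
        case False
        then have z: "norm z > e" "norm z > 0" using e by auto
        then have "z - ?h z = z * complex_of_real (e / norm z)"
          by (simp add: max_def field_simps)
        then have "norm (z - ?h z) = norm z * (e / norm z)"
          using z e by (simp add: norm_mult norm_divide)
        then show ?thesis using z by simp
      qed
      have "continuous_on UNIV ?h"
        using e by (intro continuous_intros) (auto simp: max_def)
      then have contg: "continuous_map ?T euclidean ?g"
        using cont by (intro continuous_map_compose[OF cont]) simp
      have "{x \<in> topspace ?T. ?g x \<noteq> 0} \<subseteq> {x \<in> topspace ?T. e \<le> norm (f x)}"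
        by auto
      then have "?T closure_of {x \<in> topspace ?T. ?g x \<noteq> 0} \<subseteq> {x \<in> topspace ?T. e \<le> norm (f x)}"
        by (rule closure_of_minimal) (rule closed[OF cont])
      then have "compactin ?T (?T closure_of {x \<in> topspace ?T. ?g x \<noteq> 0})"
        by (rule closed_compactin[OF cp[OF e]]) simp
      then show "?g \<in> Cc ?T" using contg f0 top by (auto simp: Cc_def)
      show "\<forall>y. norm (f y - ?g y) \<le> e" using h by simp
    qed
    have Cl2: "g \<in> fibre_l2 \<Lambda> 0" if "g \<in> Cc ?T" for g
      using that Cc Cc_ge_subset_fibre_l2[OF k] by auto
    have main: "f - g \<in> fibre_l2 \<Lambda> 0 \<and> mod_norm \<Lambda> 0 (f - g) \<le> e"
      if "g \<in> Cc ?T" "\<forall>y. norm (f y - g y) \<le> e" "e > 0" for g e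
      using that f0 top by (subst l2) (auto simp: Cc_def)
    obtain g where g: "g \<in> Cc ?T" "\<forall>y. norm (f y - g y) \<le> 1" using app[of 1] by auto
    have "(f - g) + g \<in> fibre_l2 \<Lambda> 0" using main[OF g] Cl2[OF g(1)] by (intro fibre_l2_add) auto
    moreover have "\<exists>g\<in>Cc ?T. mod_norm \<Lambda> 0 (f - g) < e" if e: "e > 0" for e
    proof -
      obtain g where g: "g \<in> Cc ?T" "\<forall>y. norm (f y - g y) \<le> e/2" using app[of "e/2"] e by auto
      then show ?thesis using main[OF g] e by (intro bexI[OF _ g(1)]) auto
    qed
    ultimately show "f \<in> X \<Lambda> 0" using Cc by (simp add: X_def)
  qed
qed

end

theory Submission
  imports Defs
begin

text \<open>
  For morphisms \<open>l, m\<close> with the same source, exchanging the initial segment \<open>l\<close> of a boundary path for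
  \<open>m\<close> is a homeomorphism of cylinders.  If \<open>f\<close> and \<open>g\<close> are supported in the cylinders of \<open>l\<close> and \<open>m\<close>,
  both of degree \<open>p\<close>, then \<open>\<Theta>\<^bsub>f,g\<^esub>\<close> has the form \<open>h \<mapsto> c \<cdot> (h \<circ> swap l m)\<close>, a formula which makes sense on
  every \<open>X\<^bsub>q\<^esub>\<close> with \<open>p \<le> q\<close>.  Finite sums of such operators (\<open>ops p\<close>) are dense in \<open>\<K>(X\<^bsub>p\<^esub>)\<close>, and they act
  fibre by fibre over \<open>\<partial>\<Lambda>\<close>, so their norm on \<open>X\<^bsub>q\<^esub>\<close> is at most their norm on \<open>X\<^bsub>p\<^esub>\<close>; hence \<open>\<iota>(S)\<close> is a norm
  limit of elements of \<open>ops p\<close>.  Finally, if \<open>A \<in> ops m\<close> and \<open>B \<in> ops n\<close>, the intersection of two cylinders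
  is the finite disjoint union of the cylinders of the minimal common extensions, and this writes \<open>A B\<close> as
  an element of \<open>ops (sup m n)\<close>.
\<close>

text \<open>\<open>X \<Lambda> q\<close> is a space of functions and is not treated as a tensor
  product, so \<open>\<iota>(S)\<close> has no ready formula \<open>S \<otimes> 1\<close>;
  \<open>iota\<close> is a definite description, and existence and uniqueness both have to be
  proved. Elementary operators supply existence: their formula mentions no \<open>q\<close>, they
  commute with multiplication by \<open>g (shift p y)\<close>, and their adjoints are of the same
  kind. The obstacle is the norm. An approximation of \<open>S\<close> is controlled only on
  \<open>X \<Lambda> p\<close>, so the bound on \<open>X \<Lambda> q\<close> comes from realising
  finitely many values on one fibre of \<open>shift p\<close> by an element of
  \<open>X \<Lambda> p\<close> (\<open>test_function\<close>). Finite alignment enters in three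
  places: exchanging a segment must give a boundary path again, for which a finite exhaustive set is
  transported along a morphism; preimages of cylinders under \<open>swap\<close> must be finite
  unions, for continuity; and the sum that expresses a product must be finite. Degree 0, where
  \<open>iota\<close> is defined by a multiplier, is brought back to the general case by
  uniqueness.\<close>

locale aligned_kgraph =
  fixes \<Lambda> :: "('a, 'k::finite) kgraph"
  assumes kg: "k_graph \<Lambda>" and fa: "finitely_aligned \<Lambda>"
begin

abbreviation cyl :: "'a \<Rightarrow> ('a, 'k) path set" where "cyl \<equiv> cylinder \<Lambda>"
abbreviation dg :: "'a \<Rightarrow> 'k \<Rightarrow> nat" where "dg \<equiv> deg \<Lambda>"
abbreviation nrm :: "('k \<Rightarrow> nat) \<Rightarrow> (('a, 'k) path \<Rightarrow> complex) \<Rightarrow> real" where "nrm \<equiv> mod_norm \<Lambda>"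

section \<open>Factorisations of morphisms\<close>

lemma category_rules:
  assumes "l \<in> mor \<Lambda>"
  shows "rng \<Lambda> l \<in> mor \<Lambda>" "src \<Lambda> l \<in> mor \<Lambda>" "rng \<Lambda> (rng \<Lambda> l) = rng \<Lambda> l"
    "src \<Lambda> (rng \<Lambda> l) = rng \<Lambda> l" "rng \<Lambda> (src \<Lambda> l) = src \<Lambda> l" "src \<Lambda> (src \<Lambda> l) = src \<Lambda> l"
    "cmp \<Lambda> (rng \<Lambda> l) l = l" "cmp \<Lambda> l (src \<Lambda> l) = l"
    "dg (rng \<Lambda> l) = 0" "dg (src \<Lambda> l) = 0"
  using kg assms unfolding k_graph_def is_category_def by blast+

lemma cmp_rules:
  assumes "l \<in> mor \<Lambda>" "m \<in> mor \<Lambda>" "src \<Lambda> l = rng \<Lambda> m"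
  shows "cmp \<Lambda> l m \<in> mor \<Lambda>" "rng \<Lambda> (cmp \<Lambda> l m) = rng \<Lambda> l" "src \<Lambda> (cmp \<Lambda> l m) = src \<Lambda> m"
    "dg (cmp \<Lambda> l m) = dg l + dg m"
  using kg assms unfolding k_graph_def is_category_def by blast+

lemma cmp_assoc:
  assumes "l \<in> mor \<Lambda>" "m \<in> mor \<Lambda>" "n \<in> mor \<Lambda>" "src \<Lambda> l = rng \<Lambda> m" "src \<Lambda> m = rng \<Lambda> n"
  shows "cmp \<Lambda> (cmp \<Lambda> l m) n = cmp \<Lambda> l (cmp \<Lambda> m n)"
  using kg assms unfolding k_graph_def is_category_def by blast

lemma factor_unique:
  assumes "a \<in> mor \<Lambda>" "b \<in> mor \<Lambda>" "a' \<in> mor \<Lambda>" "b' \<in> mor \<Lambda>" "dg a = dg a'"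
    "src \<Lambda> a = rng \<Lambda> b" "src \<Lambda> a' = rng \<Lambda> b'" "cmp \<Lambda> a b = cmp \<Lambda> a' b'"
  shows "a = a'" "b = b'"
proof -
  have "dg a + dg b = dg a + dg b'"
    using cmp_rules(4)[of a b] cmp_rules(4)[of a' b'] assms by simp
  then have "dg b = dg b'" by (simp add: fun_eq_iff)
  let ?P = "\<lambda>p. fst p \<in> mor \<Lambda> \<and> snd p \<in> mor \<Lambda> \<and> dg (fst p) = dg a \<and> dg (snd p) = dg b
             \<and> src \<Lambda> (fst p) = rng \<Lambda> (snd p) \<and> cmp \<Lambda> a b = cmp \<Lambda> (fst p) (snd p)"
  have "\<exists>!p. ?P p" using kg cmp_rules[OF assms(1,2,6)] unfolding k_graph_def by blast
  moreover have "?P (a, b)" "?P (a', b')" using assms \<open>dg b = dg b'\<close> by auto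
  ultimately have "(a, b) = (a', b')" by blast
  then show "a = a'" "b = b'" by auto
qed

lemma factor_exists:
  assumes "l \<in> mor \<Lambda>" "n \<le> dg l"
  obtains a b where "a \<in> mor \<Lambda>" "b \<in> mor \<Lambda>" "dg a = n" "src \<Lambda> a = rng \<Lambda> b" "l = cmp \<Lambda> a b"
proof -
  have "dg l = n + (dg l - n)" using assms(2) by (auto simp: fun_eq_iff le_fun_def)
  then have "\<exists>!p. fst p \<in> mor \<Lambda> \<and> snd p \<in> mor \<Lambda> \<and> dg (fst p) = n \<and> dg (snd p) = dg l - n
             \<and> src \<Lambda> (fst p) = rng \<Lambda> (snd p) \<and> l = cmp \<Lambda> (fst p) (snd p)"
    using kg assms(1) unfolding k_graph_def by blast
  then show thesis using that by blast
qed

text \<open>The factorisation order. By unique factorisation \<open>l\<close> has exactly one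
  initial segment of each degree below \<open>dg l\<close>, and the cylinder computations are
  reduced to this.\<close>

definition prefix_of :: "'a \<Rightarrow> 'a \<Rightarrow> bool" where
  "prefix_of a l \<longleftrightarrow> a \<in> mor \<Lambda> \<and> (\<exists>b\<in>mor \<Lambda>. src \<Lambda> a = rng \<Lambda> b \<and> l = cmp \<Lambda> a b)"

lemma prefix_of_mor: "prefix_of a l \<Longrightarrow> a \<in> mor \<Lambda>" "prefix_of a l \<Longrightarrow> l \<in> mor \<Lambda>"
  unfolding prefix_of_def using cmp_rules by blast+

lemma prefix_of_deg: "prefix_of a l \<Longrightarrow> dg a \<le> dg l"
  unfolding prefix_of_def using cmp_rules(4) by (auto simp: le_fun_def)

lemma prefix_of_trans:
  assumes "prefix_of a b" "prefix_of b c" shows "prefix_of a c"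
proof -
  from assms obtain u v where *: "a \<in> mor \<Lambda>" "u \<in> mor \<Lambda>" "src \<Lambda> a = rng \<Lambda> u" "b = cmp \<Lambda> a u"
    "v \<in> mor \<Lambda>" "src \<Lambda> b = rng \<Lambda> v" "c = cmp \<Lambda> b v" unfolding prefix_of_def by blast
  then have "src \<Lambda> u = rng \<Lambda> v" using cmp_rules(3)[of a u] by simp
  then have "cmp \<Lambda> u v \<in> mor \<Lambda>" "src \<Lambda> a = rng \<Lambda> (cmp \<Lambda> u v)" "c = cmp \<Lambda> a (cmp \<Lambda> u v)"
    using * cmp_rules[of u v] cmp_assoc[of a u v] by auto
  then show ?thesis using * unfolding prefix_of_def by blast
qed

lemma prefix_of_refl: "a \<in> mor \<Lambda> \<Longrightarrow> prefix_of a a"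
  unfolding prefix_of_def using category_rules by metis

lemma prefix_of_eq: "prefix_of a l \<Longrightarrow> prefix_of b l \<Longrightarrow> dg a = dg b \<Longrightarrow> a = b"
  unfolding prefix_of_def using factor_unique(1) by blast

lemma prefix_of_exists:
  assumes "l \<in> mor \<Lambda>" "n \<le> dg l" obtains a where "prefix_of a l" "dg a = n"
  using factor_exists[OF assms] prefix_of_def by metis

text \<open>Cutting \<open>b\<close> at degree \<open>dg a\<close> yields an initial segment of
  \<open>l\<close> of that degree, and there is only one.\<close>

lemma prefix_of_le:
  assumes "prefix_of a l" "prefix_of b l" "dg a \<le> dg b" shows "prefix_of a b"
proof -
  obtain c where c: "prefix_of c b" "dg c = dg a"
    using prefix_of_exists[OF _ assms(3)] assms prefix_of_mor by metis
  then have "c = a" using prefix_of_eq[of c l a] prefix_of_trans assms by blast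
  then show ?thesis using c by simp
qed

lemma prefix_of_cmp: "a \<in> mor \<Lambda> \<Longrightarrow> b \<in> mor \<Lambda> \<Longrightarrow> src \<Lambda> a = rng \<Lambda> b \<Longrightarrow> prefix_of a (cmp \<Lambda> a b)"
  unfolding prefix_of_def by blast

lemma prefix_of_cmp_iff:
  assumes "l \<in> mor \<Lambda>" "a \<in> mor \<Lambda>" "b \<in> mor \<Lambda>" "src \<Lambda> l = rng \<Lambda> a" "src \<Lambda> l = rng \<Lambda> b"
  shows "prefix_of (cmp \<Lambda> l a) (cmp \<Lambda> l b) \<longleftrightarrow> prefix_of a b"
proof
  assume "prefix_of (cmp \<Lambda> l a) (cmp \<Lambda> l b)"
  then obtain u where u: "u \<in> mor \<Lambda>" "src \<Lambda> (cmp \<Lambda> l a) = rng \<Lambda> u" "cmp \<Lambda> l b = cmp \<Lambda> (cmp \<Lambda> l a) u"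
    unfolding prefix_of_def by blast
  then have su: "src \<Lambda> a = rng \<Lambda> u" using cmp_rules assms by simp
  then have "cmp \<Lambda> l b = cmp \<Lambda> l (cmp \<Lambda> a u)" using u cmp_assoc assms by simp
  then have "b = cmp \<Lambda> a u"
    using factor_unique(2)[of l b l "cmp \<Lambda> a u"] assms cmp_rules[OF assms(2) u(1) su] by simp
  then show "prefix_of a b" using assms u su unfolding prefix_of_def by blast
next
  assume "prefix_of a b"
  then obtain u where u: "u \<in> mor \<Lambda>" "src \<Lambda> a = rng \<Lambda> u" "b = cmp \<Lambda> a u"
    unfolding prefix_of_def by blast
  then have "cmp \<Lambda> l b = cmp \<Lambda> (cmp \<Lambda> l a) u" "src \<Lambda> (cmp \<Lambda> l a) = rng \<Lambda> u" "cmp \<Lambda> l a \<in> mor \<Lambda>"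
    using cmp_assoc assms cmp_rules[of l a] by auto
  then show "prefix_of (cmp \<Lambda> l a) (cmp \<Lambda> l b)" using u unfolding prefix_of_def by blast
qed

text \<open>The initial segment of \<open>t\<close> of degree \<open>sup (dg l) (dg m)\<close> has
  both \<open>l\<close> and \<open>m\<close> as initial segments, hence it is a minimal common
  extension.\<close>

lemma min_ext_prefix:
  assumes "prefix_of l t" "prefix_of m t"
  obtains \<alpha> \<beta> where "(\<alpha>, \<beta>) \<in> min_ext \<Lambda> l m" "prefix_of (cmp \<Lambda> l \<alpha>) t"
proof -
  have "sup (dg l) (dg m) \<le> dg t" using assms prefix_of_deg by simp
  then obtain u where u: "prefix_of u t" "dg u = sup (dg l) (dg m)"
    using prefix_of_exists assms prefix_of_mor(2) by metis
  have "prefix_of l u" "prefix_of m u"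
    using prefix_of_le[OF assms(1) u(1)] prefix_of_le[OF assms(2) u(1)] u(2) by simp_all
  then obtain \<alpha> \<beta> where "\<alpha> \<in> mor \<Lambda>" "src \<Lambda> l = rng \<Lambda> \<alpha>" "u = cmp \<Lambda> l \<alpha>"
     "\<beta> \<in> mor \<Lambda>" "src \<Lambda> m = rng \<Lambda> \<beta>" "u = cmp \<Lambda> m \<beta>" unfolding prefix_of_def by blast
  then have "(\<alpha>, \<beta>) \<in> min_ext \<Lambda> l m" "prefix_of (cmp \<Lambda> l \<alpha>) t"
    using u unfolding min_ext_def by auto
  then show thesis by (rule that)
qed

lemma min_extD:
  assumes "(\<alpha>, \<beta>) \<in> min_ext \<Lambda> l m"
  shows "\<alpha> \<in> mor \<Lambda>" "\<beta> \<in> mor \<Lambda>" "src \<Lambda> l = rng \<Lambda> \<alpha>" "src \<Lambda> m = rng \<Lambda> \<beta>" "cmp \<Lambda> l \<alpha> = cmp \<Lambda> m \<beta>"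
    "dg (cmp \<Lambda> l \<alpha>) = sup (dg l) (dg m)"
  using assms unfolding min_ext_def by blast+

lemma finite_min_ext: "l \<in> mor \<Lambda> \<Longrightarrow> m \<in> mor \<Lambda> \<Longrightarrow> finite (min_ext \<Lambda> l m)"
  using fa unfolding finitely_aligned_def by blast

section \<open>Concatenation and shift of boundary paths\<close>

lemma env_0: "env 0 \<le> x" by (simp add: le_fun_def env_def zero_enat_def[symmetric])

lemma nat_fun_ge_0: "(0::'b \<Rightarrow> nat) \<le> p" by (simp add: le_fun_def)

lemmas path_prefixD = pathsD[OF _ nat_fun_ge_0]

lemma path_prefix_deg: "x \<in> paths \<Lambda> \<Longrightarrow> env q \<le> fst x \<Longrightarrow> dg (snd x (0, q)) = q"
  using path_prefixD(4)[of x \<Lambda> q] by (simp add: fun_eq_iff)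

lemma path_prefix_le:
  assumes "x \<in> paths \<Lambda>" "p \<le> q" "env q \<le> fst x"
  shows "prefix_of (snd x (0, p)) (snd x (0, q))"
proof -
  have p: "env p \<le> fst x" using assms env_le_trans by blast
  show ?thesis unfolding prefix_of_def
    using paths_cmp[OF assms(1) nat_fun_ge_0 assms(2,3)] pathsD[OF assms] path_prefixD[OF assms(1) p]
    by (intro conjI bexI[of _ "snd x (p, q)"]) simp_all
qed

lemma path_eqI:
  assumes x: "x \<in> paths \<Lambda>" and y: "y \<in> paths \<Lambda>" and m: "fst x = fst y"
    and eq: "\<And>t. env t \<le> fst x \<Longrightarrow> snd x (0, t) = snd y (0, t)"
  shows "x = y"
proof -
  have "snd x (p, q) = snd y (p, q)" for p q
  proof (cases "(p, q) \<in> mor (Omega (fst x))")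
    case True
    then have pq: "p \<le> q" "env q \<le> fst x" by (auto simp: Omega_def)
    show ?thesis using snd_path_eqI[OF kg x y m pq(2) eq[OF pq(2)] pq(1) order_refl] .
  next
    case False
    then show ?thesis using x y m by (auto simp: paths_def extensional_def)
  qed
  then show ?thesis using m by (auto simp: prod_eq_iff)
qed

text \<open>Left cancellation makes the segment from \<open>p\<close> to \<open>q\<close> the unique
  \<open>b\<close> with \<open>u q = u p b\<close>, and functoriality follows from the same
  uniqueness. So a path may be prescribed by its initial segments alone, which is how
  \<open>concat_exists\<close> builds one.\<close>

lemma path_from_prefixes:
  assumes u: "\<And>t. env t \<le> m \<Longrightarrow> dg (u t) = t"
    and pre: "\<And>s t. s \<le> t \<Longrightarrow> env t \<le> m \<Longrightarrow> prefix_of (u s) (u t)"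
  obtains x where "x \<in> paths \<Lambda>" "fst x = m" "\<And>t. env t \<le> m \<Longrightarrow> snd x (0, t) = u t"
proof -
  define f where "f = (\<lambda>(p, q). SOME b. b \<in> mor \<Lambda> \<and> src \<Lambda> (u p) = rng \<Lambda> b \<and> u q = cmp \<Lambda> (u p) b)"
  define x where "x = (m, restrict f (mor (Omega m)))"
  have f: "f (p, q) \<in> mor \<Lambda> \<and> src \<Lambda> (u p) = rng \<Lambda> (f (p, q)) \<and> u q = cmp \<Lambda> (u p) (f (p, q))"
    if "p \<le> q" "env q \<le> m" for p q
    using someI_ex[of "\<lambda>b. b \<in> mor \<Lambda> \<and> src \<Lambda> (u p) = rng \<Lambda> b \<and> u q = cmp \<Lambda> (u p) b"]
      pre[OF that] unfolding prefix_of_def f_def by auto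
  have um: "u t \<in> mor \<Lambda>" if "env t \<le> m" for t using pre[OF order_refl that] prefix_of_mor by blast
  have fu: "f (p, q) = b" if "p \<le> q" "env q \<le> m" "b \<in> mor \<Lambda>" "src \<Lambda> (u p) = rng \<Lambda> b" "u q = cmp \<Lambda> (u p) b" for p q b
    using factor_unique(2)[of "u p" "f (p, q)" "u p" b] f[OF that(1,2)] that um env_le_trans[OF that(1,2)] by simp
  have id: "f (p, p) = src \<Lambda> (u p)" if "env p \<le> m" for p
    using fu[OF order_refl that] category_rules[OF um[OF that]] by simp
  have deg: "dg (f (p, q)) = q - p" if "p \<le> q" "env q \<le> m" for p q
  proof -
    have p: "env p \<le> m" using that env_le_trans by blast
    have "q = p + dg (f (p, q))" using cmp_rules(4)[OF um[OF p]] f[OF that] u that p by metis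
    then show ?thesis by (metis add_diff_cancel_left')
  qed
  have src: "src \<Lambda> (f (p, q)) = src \<Lambda> (u q)" if "p \<le> q" "env q \<le> m" for p q
    using cmp_rules(3)[OF um[OF env_le_trans[OF that]]] f[OF that] by simp
  have cmp: "f (p, r) = cmp \<Lambda> (f (p, q)) (f (q, r))" if "p \<le> q" "q \<le> r" "env r \<le> m" for p q r
  proof (rule fu)
    note q = env_le_trans[OF that(2,3)] note p = env_le_trans[OF that(1) q]
    note a = f[OF that(1) q] note b = f[OF that(2,3)]
    have s: "src \<Lambda> (f (p, q)) = rng \<Lambda> (f (q, r))" using src[OF that(1) q] b by simp
    show "cmp \<Lambda> (f (p, q)) (f (q, r)) \<in> mor \<Lambda>" "src \<Lambda> (u p) = rng \<Lambda> (cmp \<Lambda> (f (p, q)) (f (q, r)))"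
      using cmp_rules[OF _ _ s] a b by auto
    show "u r = cmp \<Lambda> (u p) (cmp \<Lambda> (f (p, q)) (f (q, r)))"
      using cmp_assoc[OF um[OF p] _ _ _ s] a b by simp
  qed (use that in auto)
  have "graph_morphism (Omega m) \<Lambda> (restrict f (mor (Omega m)))"
    unfolding graph_morphism_def
  proof (intro conjI ballI impI)
    fix e assume e0: "e \<in> mor (Omega m)"
    then obtain p q where e: "e = (p, q)" "p \<le> q" "env q \<le> m" by (auto simp: Omega_def)
    have pm: "env p \<le> m" using e(2,3) by (rule env_le_trans)
    have mem: "(p, q) \<in> mor (Omega m)" "(p, p) \<in> mor (Omega m)" "(q, q) \<in> mor (Omega m)"
      using e pm by (auto simp: Omega_def)
    have R: "rng (Omega m) e = (p, p)" "src (Omega m) e = (q, q)" "deg (Omega m) e = q - p"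
      using e by (auto simp: Omega_def)
    let ?x = "restrict f (mor (Omega m))"
    show "?x e \<in> mor \<Lambda>" "rng \<Lambda> (?x e) = ?x (rng (Omega m) e)" "src \<Lambda> (?x e) = ?x (src (Omega m) e)"
      "dg (?x e) = deg (Omega m) e"
      unfolding R using mem f[OF e(2,3)] id[OF pm] id[OF e(3)] src[OF e(2,3)] deg[OF e(2,3)] by (simp_all add: e(1))
    fix g assume "g \<in> mor (Omega m)" "src (Omega m) e = rng (Omega m) g"
    then obtain t where g: "g = (q, t)" "q \<le> t" "env t \<le> m" using e by (auto simp: Omega_def)
    have "(q, t) \<in> mor (Omega m)" "(p, t) \<in> mor (Omega m)" "cmp (Omega m) e g = (p, t)"
      using e g by (auto simp: Omega_def)
    then show "?x (cmp (Omega m) e g) = cmp \<Lambda> (?x e) (?x g)"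
      using cmp[OF e(2) g(2,3)] mem e g by simp
  qed
  then have "x \<in> paths \<Lambda>" unfolding x_def paths_def by auto
  moreover have "snd x (0, t) = u t" if t: "env t \<le> m" for t
  proof -
    \<comment> \<open>Degree 0 makes \<open>u 0\<close> a vertex, so the factor completing it to
      \<open>u t\<close> is \<open>u t\<close> itself.\<close>
    have "dg (u 0) = 0" using u[OF env_0] .
    then have "u 0 = rng \<Lambda> (u 0)" using deg_zero_iff_identity[OF kg um[OF env_0]] by simp
    then have "src \<Lambda> (u 0) = u 0" "u 0 = rng \<Lambda> (u 0)" using category_rules[OF um[OF env_0]] by metis+
    moreover have "prefix_of (u 0) (u t)" using pre[OF nat_fun_ge_0 t] .
    then have "rng \<Lambda> (u t) = rng \<Lambda> (u 0)" unfolding prefix_of_def using cmp_rules by metis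
    ultimately have "f (0, t) = u t"
      by (intro fu) (use t um[OF t] category_rules[OF um[OF t]] in \<open>auto simp: nat_fun_ge_0\<close>)
    then show ?thesis using t by (simp add: x_def Omega_def nat_fun_ge_0)
  qed
  ultimately show thesis using that[of x] by (simp add: x_def)
qed

lemma cylinderD:
  assumes "y \<in> cyl l"
  shows "y \<in> boundary \<Lambda>" "y \<in> paths \<Lambda>" "env (dg l) \<le> fst y" "snd y (0, dg l) = l" "l \<in> mor \<Lambda>"
    "y \<in> boundary_ge \<Lambda> (dg l)"
proof -
  show *: "y \<in> boundary \<Lambda>" "y \<in> paths \<Lambda>" "env (dg l) \<le> fst y" "snd y (0, dg l) = l"
    "y \<in> boundary_ge \<Lambda> (dg l)"
    using assms unfolding cylinder_def boundary_def boundary_ge_def by auto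
  show "l \<in> mor \<Lambda>" using path_prefixD(1)[OF *(2,3)] *(4) by simp
qed

lemma cylinder_iff_prefix:
  assumes "y \<in> boundary \<Lambda>" "env q \<le> fst y" "dg l \<le> q"
  shows "y \<in> cyl l \<longleftrightarrow> prefix_of l (snd y (0, q))"
proof -
  have p: "y \<in> paths \<Lambda>" using assms unfolding boundary_def by simp
  have e: "env (dg l) \<le> fst y" using assms env_le_trans by blast
  have *: "prefix_of (snd y (0, dg l)) (snd y (0, q))" using path_prefix_le[OF p assms(3,2)] .
  have "prefix_of l (snd y (0, q)) \<Longrightarrow> snd y (0, dg l) = l"
    using prefix_of_eq[OF *] path_prefix_deg[OF p e] by simp
  then show ?thesis using * e assms unfolding cylinder_def by auto
qed

lemma cylinder_mono:
  assumes "prefix_of l m" "y \<in> cyl m" shows "y \<in> cyl l"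
  using cylinder_iff_prefix[OF cylinderD(1,3)[OF assms(2)] prefix_of_deg[OF assms(1)]]
    cylinderD(4)[OF assms(2)] assms(1) by simp

lemma env_sup: "env (sup p q) \<le> x \<longleftrightarrow> env p \<le> x \<and> env q \<le> x"
proof -
  have "enat (max a b) \<le> c \<longleftrightarrow> enat a \<le> c \<and> enat b \<le> c" for a b c by (cases c) auto
  then show ?thesis by (simp add: env_def le_fun_def sup_max all_conj_distrib)
qed

text \<open>A path in both cylinders has \<open>l\<close> and \<open>m\<close> as initial segments
  of its segment of degree \<open>sup (dg l) (dg m)\<close>, and that segment is the common
  extension. All these extensions have the same degree, so the union is disjoint;
  \<open>Op_product\<close> depends on this.\<close>

lemma cylinder_Int:
  assumes lm: "l \<in> mor \<Lambda>" "m \<in> mor \<Lambda>"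
  shows "cyl l \<inter> cyl m = (\<Union>(\<alpha>, \<beta>)\<in>min_ext \<Lambda> l m. cyl (cmp \<Lambda> l \<alpha>))"
proof (intro equalityI subsetI)
  fix y assume y: "y \<in> cyl l \<inter> cyl m"
  let ?q = "sup (dg l) (dg m)"
  have q: "env ?q \<le> fst y" "y \<in> boundary \<Lambda>" using y cylinderD unfolding env_sup by blast+
  have "prefix_of l (snd y (0, ?q))" "prefix_of m (snd y (0, ?q))"
    using y cylinder_iff_prefix[OF q(2,1)] by auto
  then obtain \<alpha> \<beta> where ab: "(\<alpha>, \<beta>) \<in> min_ext \<Lambda> l m" "prefix_of (cmp \<Lambda> l \<alpha>) (snd y (0, ?q))"
    by (rule min_ext_prefix)
  then have "y \<in> cyl (cmp \<Lambda> l \<alpha>)"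
    using cylinder_iff_prefix[OF q(2,1)] min_extD(6)[OF ab(1)] by simp
  then show "y \<in> (\<Union>(\<alpha>, \<beta>)\<in>min_ext \<Lambda> l m. cyl (cmp \<Lambda> l \<alpha>))" using ab by blast
next
  fix y assume "y \<in> (\<Union>(\<alpha>, \<beta>)\<in>min_ext \<Lambda> l m. cyl (cmp \<Lambda> l \<alpha>))"
  then obtain \<alpha> \<beta> where ab: "(\<alpha>, \<beta>) \<in> min_ext \<Lambda> l m" and y: "y \<in> cyl (cmp \<Lambda> l \<alpha>)" by blast
  note D = min_extD[OF ab]
  have "prefix_of l (cmp \<Lambda> l \<alpha>)" "prefix_of m (cmp \<Lambda> l \<alpha>)"
    using D lm prefix_of_cmp[of l \<alpha>] prefix_of_cmp[of m \<beta>] by simp_all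
  then show "y \<in> cyl l \<inter> cyl m" using y cylinder_mono by blast
qed

lemma shift_eq:
  assumes "y \<in> boundary_ge \<Lambda> n"
  shows "fst (shift n y) = fst y - env n"
    "p \<le> q \<Longrightarrow> env (q + n) \<le> fst y \<Longrightarrow> snd (shift n y) (p, q) = snd y (p + n, q + n)"
  using assms env_diff_le_iff[of n "fst y" q]
  unfolding boundary_ge_def by (auto simp: shift_def Let_def Omega_def)

lemma env_add: "env (p + n) = env p + env n"
  by (simp add: env_def fun_eq_iff)

lemma env_le_add: "env n \<le> env n + x"
  by (simp add: le_fun_def)

lemma env_add_diff: "env n + x - env n = x"
proof
  fix i show "(env n + x - env n) i = x i" by (cases "x i") (auto simp: env_def)
qed

lemma shift_shift:
  assumes "y \<in> boundary_ge \<Lambda> (m + n)"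
  shows "y \<in> boundary_ge \<Lambda> m" "shift m y \<in> boundary_ge \<Lambda> n" "shift n (shift m y) = shift (m + n) y"
proof -
  have e: "env (m + n) \<le> fst y" "y \<in> boundary \<Lambda>" using assms by (auto simp: boundary_ge_def)
  have "m \<le> m + n" by (simp add: le_fun_def)
  then have em: "env m \<le> fst y" using e env_le_trans by blast
  then show y: "y \<in> boundary_ge \<Lambda> m" using e by (auto simp: boundary_ge_def)
  have "env (n + m) \<le> fst y" using e by (simp add: add.commute)
  then have "env n \<le> fst (shift m y)" using shift_eq(1)[OF y] env_diff_le_iff[OF em] by simp
  then show y2: "shift m y \<in> boundary_ge \<Lambda> n" using shift_in_boundary[OF y] by (auto simp: boundary_ge_def)
  show "shift n (shift m y) = shift (m + n) y"
  proof (rule path_eqI)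
    show "shift n (shift m y) \<in> paths \<Lambda>" "shift (m + n) y \<in> paths \<Lambda>"
      using shift_in_boundary[OF y2] shift_in_boundary[OF assms] by (auto simp: boundary_def)
    show f: "fst (shift n (shift m y)) = fst (shift (m + n) y)"
    proof
      fix i show "fst (shift n (shift m y)) i = fst (shift (m + n) y) i"
        unfolding shift_eq(1)[OF y2] shift_eq(1)[OF y] shift_eq(1)[OF assms]
        by (cases "fst y i") (auto simp: env_def)
    qed
    fix t assume "env t \<le> fst (shift n (shift m y))"
    then have 1: "env (t + n) \<le> fst (shift m y)"
      using env_diff_le_iff[of n "fst (shift m y)" t] y2 shift_eq(1)[OF y2] by (simp add: boundary_ge_def)
    then have 2: "env (t + n + m) \<le> fst y"
      using env_diff_le_iff[OF em, of "t + n"] shift_eq(1)[OF y] by simp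
    have 3: "env (t + (m + n)) \<le> fst y" using 2 by (simp add: add_ac)
    have 4: "n \<le> t + n" by (simp add: le_fun_def)
    show "snd (shift n (shift m y)) (0, t) = snd (shift (m + n) y) (0, t)"
      using shift_eq(2)[OF y2 nat_fun_ge_0 1] shift_eq(2)[OF y 4 2] shift_eq(2)[OF assms nat_fun_ge_0 3]
      by (simp add: add_ac)
  qed
qed

lemma path_split:
  assumes y: "y \<in> boundary_ge \<Lambda> n" and t: "env (t + n) \<le> fst y"
  shows "snd y (0, t + n) = cmp \<Lambda> (snd y (0, n)) (snd (shift n y) (0, t))"
    "env t \<le> fst (shift n y)"
proof -
  have p: "y \<in> paths \<Lambda>" using y by (auto simp: boundary_ge_def boundary_def)
  have "n \<le> t + n" by (simp add: le_fun_def)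
  then show "snd y (0, t + n) = cmp \<Lambda> (snd y (0, n)) (snd (shift n y) (0, t))"
    using paths_cmp[OF p nat_fun_ge_0 _ t] shift_eq(2)[OF y nat_fun_ge_0 t] by simp
  show "env t \<le> fst (shift n y)"
    using env_diff_le_iff[of n "fst y" t] t shift_eq(1)[OF y] y by (simp add: boundary_ge_def)
qed

lemma shift_in_cylinder_src:
  assumes "y \<in> cyl l" shows "shift (dg l) y \<in> cyl (src \<Lambda> l)"
proof -
  note D = cylinderD[OF assms]
  have s: "snd (shift (dg l) y) (0, 0) = snd y (dg l, dg l)"
    using shift_eq(2)[OF D(6), of 0 0] D(3) by simp
  also have "\<dots> = src \<Lambda> l" using path_prefixD(3)[OF D(2,3)] D(4) by simp
  finally show ?thesis
    using shift_in_boundary[OF D(6)] category_rules(10)[OF D(5)] env_0 by (simp add: cylinder_def)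
qed

text \<open>Unique factorisation cancels \<open>l\<close> from
  \<open>y(0, d(l) + d(m)) = l m\<close>.\<close>

lemma cylinder_cmp:
  assumes "l \<in> mor \<Lambda>" "m \<in> mor \<Lambda>" "src \<Lambda> l = rng \<Lambda> m"
  shows "y \<in> cyl (cmp \<Lambda> l m) \<longleftrightarrow> y \<in> cyl l \<and> shift (dg l) y \<in> cyl m"
proof (cases "y \<in> cyl l")
  case True
  note D = cylinderD[OF True] note c = cmp_rules[OF assms]
  have e: "env (dg m) \<le> fst (shift (dg l) y) \<longleftrightarrow> env (dg m + dg l) \<le> fst y"
    unfolding shift_eq(1)[OF D(6)] using env_diff_le_iff[OF D(3)] .
  have b: "shift (dg l) y \<in> boundary \<Lambda>" using shift_in_boundary[OF D(6)] .
  show ?thesis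
  proof (cases "env (dg m + dg l) \<le> fst y")
    case ge: True
    note sp = path_split[OF D(6) ge]
    have sh: "snd (shift (dg l) y) (0, dg m) \<in> mor \<Lambda>"
      "rng \<Lambda> (snd (shift (dg l) y) (0, dg m)) = src \<Lambda> l"
    proof -
      note s = cylinderD[OF shift_in_cylinder_src[OF True]]
      have "snd (shift (dg l) y) (0, 0) = src \<Lambda> l" using s(4) category_rules(10)[OF D(5)] by simp
      then show "snd (shift (dg l) y) (0, dg m) \<in> mor \<Lambda>"
        "rng \<Lambda> (snd (shift (dg l) y) (0, dg m)) = src \<Lambda> l"
        using path_prefixD(1,2)[OF s(2) sp(2)] by simp_all
    qed
    have "snd y (0, dg m + dg l) = cmp \<Lambda> l m \<longleftrightarrow> snd (shift (dg l) y) (0, dg m) = m"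
      unfolding sp(1) D(4) using factor_unique(2)[of l _ l m] sh assms by auto
    then show ?thesis using True ge e b D(1) by (simp add: cylinder_def c(4) add.commute)
  next
    case False
    then show ?thesis using e by (simp add: cylinder_def c(4) add.commute)
  qed
next
  case False
  then show ?thesis using cylinder_mono[OF prefix_of_cmp[OF assms]] by blast
qed

text \<open>The path \<open>y = l w\<close> is built from its initial segments. The hard part is
  that \<open>y\<close> is again a boundary path: a finite exhaustive set \<open>E\<close> at
  \<open>y(n)\<close>, with \<open>n\<close> perhaps not above \<open>dg l\<close>, is transported
  to the vertex of \<open>y\<close> at \<open>sup n (dg l)\<close>, which lies on \<open>w\<close>.
  The transported set is finite by finite alignment, and the boundary condition of \<open>w\<close>
  applies to it.\<close>

lemma concat_exists:
  assumes l: "l \<in> mor \<Lambda>" and w: "w \<in> cyl (src \<Lambda> l)"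
  shows "\<exists>y\<in>cyl l. shift (dg l) y = w"
proof -
  let ?d = "dg l"
  note W = cylinderD[OF w]
  have w0: "snd w (0, 0) = src \<Lambda> l" using W(4) category_rules(10)[OF l] by simp
  define U where "U t = cmp \<Lambda> l (snd w (0, t))" for t
  have Wm: "snd w (0, t) \<in> mor \<Lambda>" "rng \<Lambda> (snd w (0, t)) = src \<Lambda> l" if "env t \<le> fst w" for t
    using path_prefixD(1,2)[OF W(2) that] w0 by auto
  have U: "U t \<in> mor \<Lambda>" "dg (U t) = ?d + t" "prefix_of l (U t)" if "env t \<le> fst w" for t
    using cmp_rules[OF l Wm(1)[OF that]] Wm(2)[OF that] path_prefix_deg[OF W(2) that]
      prefix_of_cmp[OF l Wm(1)[OF that]] unfolding U_def by auto
  have Upre: "prefix_of (U s) (U t)" if "s \<le> t" "env t \<le> fst w" for s t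
  proof -
    note s = Wm[OF env_le_trans[OF that]] note t = Wm[OF that(2)]
    show ?thesis unfolding U_def
      using prefix_of_cmp_iff[OF l s(1) t(1) s(2)[symmetric] t(2)[symmetric]] path_prefix_le[OF W(2) that] by simp
  qed
  let ?M = "env ?d + fst w"
  \<comment> \<open>\<open>r t\<close> is how far \<open>w\<close> must be followed to reach
    \<open>sup t (dg l)\<close>; the truncated difference is exact since \<open>sup t ?d\<close>
    dominates \<open>?d\<close>.\<close>
  define r where "r t = sup t ?d - ?d" for t :: "'k \<Rightarrow> nat"
  have r: "?d + r t = sup t ?d" for t by (auto simp: r_def fun_eq_iff sup_max)
  have r_le: "env (r t) \<le> fst w" if "env t \<le> ?M" for t
  proof -
    have "env (r t + ?d) \<le> ?M" using that env_le_add[of ?d "fst w"] env_sup[of t ?d ?M] r[of t] by (simp add: add.commute)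
    then show ?thesis using env_diff_le_iff[OF env_le_add[of ?d "fst w"], of "r t"] env_add_diff[of ?d "fst w"] by simp
  qed
  \<comment> \<open>For \<open>t\<close> not above \<open>dg l\<close> the path has to be cut inside
    \<open>l\<close>: take the initial segment of degree \<open>t\<close> of the longer
    \<open>U (r t)\<close>.\<close>
  define u where "u t = (SOME a. prefix_of a (U (r t)) \<and> dg a = t)" for t
  have u: "prefix_of (u t) (U (r t)) \<and> dg (u t) = t" if "env t \<le> ?M" for t
  proof -
    have "t \<le> dg (U (r t))" using U(2)[OF r_le[OF that]] r[of t] by simp
    from prefix_of_exists[OF U(1)[OF r_le[OF that]] this]
    have "\<exists>a. prefix_of a (U (r t)) \<and> dg a = t" by blast
    then show ?thesis unfolding u_def by (rule someI_ex)
  qed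
  have "prefix_of (u s) (u t)" if st: "s \<le> t" "env t \<le> ?M" for s t
  proof -
    have s: "env s \<le> ?M" using st env_le_trans by blast
    have "r s \<le> r t"
    proof (rule le_funI)
      fix i have "s i \<le> t i" using st(1) by (rule le_funD)
      then show "r s i \<le> r t i" by (simp add: r_def) (intro diff_le_mono sup_mono order_refl)
    qed
    then have "prefix_of (u s) (U (r t))" using u[OF s] Upre r_le[OF st(2)] prefix_of_trans by blast
    then show ?thesis using prefix_of_le[of "u s" "U (r t)" "u t"] u[OF s] u[OF st(2)] st(1) by simp
  qed
  then obtain y where y: "y \<in> paths \<Lambda>" "fst y = ?M" "\<And>t. env t \<le> ?M \<Longrightarrow> snd y (0, t) = u t"
    using path_from_prefixes[of ?M u] u by metis
  have yU: "env (?d + t) \<le> ?M" "snd y (0, ?d + t) = U t" if t: "env t \<le> fst w" for t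
  proof -
    show e: "env (?d + t) \<le> ?M" using t by (simp add: env_add le_fun_def add_left_mono)
    have "r (?d + t) = t" by (auto simp: r_def fun_eq_iff sup_max)
    then have "prefix_of (u (?d + t)) (U t)" "dg (u (?d + t)) = ?d + t" using u[OF e] by auto
    then have "u (?d + t) = U t" using prefix_of_eq[OF _ prefix_of_refl] U[OF t] by simp
    then show "snd y (0, ?d + t) = U t" using y(3)[OF e] by simp
  qed
  have ydl: "snd y (0, ?d) = l" using yU(2)[OF env_0] w0 category_rules(8)[OF l] by (simp add: U_def)
  \<comment> \<open>Both segments complete \<open>U p\<close> to \<open>U q\<close>, so they agree
    by left cancellation.\<close>
  have seg: "snd y (?d + p, ?d + q) = snd w (p, q)" if pq: "p \<le> q" "env q \<le> fst w" for p q
  proof -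
    have p: "env p \<le> fst w" using pq env_le_trans by blast
    have pq': "?d + p \<le> ?d + q" using pq(1) by (simp add: le_fun_def)
    have eq: "cmp \<Lambda> (U p) (snd y (?d + p, ?d + q)) = U q"
      using paths_cmp[OF y(1) nat_fun_ge_0 pq'] yU[OF p] yU[OF pq(2)] y(2) by simp
    have "U q = cmp \<Lambda> l (cmp \<Lambda> (snd w (0, p)) (snd w (p, q)))"
      unfolding U_def using paths_cmp[OF W(2) nat_fun_ge_0 pq] by simp
    also have "\<dots> = cmp \<Lambda> (U p) (snd w (p, q))" unfolding U_def
      by (subst cmp_assoc[OF l]) (use Wm[OF p] pathsD[OF W(2) pq] path_prefixD[OF W(2) p] in auto)
    finally have eq': "U q = cmp \<Lambda> (U p) (snd w (p, q))" .
    have yq: "env (?d + q) \<le> fst y" using yU(1)[OF pq(2)] y(2) by simp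
    have yp: "env (?d + p) \<le> fst y" using yU(1)[OF p] y(2) by simp
    have s: "src \<Lambda> (U p) = rng \<Lambda> (snd y (?d + p, ?d + q))"
      using pathsD(2)[OF y(1) pq' yq] path_prefixD(3)[OF y(1) yp] yU(2)[OF p] by simp
    have s': "src \<Lambda> (U p) = rng \<Lambda> (snd w (p, q))"
      unfolding U_def using cmp_rules(3)[OF l Wm(1)[OF p]] Wm(2)[OF p] path_prefixD(3)[OF W(2) p] pathsD(2)[OF W(2) pq] by simp
    show ?thesis
      using factor_unique(2)[OF U(1)[OF p] _ U(1)[OF p] _ refl s s'] eq eq'
        pathsD(1)[OF y(1) pq' yq] pathsD(1)[OF W(2) pq] by simp
  qed
  have bd: "y \<in> boundary \<Lambda>" unfolding boundary_def
  proof (intro CollectI conjI allI impI ballI)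
    show "y \<in> paths \<Lambda>" by fact
    fix n E assume n: "env n \<le> fst y" and E: "E \<in> finite_exhaustive \<Lambda> (snd y (n, n))"
    have nM: "env n \<le> ?M" using n y(2) by simp
    let ?n = "?d + r n"
    define \<alpha> where "\<alpha> = snd y (n, ?n)"
    have n': "env ?n \<le> fst y" using yU(1)[OF r_le[OF nM]] y(2) by simp
    have nn: "n \<le> ?n" using r[of n] by simp
    have \<alpha>: "\<alpha> \<in> mor \<Lambda>" "rng \<Lambda> \<alpha> = snd y (n, n)" "src \<Lambda> \<alpha> = snd y (?n, ?n)" "dg \<alpha> = ?n - n"
      unfolding \<alpha>_def using pathsD[OF y(1) nn n'] by auto
    have Em: "\<mu> \<in> mor \<Lambda>" "rng \<Lambda> \<mu> = snd y (n, n)" if "\<mu> \<in> E" for \<mu>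
      using E that unfolding finite_exhaustive_def from_vertex_def by auto
    \<comment> \<open>The transport of \<open>E\<close> along \<open>\<alpha>\<close>: all tails
      that extend \<open>\<alpha>\<close> to a minimal common extension with some member of
      \<open>E\<close>.\<close>
    define E' where "E' = (\<Union>\<mu>\<in>E. fst ` min_ext \<Lambda> \<alpha> \<mu>)"
    have "E' \<in> finite_exhaustive \<Lambda> (src \<Lambda> \<alpha>)"
      unfolding finite_exhaustive_def
    proof (intro CollectI conjI ballI)
      show "E' \<subseteq> from_vertex \<Lambda> (src \<Lambda> \<alpha>)" unfolding E'_def from_vertex_def using min_extD by fastforce
      show "finite E'" unfolding E'_def using E Em finite_min_ext[OF \<alpha>(1)]
        by (auto simp: finite_exhaustive_def)
      fix \<tau> assume "\<tau> \<in> from_vertex \<Lambda> (src \<Lambda> \<alpha>)"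
      then have \<tau>: "\<tau> \<in> mor \<Lambda>" "src \<Lambda> \<alpha> = rng \<Lambda> \<tau>" by (auto simp: from_vertex_def)
      note at = cmp_rules[OF \<alpha>(1) \<tau>]
      \<comment> \<open>Exhaustiveness of \<open>E\<close> is applied to
        \<open>\<alpha> \<tau>\<close>. The common extension found there contains a minimal one of
        \<open>\<alpha>\<close> and \<open>\<mu>\<close>, and the tail \<open>\<beta>\<close> of the
        latter is compatible with \<open>\<tau>\<close>.\<close>
      have "cmp \<Lambda> \<alpha> \<tau> \<in> from_vertex \<Lambda> (snd y (n, n))" using at \<alpha> by (simp add: from_vertex_def)
      then have "\<exists>\<mu>\<in>E. min_ext \<Lambda> \<mu> (cmp \<Lambda> \<alpha> \<tau>) \<noteq> {}"
        using E unfolding finite_exhaustive_def by blast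
      then obtain \<mu> \<gamma> \<delta> where \<mu>: "\<mu> \<in> E" "(\<gamma>, \<delta>) \<in> min_ext \<Lambda> \<mu> (cmp \<Lambda> \<alpha> \<tau>)" by force
      note D = min_extD[OF \<mu>(2)]
      have sd: "src \<Lambda> \<tau> = rng \<Lambda> \<delta>" using D(4) at(3) by simp
      note td = cmp_rules[OF \<tau>(1) D(2) sd]
      have T: "cmp \<Lambda> \<mu> \<gamma> = cmp \<Lambda> \<alpha> (cmp \<Lambda> \<tau> \<delta>)" using D(5) cmp_assoc[OF \<alpha>(1) \<tau>(1) D(2) \<tau>(2) sd] by simp
      have "prefix_of \<alpha> (cmp \<Lambda> \<mu> \<gamma>)" "prefix_of \<mu> (cmp \<Lambda> \<mu> \<gamma>)"
        using prefix_of_cmp[OF \<alpha>(1) td(1)] td(2) \<tau>(2) T prefix_of_cmp[OF Em(1)[OF \<mu>(1)] D(1,3)] by auto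
      then obtain \<beta> \<beta>' where b: "(\<beta>, \<beta>') \<in> min_ext \<Lambda> \<alpha> \<mu>" "prefix_of (cmp \<Lambda> \<alpha> \<beta>) (cmp \<Lambda> \<mu> \<gamma>)"
        using min_ext_prefix by metis
      note B = min_extD[OF b(1)]
      have "prefix_of \<beta> (cmp \<Lambda> \<tau> \<delta>)"
        using prefix_of_cmp_iff[OF \<alpha>(1) B(1) td(1) B(3)] b(2) td(2) \<tau>(2) T by simp
      then obtain ab where "ab \<in> min_ext \<Lambda> \<beta> \<tau>"
        using min_ext_prefix[OF _ prefix_of_cmp[OF \<tau>(1) D(2) sd]] by metis
      then show "\<exists>l\<in>E'. min_ext \<Lambda> l \<tau> \<noteq> {}" using \<mu>(1) b(1) unfolding E'_def by force
    qed
    moreover have "src \<Lambda> \<alpha> = snd w (r n, r n)" using \<alpha>(3) seg[OF order_refl r_le[OF nM]] by simp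
    ultimately obtain \<beta> where b: "\<beta> \<in> E'" "env (r n + dg \<beta>) \<le> fst w" "snd w (r n, r n + dg \<beta>) = \<beta>"
      using W(1) r_le[OF nM] unfolding boundary_def by auto
    then obtain \<mu> \<beta>' where \<mu>: "\<mu> \<in> E" "(\<beta>, \<beta>') \<in> min_ext \<Lambda> \<alpha> \<mu>" unfolding E'_def by force
    note B = min_extD[OF \<mu>(2)]
    let ?e = "?n + dg \<beta>"
    have e: "env ?e \<le> fst y" using yU(1)[OF b(2)] y(2) by (simp add: add.assoc)
    have ne: "?n \<le> ?e" by (simp add: le_fun_def)
    have "snd y (?n, ?e) = \<beta>"
      using seg[OF _ b(2), of "r n"] b(3) by (simp add: add.assoc le_fun_def)
    \<comment> \<open>As \<open>\<alpha> \<beta> = \<mu> \<beta>'\<close>, the segment of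
      \<open>y\<close> from \<open>n\<close> to \<open>?e\<close> starts with \<open>\<mu>\<close>;
      a comparison of degrees and unique factorisation do the rest.\<close>
    then have tot: "snd y (n, ?e) = cmp \<Lambda> \<mu> \<beta>'"
      using paths_cmp[OF y(1) nn ne e] B(5) unfolding \<alpha>_def by simp
    have "dg (cmp \<Lambda> \<alpha> \<beta>) = (?n - n) + dg \<beta>" using cmp_rules(4)[OF \<alpha>(1) B(1,3)] \<alpha>(4) by simp
    moreover have "dg (cmp \<Lambda> \<alpha> \<beta>) = dg \<mu> + dg \<beta>'"
      using cmp_rules(4)[OF Em(1)[OF \<mu>(1)] B(2,4)] B(5) by simp
    ultimately have dd: "(?n - n) + dg \<beta> = dg \<mu> + dg \<beta>'" by simp
    have "n + dg \<mu> \<le> ?e"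
    proof (rule le_funI)
      fix i show "(n + dg \<mu>) i \<le> ?e i" using fun_cong[OF dd, of i] le_funD[OF nn, of i] by simp
    qed
    note le = this
    have nl: "n \<le> n + dg \<mu>" by (simp add: le_fun_def)
    have el: "env (n + dg \<mu>) \<le> fst y" using env_le_trans[OF le e] .
    note P = pathsD[OF y(1) nl el]
    have "dg (snd y (n, n + dg \<mu>)) = dg \<mu>" using P(4) by simp
    moreover have "cmp \<Lambda> (snd y (n, n + dg \<mu>)) (snd y (n + dg \<mu>, ?e)) = cmp \<Lambda> \<mu> \<beta>'"
      using paths_cmp[OF y(1) nl le e] tot by simp
    ultimately have "snd y (n, n + dg \<mu>) = \<mu>"
      using factor_unique(1)[OF P(1) pathsD(1)[OF y(1) le e] Em(1)[OF \<mu>(1)] B(2) _ _ B(4)]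
        P(3) pathsD(2)[OF y(1) le e] by simp
    then show "\<exists>l\<in>E. env (n + dg l) \<le> fst y \<and> snd y (n, n + dg l) = l"
      using \<mu>(1) el by auto
  qed
  have yc: "y \<in> cyl l" using bd ydl y(2) env_le_add[of ?d "fst w"] by (simp add: cylinder_def)
  have ge: "y \<in> boundary_ge \<Lambda> ?d" using cylinderD[OF yc] by blast
  have "shift ?d y = w"
  proof (rule path_eqI)
    show "shift ?d y \<in> paths \<Lambda>" using shift_in_boundary[OF ge] by (simp add: boundary_def)
    show f: "fst (shift ?d y) = fst w" unfolding shift_eq(1)[OF ge] y(2) by (rule env_add_diff)
    fix t assume "env t \<le> fst (shift ?d y)"
    then have t: "env t \<le> fst w" using f by simp
    have "env (t + ?d) \<le> fst y" using yU(1)[OF t] y(2) by (simp add: add.commute)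
    then show "snd (shift ?d y) (0, t) = snd w (0, t)"
      using shift_eq(2)[OF ge nat_fun_ge_0, of t] seg[OF nat_fun_ge_0 t] by (simp add: add.commute)
  qed (rule W)
  then show ?thesis using yc by blast
qed

section \<open>Exchanging initial segments\<close>

text \<open>The map \<open>l w \<mapsto> m w\<close>. \<open>concat_exists\<close> provides a
  candidate and \<open>shift_inj_on_cylinder\<close> makes it the only one, so on
  \<open>cyl l\<close>, for equal sources, the choice is determined.\<close>

definition swap :: "'a \<Rightarrow> 'a \<Rightarrow> ('a, 'k) path \<Rightarrow> ('a, 'k) path" where
  "swap l m y = (SOME z. z \<in> cyl m \<and> shift (dg m) z = shift (dg l) y)"

lemma swap_in:
  assumes "y \<in> cyl l" "m \<in> mor \<Lambda>" "src \<Lambda> l = src \<Lambda> m"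
  shows "swap l m y \<in> cyl m" "shift (dg m) (swap l m y) = shift (dg l) y"
proof -
  have "\<exists>z. z \<in> cyl m \<and> shift (dg m) z = shift (dg l) y"
    using concat_exists[OF assms(2), of "shift (dg l) y"] shift_in_cylinder_src[OF assms(1)] assms(3) by (simp add: Bex_def)
  from someI_ex[OF this] show "swap l m y \<in> cyl m" "shift (dg m) (swap l m y) = shift (dg l) y"
    unfolding swap_def by auto
qed

lemma swap_eqI:
  assumes "z \<in> cyl m" "shift (dg m) z = shift (dg l) y"
  shows "swap l m y = z"
proof -
  from someI[of "\<lambda>z. z \<in> cyl m \<and> shift (dg m) z = shift (dg l) y"] assms
  have "swap l m y \<in> cyl m" "shift (dg m) (swap l m y) = shift (dg l) y"
    unfolding swap_def by auto
  then show ?thesis using inj_onD[OF shift_inj_on_cylinder[OF kg refl]] assms by metis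
qed

lemma swap_self: "y \<in> cyl l \<Longrightarrow> swap l l y = y"
  by (rule swap_eqI) auto

lemma swap_swap:
  assumes "y \<in> cyl l" "m \<in> mor \<Lambda>" "n \<in> mor \<Lambda>" "src \<Lambda> l = src \<Lambda> m" "src \<Lambda> m = src \<Lambda> n"
  shows "swap m n (swap l m y) = swap l n y"
  using swap_in[OF assms(1,2,4)] swap_in[OF assms(1,3)] assms(4,5) by (intro swap_eqI) auto

lemma cylinder_cmp_swap:
  assumes "l \<in> mor \<Lambda>" "m \<in> mor \<Lambda>" "src \<Lambda> l = src \<Lambda> m" "a \<in> mor \<Lambda>" "src \<Lambda> l = rng \<Lambda> a" "y \<in> cyl l"
  shows "swap l m y \<in> cyl (cmp \<Lambda> m a) \<longleftrightarrow> y \<in> cyl (cmp \<Lambda> l a)"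
  using cylinder_cmp[of l a y] cylinder_cmp[of m a "swap l m y"] swap_in[OF assms(6,2,3)] assms by simp

lemma shift_cmp:
  assumes "l \<in> mor \<Lambda>" "a \<in> mor \<Lambda>" "src \<Lambda> l = rng \<Lambda> a" "y \<in> cyl (cmp \<Lambda> l a)"
  shows "shift (dg (cmp \<Lambda> l a)) y = shift (dg a) (shift (dg l) y)"
  using shift_shift(3)[of y "dg l" "dg a"] cylinderD(6)[OF assms(4)] cmp_rules[OF assms(1-3)] by simp

text \<open>As \<open>(l a) w = l (a w)\<close>, exchanging \<open>l a\<close> for
  \<open>m a\<close> is the restriction of exchanging \<open>l\<close> for \<open>m\<close>. This
  allows an elementary operator to be cut down to smaller cylinders.\<close>

lemma swap_cmp:
  assumes "l \<in> mor \<Lambda>" "m \<in> mor \<Lambda>" "src \<Lambda> l = src \<Lambda> m" "a \<in> mor \<Lambda>" "src \<Lambda> l = rng \<Lambda> a"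
    "y \<in> cyl (cmp \<Lambda> l a)"
  shows "swap (cmp \<Lambda> l a) (cmp \<Lambda> m a) y = swap l m y"
proof (rule swap_eqI)
  have yl: "y \<in> cyl l" using cylinder_cmp[OF assms(1,4,5)] assms(6) by blast
  show c: "swap l m y \<in> cyl (cmp \<Lambda> m a)" using cylinder_cmp_swap[OF assms(1-5) yl] assms(6) by blast
  show "shift (dg (cmp \<Lambda> m a)) (swap l m y) = shift (dg (cmp \<Lambda> l a)) y"
    using shift_cmp[OF assms(1,4,5,6)] shift_cmp[OF assms(2,4) _ c] swap_in(2)[OF yl assms(2,3)] assms(3,5) by simp
qed

end

section \<open>Continuous functions with compact support on an arbitrary space\<close>

declare split_paired_All [simp del] split_paired_Ex [simp del]

text \<open>\<open>T\<close> need not be Hausdorff, so \<open>K\<close> is required to be closed as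
  well as compact; it then contains the closure of the nonzero set, which is compact as a closed
  subset. Later proofs only have to exhibit such a \<open>K\<close>.\<close>

lemma Cc_iff:
  "f \<in> Cc T \<longleftrightarrow> continuous_map T euclidean f \<and>
     (\<exists>K. compactin T K \<and> closedin T K \<and> (\<forall>y. f y \<noteq> 0 \<longrightarrow> y \<in> K))" (is "?L \<longleftrightarrow> ?R")
proof
  assume ?L
  then have "continuous_map T euclidean f" "\<And>y. f y \<noteq> 0 \<Longrightarrow> y \<in> topspace T"
    "compactin T (T closure_of {x \<in> topspace T. f x \<noteq> 0})" unfolding Cc_def by blast+
  moreover have "{x \<in> topspace T. f x \<noteq> 0} \<subseteq> T closure_of {x \<in> topspace T. f x \<noteq> 0}"
    by (rule closure_of_subset) blast
  ultimately show ?R by (intro conjI exI[of _ "T closure_of {x \<in> topspace T. f x \<noteq> 0}"]) auto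
next
  assume ?R
  then obtain K where K: "continuous_map T euclidean f" "compactin T K" "closedin T K" "\<And>y. f y \<noteq> 0 \<Longrightarrow> y \<in> K"
    by blast
  have "T closure_of {x \<in> topspace T. f x \<noteq> 0} \<subseteq> K"
    by (rule closure_of_minimal[OF _ K(3)]) (use K(4) in blast)
  then have "compactin T (T closure_of {x \<in> topspace T. f x \<noteq> 0})"
    by (rule closed_compactin[OF K(2) _ closedin_closure_of])
  moreover have "K \<subseteq> topspace T" using K closedin_subset by blast
  ultimately show ?L using K(1,4) unfolding Cc_def by blast
qed

lemma Cc_dominated:
  assumes "f \<in> Cc T" "continuous_map T euclidean g" "\<And>y. g y \<noteq> 0 \<Longrightarrow> f y \<noteq> 0"
  shows "g \<in> Cc T"
  using assms unfolding Cc_iff by blast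

lemma Cc_add:
  assumes "f \<in> Cc T" "g \<in> Cc T" shows "(\<lambda>y. f y + g y) \<in> Cc T"
proof -
  obtain K K' where "compactin T K" "closedin T K" "\<And>y. f y \<noteq> 0 \<Longrightarrow> y \<in> K"
    "compactin T K'" "closedin T K'" "\<And>y. g y \<noteq> 0 \<Longrightarrow> y \<in> K'"
    using assms unfolding Cc_iff by blast
  then have "compactin T (K \<union> K')" "closedin T (K \<union> K')" "\<forall>y. f y + g y \<noteq> 0 \<longrightarrow> y \<in> K \<union> K'"
    by (blast intro: compactin_Un, blast intro: closedin_Un, metis UnCI add.right_neutral)
  moreover have "continuous_map T euclidean (\<lambda>y. f y + g y)"
    using assms unfolding Cc_iff by (intro continuous_map_add) auto
  ultimately show ?thesis unfolding Cc_iff by blast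
qed

lemma Cc_compose:
  assumes "f \<in> Cc T" "continuous_on UNIV h" "h 0 = 0"
  shows "(\<lambda>y. h (f y)) \<in> Cc T"
proof (rule Cc_dominated[OF assms(1)])
  have "continuous_map T euclidean (h \<circ> f)"
    using assms(1,2) by (intro continuous_map_compose[of T euclidean f]) (auto simp: Cc_iff)
  then show "continuous_map T euclidean (\<lambda>y. h (f y))" by (simp add: o_def)
qed (use assms(3) in auto)

lemma Cc_mult_right:
  assumes "f \<in> Cc T" "continuous_map T euclidean g" shows "(\<lambda>y. f y * g y) \<in> Cc T"
proof (rule Cc_dominated[OF assms(1)])
  have "continuous_map T euclidean f" using assms(1) by (simp add: Cc_iff)
  then show "continuous_map T euclidean (\<lambda>y. f y * g y)"
    using assms(2) by (auto simp: continuous_map_atin intro: tendsto_mult)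
qed simp

lemma Cc_bounded:
  assumes "f \<in> Cc T" obtains B where "0 \<le> B" "\<And>y. norm (f y) \<le> B"
proof -
  obtain K where K: "compactin T K" "\<And>y. f y \<noteq> 0 \<Longrightarrow> y \<in> K" and c: "continuous_map T euclidean f"
    using assms unfolding Cc_iff by blast
  have "compactin euclidean (f ` K)" using image_compactin[OF K(1) c] .
  then have "bounded (f ` K)" by (simp add: compact_imp_bounded)
  then obtain B where B: "\<And>y. y \<in> K \<Longrightarrow> norm (f y) \<le> B" by (auto simp: bounded_iff)
  have "norm (f y) \<le> max B 0" for y using B[of y] K(2)[of y] by (cases "f y = 0") auto
  then show thesis using that[of "max B 0"] by auto
qed

context aligned_kgraph
begin

section \<open>Functions with compact support in a cylinder\<close>

abbreviation BT :: "('a, 'k) path topology" where "BT \<equiv> boundary_top \<Lambda>"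

lemmas topspace_BT = topspace_boundary_top[OF kg]

lemma cylinder_subset: "cyl l \<subseteq> boundary \<Lambda>"
  by (auto simp: cylinder_def)

lemma cylinder_vertex:
  assumes "y \<in> boundary \<Lambda>"
  shows "snd y (0, 0) \<in> mor \<Lambda>" "dg (snd y (0, 0)) = 0" "y \<in> cyl (snd y (0, 0))"
    "src \<Lambda> (snd y (0, 0)) = snd y (0, 0)"
proof -
  have p: "y \<in> paths \<Lambda>" using assms by (simp add: boundary_def)
  show d: "snd y (0, 0) \<in> mor \<Lambda>" "dg (snd y (0, 0)) = 0"
    using pathsD(1,4)[OF p order_refl env_0] by (simp_all add: fun_eq_iff)
  then show "y \<in> cyl (snd y (0, 0))" using assms env_0 by (simp add: cylinder_def)
  show "src \<Lambda> (snd y (0, 0)) = snd y (0, 0)" using pathsD(3)[OF p order_refl env_0] by simp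
qed

lemma cylinder_rng: "y \<in> cyl l \<Longrightarrow> snd y (0, 0) = rng \<Lambda> l"
  using cylinderD[of y l] path_prefixD(2)[of y \<Lambda> "dg l"] by simp

text \<open>A path outside \<open>cyl l\<close> either starts at another vertex, whose cylinder is
  an open neighbourhood missing \<open>cyl l\<close>, or starts at
  \<open>v = rng \<Lambda> l\<close> and lies in the basic set given by \<open>v\<close> and
  \<open>{l}\<close>.\<close>

lemma closedin_cylinder:
  assumes l: "l \<in> mor \<Lambda>" shows "closedin BT (cyl l)"
proof -
  have "\<exists>U. openin BT U \<and> x \<in> U \<and> U \<subseteq> boundary \<Lambda> - cyl l" if x: "x \<in> boundary \<Lambda> - cyl l" for x
  proof -
    have xb: "x \<in> boundary \<Lambda>" using x by simp
    note V = cylinder_vertex[OF xb]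
    show ?thesis
    proof (cases "snd x (0, 0) = rng \<Lambda> l")
      case False
      have "cyl (snd x (0, 0)) \<inter> cyl l = {}"
      proof (rule equals0I)
        fix y assume y: "y \<in> cyl (snd x (0, 0)) \<inter> cyl l"
        then have "snd y (0, 0) = snd x (0, 0)" "snd y (0, 0) = rng \<Lambda> l"
          using cylinderD(4)[of y "snd x (0, 0)"] cylinder_rng[of y l] V(2) by simp_all
        then show False using False by simp
      qed
      then show ?thesis using openin_cylinder[OF V(1)] V(3) cylinder_subset[of "snd x (0, 0)"] by blast
    next
      case True
      then have c: "cmp \<Lambda> (snd x (0, 0)) l = l" using category_rules(7)[OF l] by simp
      have "openin BT (basic_set \<Lambda> (snd x (0, 0)) {l})"
        unfolding boundary_top_def
      proof (intro topology_generated_by_Basis CollectI exI conjI)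
        show "{l} \<subseteq> from_vertex \<Lambda> (src \<Lambda> (snd x (0, 0)))" using V(4) True l by (simp add: from_vertex_def)
      qed (use V in auto)
      then show ?thesis using x V(3) cylinder_subset[of "snd x (0, 0)"] c
        by (intro exI[of _ "basic_set \<Lambda> (snd x (0, 0)) {l}"]) (auto simp: basic_set_def)
    qed
  qed
  then have "openin BT (boundary \<Lambda> - cyl l)" by (subst openin_subopen) blast
  then show ?thesis unfolding closedin_def topspace_BT using cylinder_subset by simp
qed

text \<open>The generating sets are cylinders minus finite unions of cylinders, so it suffices that
  preimages of single cylinders are both open and closed.\<close>

lemma continuous_map_boundary_topI:
  assumes f: "\<And>x. x \<in> topspace S \<Longrightarrow> f x \<in> boundary \<Lambda>"
    and o: "\<And>l. l \<in> mor \<Lambda> \<Longrightarrow> openin S {x \<in> topspace S. f x \<in> cyl l}"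
    and c: "\<And>l. l \<in> mor \<Lambda> \<Longrightarrow> closedin S {x \<in> topspace S. f x \<in> cyl l}"
  shows "continuous_map S BT f"
  unfolding boundary_top_def
proof (rule continuous_on_generated_topo)
  fix U assume "U \<in> {basic_set \<Lambda> l F |l F. l \<in> mor \<Lambda> \<and> finite F \<and> F \<subseteq> from_vertex \<Lambda> (src \<Lambda> l)}"
  then obtain l F where U: "U = basic_set \<Lambda> l F" "l \<in> mor \<Lambda>" "finite F" "F \<subseteq> from_vertex \<Lambda> (src \<Lambda> l)" by blast
  have eq: "f -` U \<inter> topspace S = {x \<in> topspace S. f x \<in> cyl l} -
     (\<Union>\<nu>\<in>F. {x \<in> topspace S. f x \<in> cyl (cmp \<Lambda> l \<nu>)})" unfolding U basic_set_def by auto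
  have "cmp \<Lambda> l \<nu> \<in> mor \<Lambda>" if "\<nu> \<in> F" for \<nu> using U that cmp_rules(1)[OF U(2)] by (auto simp: from_vertex_def)
  then have "closedin S (\<Union>\<nu>\<in>F. {x \<in> topspace S. f x \<in> cyl (cmp \<Lambda> l \<nu>)})"
    using U(3) c by (intro closedin_Union) auto
  then show "openin S (f -` U \<inter> topspace S)" unfolding eq using o[OF U(2)] by (rule openin_diff[rotated])
next
  show "f ` topspace S \<subseteq> \<Union> {basic_set \<Lambda> l F |l F. l \<in> mor \<Lambda> \<and> finite F \<and> F \<subseteq> from_vertex \<Lambda> (src \<Lambda> l)}"
    using f topspace_BT unfolding boundary_top_def topology_generated_by_topspace by auto
qed

text \<open>For \<open>y\<close> in \<open>cyl l\<close>, the path \<open>swap l m y\<close> lies in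
  \<open>cyl u\<close> iff \<open>y\<close> lies in \<open>cyl (l \<alpha>)\<close> for some
  \<open>(\<alpha>, \<beta>)\<close> in \<open>min_ext \<Lambda> m u\<close>. Finite alignment makes
  this union finite, hence closed as well as open.\<close>

lemma continuous_map_swap:
  assumes lm: "l \<in> mor \<Lambda>" "m \<in> mor \<Lambda>" "src \<Lambda> l = src \<Lambda> m"
  shows "continuous_map (subtopology BT (cyl l)) (subtopology BT (cyl m)) (swap l m)"
proof -
  let ?S = "subtopology BT (cyl l)"
  have top: "topspace ?S = cyl l" using topspace_BT cylinder_subset by auto
  have pre: "{y \<in> topspace ?S. swap l m y \<in> cyl u} = (\<Union>(\<alpha>, \<beta>)\<in>min_ext \<Lambda> m u. cyl (cmp \<Lambda> l \<alpha>))"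
    if u: "u \<in> mor \<Lambda>" for u
  proof -
    have "y \<in> cyl l \<and> swap l m y \<in> cyl u \<longleftrightarrow>
      (\<exists>\<alpha> \<beta>. (\<alpha>, \<beta>) \<in> min_ext \<Lambda> m u \<and> y \<in> cyl (cmp \<Lambda> l \<alpha>))" for y
    proof (cases "y \<in> cyl l")
      case True
      have "swap l m y \<in> cyl u \<longleftrightarrow> swap l m y \<in> cyl m \<inter> cyl u"
        using swap_in(1)[OF True lm(2,3)] by blast
      also have "\<dots> \<longleftrightarrow> (\<exists>\<alpha> \<beta>. (\<alpha>, \<beta>) \<in> min_ext \<Lambda> m u \<and> swap l m y \<in> cyl (cmp \<Lambda> m \<alpha>))"
        unfolding cylinder_Int[OF lm(2) u] by blast
      also have "\<dots> \<longleftrightarrow> (\<exists>\<alpha> \<beta>. (\<alpha>, \<beta>) \<in> min_ext \<Lambda> m u \<and> y \<in> cyl (cmp \<Lambda> l \<alpha>))"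
      proof -
        have "swap l m y \<in> cyl (cmp \<Lambda> m \<alpha>) \<longleftrightarrow> y \<in> cyl (cmp \<Lambda> l \<alpha>)"
          if "(\<alpha>, \<beta>) \<in> min_ext \<Lambda> m u" for \<alpha> \<beta>
          using cylinder_cmp_swap[OF lm min_extD(1)[OF that] _ True] min_extD(3)[OF that] lm(3) by simp
        then show ?thesis by blast
      qed
      finally show ?thesis using True by simp
    next
      case False
      have "y \<notin> cyl (cmp \<Lambda> l \<alpha>)" if "(\<alpha>, \<beta>) \<in> min_ext \<Lambda> m u" for \<alpha> \<beta>
        using cylinder_cmp[OF lm(1) min_extD(1)[OF that]] min_extD(3)[OF that] lm(3) False by simp
      then show ?thesis using False by blast
    qed
    then show ?thesis unfolding top by blast
  qed
  have m: "cmp \<Lambda> l \<alpha> \<in> mor \<Lambda>" "cyl (cmp \<Lambda> l \<alpha>) \<subseteq> cyl l" if "(\<alpha>, \<beta>) \<in> min_ext \<Lambda> m u" for \<alpha> \<beta> u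
    using min_extD[OF that] lm cmp_rules(1)[OF lm(1) min_extD(1)[OF that]] cylinder_cmp[OF lm(1) min_extD(1)[OF that]] by auto
  have "continuous_map ?S BT (swap l m)"
  proof (rule continuous_map_boundary_topI)
    show "swap l m x \<in> boundary \<Lambda>" if "x \<in> topspace ?S" for x
      using that swap_in(1)[OF _ lm(2,3)] cylinder_subset unfolding top by blast
    fix u assume u: "u \<in> mor \<Lambda>"
    have "openin ?S (cyl (cmp \<Lambda> l \<alpha>))" "closedin ?S (cyl (cmp \<Lambda> l \<alpha>))"
      if "(\<alpha>, \<beta>) \<in> min_ext \<Lambda> m u" for \<alpha> \<beta>
      unfolding openin_subtopology closedin_subtopology
      using openin_cylinder[OF m(1)[OF that]] closedin_cylinder[OF m(1)[OF that]] m(2)[OF that]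
      by (metis Int_absorb2)+
    then show "openin ?S {x \<in> topspace ?S. swap l m x \<in> cyl u}"
      "closedin ?S {x \<in> topspace ?S. swap l m x \<in> cyl u}"
      unfolding pre[OF u] using finite_min_ext[OF lm(2) u]
      by (auto intro!: openin_Union closedin_Union)
  qed
  then show ?thesis using swap_in(1)[OF _ lm(2,3)] unfolding continuous_map_in_subtopology top by auto
qed

lemma continuous_map_extend_zero:
  assumes l: "l \<in> mor \<Lambda>" and g: "continuous_map (subtopology BT (cyl l)) euclidean g"
  shows "continuous_map BT euclidean (\<lambda>y. if y \<in> cyl l then g y else (0::complex))"
  unfolding continuous_map_def
proof (intro conjI allI impI)
  fix U :: "complex set" assume U: "openin euclidean U"
  have top: "topspace (subtopology BT (cyl l)) = cyl l" using topspace_BT cylinder_subset by auto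
  have "openin (subtopology BT (cyl l)) {y \<in> cyl l. g y \<in> U}"
    using g U unfolding continuous_map_def top by blast
  then have 1: "openin BT {y \<in> cyl l. g y \<in> U}"
    using openin_open_subtopology[OF openin_cylinder[OF l]] by blast
  have 2: "openin BT (boundary \<Lambda> - cyl l)" using closedin_cylinder[OF l] unfolding closedin_def topspace_BT by blast
  have "{y \<in> topspace BT. (if y \<in> cyl l then g y else 0) \<in> U} =
    {y \<in> cyl l. g y \<in> U} \<union> (if 0 \<in> U then boundary \<Lambda> - cyl l else {})"
    using cylinder_subset unfolding topspace_BT by auto
  then show "openin BT {y \<in> topspace BT. (if y \<in> cyl l then g y else 0) \<in> U}" using 1 2 by auto
qed auto

definition Ccyl :: "'a \<Rightarrow> (('a, 'k) path \<Rightarrow> complex) set" where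
  "Ccyl l = {f \<in> Cc BT. \<forall>y. y \<notin> cyl l \<longrightarrow> f y = 0}"

lemma Ccyl_zero: "f \<in> Ccyl l \<Longrightarrow> y \<notin> cyl l \<Longrightarrow> f y = 0"
  unfolding Ccyl_def by blast

lemma Ccyl_Cc: "f \<in> Ccyl l \<Longrightarrow> f \<in> Cc BT"
  unfolding Ccyl_def by blast

lemma Ccyl_continuous: "f \<in> Ccyl l \<Longrightarrow> continuous_map BT euclidean f"
  unfolding Ccyl_def Cc_iff by blast

lemma Ccyl_support:
  assumes "f \<in> Ccyl l" "l \<in> mor \<Lambda>"
  obtains K where "compactin BT K" "closedin BT K" "K \<subseteq> cyl l" "\<And>y. f y \<noteq> 0 \<Longrightarrow> y \<in> K"
proof -
  obtain K where K: "compactin BT K" "closedin BT K" "\<And>y. f y \<noteq> 0 \<Longrightarrow> y \<in> K"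
    using assms(1) unfolding Ccyl_def Cc_iff by blast
  have "closedin BT (K \<inter> cyl l)" using K closedin_cylinder[OF assms(2)] by blast
  moreover have "compactin BT (K \<inter> cyl l)" using closed_compactin[OF K(1) Int_lower1 calculation] .
  ultimately show thesis using that[of "K \<inter> cyl l"] K(3) Ccyl_zero[OF assms(1)] by blast
qed

lemma Ccyl_dominated:
  assumes "f \<in> Ccyl l" "continuous_map BT euclidean g" "\<And>y. g y \<noteq> 0 \<Longrightarrow> f y \<noteq> 0"
  shows "g \<in> Ccyl l"
  using assms Cc_dominated[of f BT g] unfolding Ccyl_def by blast

lemma Ccyl_mult_right: "f \<in> Ccyl l \<Longrightarrow> continuous_map BT euclidean g \<Longrightarrow> (\<lambda>y. f y * g y) \<in> Ccyl l"
  using Cc_mult_right unfolding Ccyl_def by auto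

lemma Ccyl_mult: "f \<in> Ccyl l \<Longrightarrow> g \<in> Ccyl m \<Longrightarrow> (\<lambda>y. f y * g y) \<in> Ccyl l"
  using Ccyl_mult_right Ccyl_continuous by blast

lemma Ccyl_compose: "f \<in> Ccyl l \<Longrightarrow> continuous_on UNIV h \<Longrightarrow> h 0 = 0 \<Longrightarrow> (\<lambda>y. h (f y)) \<in> Ccyl l"
  using Cc_compose unfolding Ccyl_def by auto

lemma Ccyl_scale: "f \<in> Ccyl l \<Longrightarrow> (\<lambda>y. c * f y) \<in> Ccyl l"
  by (rule Ccyl_compose) (auto intro: continuous_intros)

lemma Ccyl_cnj: "f \<in> Ccyl l \<Longrightarrow> (\<lambda>y. cnj (f y)) \<in> Ccyl l"
  by (rule Ccyl_compose) (auto intro: continuous_intros)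

lemma Ccyl_bounded:
  assumes "f \<in> Ccyl l" obtains B where "0 \<le> B" "\<And>y. norm (f y) \<le> B"
  using Cc_bounded[OF Ccyl_Cc[OF assms]] by blast

lemma Ccyl_restrict:
  assumes "f \<in> Ccyl l" "m \<in> mor \<Lambda>"
  shows "(\<lambda>y. if y \<in> cyl m then f y else 0) \<in> Ccyl m"
proof -
  have "continuous_map BT euclidean (\<lambda>y. if y \<in> cyl m then f y else 0)"
    using Ccyl_continuous[OF assms(1)]
    by (intro continuous_map_extend_zero[OF assms(2)] continuous_map_from_subtopology)
  from Ccyl_dominated[OF assms(1) this] show ?thesis by (auto simp: Ccyl_def split: if_splits)
qed

definition pull :: "'a \<Rightarrow> 'a \<Rightarrow> (('a, 'k) path \<Rightarrow> complex) \<Rightarrow> ('a, 'k) path \<Rightarrow> complex" where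
  "pull l m g y = (if y \<in> cyl l then g (swap l m y) else 0)"

text \<open>The set that carries \<open>g\<close> is moved by the homeomorphism
  \<open>swap m l\<close>: it becomes compact as an image under that map and closed as a preimage
  under \<open>swap l m\<close>.\<close>

lemma pull_Ccyl:
  assumes lm: "l \<in> mor \<Lambda>" "m \<in> mor \<Lambda>" "src \<Lambda> l = src \<Lambda> m" and g: "g \<in> Ccyl m"
  shows "pull l m g \<in> Ccyl l"
proof -
  let ?S = "subtopology BT (cyl l)"
  have top: "topspace ?S = cyl l" "topspace (subtopology BT (cyl m)) = cyl m"
    using topspace_BT cylinder_subset by auto
  have "continuous_map ?S euclidean (g \<circ> swap l m)"
    by (rule continuous_map_compose[OF continuous_map_swap[OF lm]])
       (rule continuous_map_from_subtopology[OF Ccyl_continuous[OF g]])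
  then have cont: "continuous_map BT euclidean (pull l m g)"
    unfolding pull_def[abs_def] using continuous_map_extend_zero[OF lm(1), of "\<lambda>y. g (swap l m y)"] by (simp add: o_def)
  obtain K where K: "compactin BT K" "closedin BT K" "K \<subseteq> cyl m" "\<And>y. g y \<noteq> 0 \<Longrightarrow> y \<in> K"
    using Ccyl_support[OF g lm(2)] by metis
  let ?K = "swap m l ` K"
  have eq: "?K = {y \<in> cyl l. swap l m y \<in> K}"
  proof (intro equalityI subsetI)
    fix y assume "y \<in> ?K"
    then obtain z where z: "z \<in> K" "y = swap m l z" by blast
    then have "z \<in> cyl m" using K by blast
    then show "y \<in> {y \<in> cyl l. swap l m y \<in> K}"
      using swap_in(1)[OF _ lm(1)] swap_swap[OF _ lm(1,2)] swap_self z lm by simp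
  next
    fix y assume "y \<in> {y \<in> cyl l. swap l m y \<in> K}"
    moreover then have "y = swap m l (swap l m y)" using swap_swap[OF _ lm(2,1,3)] swap_self lm by simp
    ultimately show "y \<in> ?K" by blast
  qed
  have "compactin (subtopology BT (cyl m)) K" using K by (simp add: compactin_subtopology)
  from image_compactin[OF this continuous_map_swap[OF lm(2,1) lm(3)[symmetric]]]
  have comp: "compactin BT ?K" by (simp add: compactin_subtopology)
  have "closedin (subtopology BT (cyl m)) K" using K by (auto simp: closedin_subtopology)
  from closedin_continuous_map_preimage[OF continuous_map_swap[OF lm] this]
  have "closedin ?S ?K" unfolding eq top .
  then have "closedin BT ?K" using closedin_closed_subtopology[OF closedin_cylinder[OF lm(1)]] by blast
  moreover have "\<forall>y. pull l m g y \<noteq> 0 \<longrightarrow> y \<in> ?K" unfolding eq pull_def using K(4) by auto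
  ultimately have "pull l m g \<in> Cc BT" using cont comp unfolding Cc_iff by blast
  then show ?thesis unfolding Ccyl_def pull_def by simp
qed

lemma cylinder_ge: "n \<le> dg l \<Longrightarrow> cyl l \<subseteq> boundary_ge \<Lambda> n"
  using env_le_trans unfolding cylinder_def boundary_ge_def by blast

lemma Ccyl_Cc_ge:
  assumes "f \<in> Ccyl l" "l \<in> mor \<Lambda>" "n \<le> dg l" shows "f \<in> Cc_ge \<Lambda> n"
proof -
  obtain K where K: "compactin BT K" "closedin BT K" "K \<subseteq> cyl l" "\<And>y. f y \<noteq> 0 \<Longrightarrow> y \<in> K"
    using Ccyl_support[OF assms(1,2)] by metis
  let ?S = "subtopology BT (boundary_ge \<Lambda> n)"
  have "K \<subseteq> boundary_ge \<Lambda> n" using K cylinder_ge[OF assms(3)] by blast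
  then have "compactin ?S K" "closedin ?S K" using K by (auto simp: compactin_subtopology closedin_subtopology)
  then show ?thesis using K(4) continuous_map_from_subtopology[OF Ccyl_continuous[OF assms(1)]]
    unfolding Cc_ge_def Cc_iff by blast
qed

text \<open>Compactness covers the support by finitely many cylinders of degree \<open>n\<close>.
  These are open, closed and pairwise disjoint, so cutting \<open>f\<close> off outside each of them
  gives continuous pieces that sum to \<open>f\<close>. The density arguments below start
  here.\<close>

lemma Cc_ge_decompose:
  assumes f: "f \<in> Cc_ge \<Lambda> n"
  obtains L g where "finite L" "\<And>l. l \<in> L \<Longrightarrow> l \<in> mor \<Lambda> \<and> dg l = n \<and> g l \<in> Ccyl l"
    "f = (\<lambda>y. \<Sum>l\<in>L. g l y)"
proof -
  let ?S = "subtopology BT (boundary_ge \<Lambda> n)"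
  obtain K where K: "compactin ?S K" "closedin ?S K" "\<And>y. f y \<noteq> 0 \<Longrightarrow> y \<in> K" and c: "continuous_map ?S euclidean f"
    using f unfolding Cc_ge_def Cc_iff by blast
  have KB: "compactin BT K" "K \<subseteq> boundary_ge \<Lambda> n" using K(1) by (auto simp: compactin_subtopology)
  then have "\<exists>\<F>. finite \<F> \<and> \<F> \<subseteq> cyl ` {l \<in> mor \<Lambda>. dg l = n} \<and> K \<subseteq> \<Union>\<F>"
    by (intro compactinD) (auto simp: boundary_ge_eq_Union_cylinder intro: openin_cylinder)
  then obtain \<F> where "finite \<F>" "\<F> \<subseteq> cyl ` {l \<in> mor \<Lambda>. dg l = n}" and KF: "K \<subseteq> \<Union>\<F>"
    by blast
  from finite_subset_image[OF this(1,2)] KF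
  obtain L where L: "finite L" "L \<subseteq> {l \<in> mor \<Lambda>. dg l = n}" "K \<subseteq> (\<Union>l\<in>L. cyl l)"
    by blast
  define g where "g l y = (if y \<in> cyl l then f y else 0)" for l y
  have "g l \<in> Ccyl l" if "l \<in> L" for l
  proof -
    have l: "l \<in> mor \<Lambda>" "dg l = n" using L that by auto
    have sub: "cyl l \<subseteq> boundary_ge \<Lambda> n" using cylinder_ge l by blast
    have "subtopology ?S (cyl l) = subtopology BT (cyl l)"
      using sub by (simp add: subtopology_subtopology Int_absorb1)
    then have "continuous_map (subtopology BT (cyl l)) euclidean f"
      using continuous_map_from_subtopology[OF c, of "cyl l"] by simp
    from continuous_map_extend_zero[OF l(1) this] have cg: "continuous_map BT euclidean (g l)"
      unfolding g_def[abs_def] .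
    obtain C where C: "closedin BT C" "K = C \<inter> boundary_ge \<Lambda> n" using K(2) by (auto simp: closedin_subtopology)
    then have eq: "K \<inter> cyl l = C \<inter> cyl l" using sub by blast
    have cl: "closedin BT (K \<inter> cyl l)" unfolding eq using C(1) closedin_cylinder[OF l(1)] by blast
    have "compactin BT (K \<inter> cyl l)" using closed_compactin[OF KB(1) Int_lower1 cl] .
    moreover have "\<forall>y. g l y \<noteq> 0 \<longrightarrow> y \<in> K \<inter> cyl l" using K(3) by (auto simp: g_def)
    ultimately have "g l \<in> Cc BT" using cg cl unfolding Cc_iff by blast
    then show ?thesis by (simp add: Ccyl_def g_def)
  qed
  moreover have "f y = (\<Sum>l\<in>L. g l y)" for y
  proof (cases "f y = 0")
    case True
    then have "g l y = 0" for l by (simp add: g_def)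
    then show ?thesis using True by simp
  next
    case False
    then obtain l where l: "l \<in> L" "y \<in> cyl l" using K(3) L(3) by blast
    have "(\<Sum>l'\<in>L. g l' y) = (\<Sum>l'\<in>L. if l' = l then f y else 0)"
    proof (rule sum.cong)
      fix l' assume "l' \<in> L"
      then have "dg l' = dg l" using L(2) l(1) by auto
      then have "y \<in> cyl l' \<longleftrightarrow> l' = l" using l(2) cylinderD(4) by metis
      then show "g l' y = (if l' = l then f y else 0)" unfolding g_def by simp
    qed simp
    also have "\<dots> = f y" using L(1) l(1) by (simp add: sum.delta')
    finally show ?thesis ..
  qed
  ultimately have G: "\<And>l. l \<in> L \<Longrightarrow> g l \<in> Ccyl l" and S: "\<And>y. f y = (\<Sum>l\<in>L. g l y)" by blast+
  show thesis by (rule that[OF L(1) _ ext[OF S]]) (use G L(2) in blast)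
qed

end

section \<open>The Hilbert modules\<close>

lemma fibre_l2_leI:
  assumes "0 \<le> c" "\<And>y. y \<notin> boundary_ge \<Lambda> n \<Longrightarrow> f y = 0"
    "\<And>x F. finite F \<Longrightarrow> F \<subseteq> fibre \<Lambda> n x \<Longrightarrow> (\<Sum>y\<in>F. (norm (f y))\<^sup>2) \<le> c\<^sup>2"
  shows "f \<in> fibre_l2 \<Lambda> n" "mod_norm \<Lambda> n f \<le> c"
  using fibre_l2_norm_le_iff[OF assms(1), of f \<Lambda> n] assms(2,3) by blast+

lemma small_factor:
  fixes c e :: real
  assumes "0 < e" obtains d where "d > 0" "\<bar>c\<bar> * d < e"
proof (rule that[of "e / (\<bar>c\<bar> + 1)"])
  have "\<bar>c\<bar> + 1 > 0" by simp
  then show "e / (\<bar>c\<bar> + 1) > 0" "\<bar>c\<bar> * (e / (\<bar>c\<bar> + 1)) < e"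
    using assms by (simp_all add: pos_divide_less_eq algebra_simps)
qed

lemma mod_norm_minus_commute: "mod_norm \<Lambda> n (f - g) = mod_norm \<Lambda> n (g - f)"
proof -
  have "norm (ip \<Lambda> n (f - g) (f - g) x) = norm (ip \<Lambda> n (g - f) (g - f) x)" for x
    unfolding ip_def by (intro arg_cong[where f = norm] infsum_cong) (simp add: algebra_simps)
  then show ?thesis unfolding mod_norm_def by simp
qed

lemma mod_norm_triangle:
  assumes "f \<in> fibre_l2 \<Lambda> n" "g \<in> fibre_l2 \<Lambda> n" "h \<in> fibre_l2 \<Lambda> n"
  shows "mod_norm \<Lambda> n (f - h) \<le> mod_norm \<Lambda> n (f - g) + mod_norm \<Lambda> n (g - h)"
  using fibre_l2_add(2)[OF fibre_l2_diff(1)[OF assms(1,2)] fibre_l2_diff(1)[OF assms(2,3)]] by simp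

lemma fibre_l2_zero: "(\<lambda>y. 0) \<in> fibre_l2 \<Lambda> n" "mod_norm \<Lambda> n (\<lambda>y. 0) = 0"
  by (auto simp: fibre_l2_def mod_norm_def ip_def)

lemma fibre_l2_mult_bounded:
  assumes f: "f \<in> fibre_l2 \<Lambda> n" and a: "\<And>y. y \<in> boundary_ge \<Lambda> n \<Longrightarrow> norm (a y) \<le> B" and B: "0 \<le> B"
  shows "(\<lambda>y. a y * f y) \<in> fibre_l2 \<Lambda> n" "mod_norm \<Lambda> n (\<lambda>y. a y * f y) \<le> B * mod_norm \<Lambda> n f"
proof -
  have le: "(\<Sum>y\<in>F. (norm (a y * f y))\<^sup>2) \<le> (B * mod_norm \<Lambda> n f)\<^sup>2" if F: "finite F" "F \<subseteq> fibre \<Lambda> n x" for F x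
  proof -
    have "(\<Sum>y\<in>F. (norm (a y * f y))\<^sup>2) \<le> (\<Sum>y\<in>F. B\<^sup>2 * (norm (f y))\<^sup>2)"
    proof (rule sum_mono)
      fix y assume "y \<in> F"
      then have "y \<in> boundary_ge \<Lambda> n" using F unfolding fibre_def by blast
      then have "norm (a y) \<le> B" by (rule a)
      then show "(norm (a y * f y))\<^sup>2 \<le> B\<^sup>2 * (norm (f y))\<^sup>2"
        by (simp add: norm_mult power_mult_distrib mult_right_mono power_mono)
    qed
    also have "\<dots> = B\<^sup>2 * (\<Sum>y\<in>F. (norm (f y))\<^sup>2)" by (simp add: sum_distrib_left)
    also have "\<dots> \<le> B\<^sup>2 * (mod_norm \<Lambda> n f)\<^sup>2"
      using fibre_l2_finite_sum_le[OF f F] by (intro mult_left_mono) auto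
    finally show ?thesis by (simp add: power_mult_distrib)
  qed
  have c: "0 \<le> B * mod_norm \<Lambda> n f" using B mod_norm_nonneg[OF f] by simp
  have z: "a y * f y = 0" if "y \<notin> boundary_ge \<Lambda> n" for y using fibre_l2D(1)[OF f that] by simp
  show "(\<lambda>y. a y * f y) \<in> fibre_l2 \<Lambda> n" "mod_norm \<Lambda> n (\<lambda>y. a y * f y) \<le> B * mod_norm \<Lambda> n f"
    by (rule fibre_l2_leI[OF c z le]; assumption)+
qed

lemmas fibre_l2_scale = fibre_l2_mult_bounded[where a = "\<lambda>y. c" and B = "norm c" for c, OF _ order_refl norm_ge_zero]

lemma mod_norm_zero_imp: "f \<in> fibre_l2 \<Lambda> n \<Longrightarrow> mod_norm \<Lambda> n f \<le> 0 \<Longrightarrow> f y = 0"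
  using norm_le_mod_norm[of f \<Lambda> n y] by (metis norm_le_zero_iff order_trans)

lemma ip_cauchy_schwarz:
  assumes f: "f \<in> fibre_l2 \<Lambda> n" and g: "g \<in> fibre_l2 \<Lambda> n"
  shows "(\<lambda>y. cnj (f y) * g y) summable_on fibre \<Lambda> n x"
    "norm (ip \<Lambda> n f g x) \<le> mod_norm \<Lambda> n f * mod_norm \<Lambda> n g"
proof -
  let ?B = "mod_norm \<Lambda> n f * mod_norm \<Lambda> n g"
  have le: "(\<Sum>y\<in>F. norm (cnj (f y) * g y)) \<le> ?B" if F: "finite F" "F \<subseteq> fibre \<Lambda> n x" for F
  proof -
    have "(\<Sum>y\<in>F. norm (cnj (f y) * g y)) \<le> L2_set (\<lambda>y. norm (f y)) F * L2_set (\<lambda>y. norm (g y)) F"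
      using L2_set_mult_ineq[of "\<lambda>y. norm (f y)" "\<lambda>y. norm (g y)" F] by (simp add: norm_mult)
    also have "\<dots> \<le> ?B"
      using fibre_l2_finite_sum_le[OF f F] fibre_l2_finite_sum_le[OF g F] mod_norm_nonneg[OF f] mod_norm_nonneg[OF g]
      unfolding L2_set_def by (intro mult_mono real_le_lsqrt) (auto intro: sum_nonneg)
    finally show ?thesis .
  qed
  have s: "(\<lambda>y. norm (cnj (f y) * g y)) summable_on fibre \<Lambda> n x"
    by (rule nonneg_bdd_above_summable_on) (auto intro!: bdd_aboveI2[of _ _ ?B] le)
  then show "(\<lambda>y. cnj (f y) * g y) summable_on fibre \<Lambda> n x" by (rule abs_summable_summable)
  have "norm (ip \<Lambda> n f g x) \<le> (\<Sum>\<^sub>\<infinity>y\<in>fibre \<Lambda> n x. norm (cnj (f y) * g y))"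
    unfolding ip_def by (rule norm_infsum_bound[OF s])
  also have "\<dots> \<le> ?B" by (rule infsum_le_finite_sums[OF s le])
  finally show "norm (ip \<Lambda> n f g x) \<le> ?B" .
qed

lemma ip_add_right:
  assumes "f \<in> fibre_l2 \<Lambda> n" "g \<in> fibre_l2 \<Lambda> n" "h \<in> fibre_l2 \<Lambda> n"
  shows "ip \<Lambda> n f (g + h) x = ip \<Lambda> n f g x + ip \<Lambda> n f h x"
  unfolding ip_def using infsum_add[OF ip_cauchy_schwarz(1)[OF assms(1,2)] ip_cauchy_schwarz(1)[OF assms(1,3)], of x]
  by (simp add: algebra_simps)

lemma ip_add_left:
  assumes "f \<in> fibre_l2 \<Lambda> n" "g \<in> fibre_l2 \<Lambda> n" "h \<in> fibre_l2 \<Lambda> n"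
  shows "ip \<Lambda> n (f + g) h x = ip \<Lambda> n f h x + ip \<Lambda> n g h x"
  unfolding ip_def using infsum_add[OF ip_cauchy_schwarz(1)[OF assms(1,3)] ip_cauchy_schwarz(1)[OF assms(2,3)], of x]
  by (simp add: algebra_simps)

lemma ip_diff_right:
  assumes "f \<in> fibre_l2 \<Lambda> n" "g \<in> fibre_l2 \<Lambda> n" "h \<in> fibre_l2 \<Lambda> n"
  shows "ip \<Lambda> n f (g - h) x = ip \<Lambda> n f g x - ip \<Lambda> n f h x"
  using ip_add_right[OF assms(1) fibre_l2_diff(1)[OF assms(2,3)] assms(3), of x] by simp

lemma ip_diff_left:
  assumes "f \<in> fibre_l2 \<Lambda> n" "g \<in> fibre_l2 \<Lambda> n" "h \<in> fibre_l2 \<Lambda> n"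
  shows "ip \<Lambda> n (f - g) h x = ip \<Lambda> n f h x - ip \<Lambda> n g h x"
  using ip_add_left[OF fibre_l2_diff(1)[OF assms(1,2)] assms(2,3), of x] by simp

lemma mod_norm_leI:
  assumes "0 \<le> c" "\<And>x. norm (ip \<Lambda> n f f x) \<le> c\<^sup>2"
  shows "mod_norm \<Lambda> n f \<le> c"
  unfolding mod_norm_def using assms by (intro real_le_lsqrt cSUP_least) auto

text \<open>The hypothesis amounts to \<open>\<parallel>f\<parallel>\<^sup>2 \<le> c
  \<parallel>f\<parallel>\<close>, and one factor cancels. It serves for adjoints and for
  multipliers, where only such a bound is at hand.\<close>

lemma mod_norm_leI_self:
  assumes f: "f \<in> fibre_l2 \<Lambda> n" and c: "0 \<le> c" "\<And>x. norm (ip \<Lambda> n f f x) \<le> c * mod_norm \<Lambda> n f"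
  shows "mod_norm \<Lambda> n f \<le> c"
proof (cases "mod_norm \<Lambda> n f = 0")
  case False
  then have pos: "mod_norm \<Lambda> n f > 0" using mod_norm_nonneg[OF f] by simp
  have "mod_norm \<Lambda> n f \<le> sqrt (c * mod_norm \<Lambda> n f)"
    using c pos by (intro mod_norm_leI) auto
  then have "(mod_norm \<Lambda> n f)\<^sup>2 \<le> c * mod_norm \<Lambda> n f"
    using pos c(1) real_le_rsqrt real_sqrt_le_iff by (metis less_imp_le mult_nonneg_nonneg power2_le_iff_abs_le power_mono real_sqrt_pow2)
  then show ?thesis using pos by (simp add: power2_eq_square)
qed (use c in simp)

lemma right_act_fibre_l2:
  assumes f: "f \<in> fibre_l2 \<Lambda> n" and a: "\<And>x. norm (a x) \<le> B" "0 \<le> B"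
  shows "right_act n f a \<in> fibre_l2 \<Lambda> n" "mod_norm \<Lambda> n (right_act n f a) \<le> B * mod_norm \<Lambda> n f"
  using fibre_l2_mult_bounded[OF f, of "\<lambda>y. a (shift n y)" B] a
  unfolding right_act_def by (simp_all add: mult.commute)

context aligned_kgraph
begin

lemma X_fibre_l2: "f \<in> X \<Lambda> n \<Longrightarrow> f \<in> fibre_l2 \<Lambda> n"
  by (simp add: X_def)

lemma X_closed:
  assumes "f \<in> fibre_l2 \<Lambda> n" "\<And>e. e > 0 \<Longrightarrow> \<exists>g\<in>X \<Lambda> n. nrm n (f - g) < e"
  shows "f \<in> X \<Lambda> n"
proof -
  have "\<exists>g\<in>Cc_ge \<Lambda> n. nrm n (f - g) < e" if e: "e > 0" for e
  proof -
    obtain g where g: "g \<in> X \<Lambda> n" "nrm n (f - g) < e / 2"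
      using assms(2) half_gt_zero[OF e] by blast
    obtain h where h: "h \<in> Cc_ge \<Lambda> n" "nrm n (g - h) < e / 2"
      using g(1) half_gt_zero[OF e] unfolding X_def by blast
    have "nrm n (f - h) < e"
      using mod_norm_triangle[OF assms(1) X_fibre_l2[OF g(1)], of h] g(2) h Cc_ge_subset_fibre_l2[OF kg] by fastforce
    then show ?thesis using h by blast
  qed
  then show ?thesis using assms(1) by (simp add: X_def)
qed

lemma Cc_ge_add: "f \<in> Cc_ge \<Lambda> n \<Longrightarrow> g \<in> Cc_ge \<Lambda> n \<Longrightarrow> f + g \<in> Cc_ge \<Lambda> n"
  unfolding Cc_ge_def plus_fun_def by (rule Cc_add)

lemma Cc_ge_scale: "f \<in> Cc_ge \<Lambda> n \<Longrightarrow> (\<lambda>y. c * f y) \<in> Cc_ge \<Lambda> n"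
  unfolding Cc_ge_def by (rule Cc_compose) (auto intro: continuous_intros)

lemma X_add:
  assumes f: "f \<in> X \<Lambda> n" and g: "g \<in> X \<Lambda> n" shows "f + g \<in> X \<Lambda> n"
proof (rule X_closed)
  show "f + g \<in> fibre_l2 \<Lambda> n" using fibre_l2_add(1) X_fibre_l2 f g by blast
  fix e :: real assume "e > 0"
  then have "e / 2 > 0" by simp
  then obtain f' g' where fg: "f' \<in> Cc_ge \<Lambda> n" "nrm n (f - f') < e / 2" "g' \<in> Cc_ge \<Lambda> n" "nrm n (g - g') < e / 2"
    using f g unfolding X_def by blast
  have "nrm n ((f - f') + (g - g')) < e"
  proof -
    have "f - f' \<in> fibre_l2 \<Lambda> n" "g - g' \<in> fibre_l2 \<Lambda> n"
      using fg(1,3) fibre_l2_diff(1) X_fibre_l2 f g Cc_ge_subset_fibre_l2[OF kg] by blast+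
    from fibre_l2_add(2)[OF this] show ?thesis using fg(2,4) by linarith
  qed
  moreover have "(f - f') + (g - g') = f + g - (f' + g')" by simp
  ultimately have "nrm n (f + g - (f' + g')) < e" by (simp only:)
  then show "\<exists>h\<in>X \<Lambda> n. nrm n (f + g - h) < e"
    using Cc_ge_add[OF fg(1,3)] Cc_ge_subset_X[OF kg] by blast
qed

lemma X_scale:
  assumes f: "f \<in> X \<Lambda> n" shows "(\<lambda>y. c * f y) \<in> X \<Lambda> n"
proof (rule X_closed)
  show "(\<lambda>y. c * f y) \<in> fibre_l2 \<Lambda> n" using fibre_l2_scale(1) X_fibre_l2 f by blast
  fix e :: real assume e: "e > 0"
  obtain d where d: "d > 0" "norm c * d < e" using small_factor[OF e, of "norm c"] by auto
  then obtain g where g: "g \<in> Cc_ge \<Lambda> n" "nrm n (f - g) < d" using f unfolding X_def by blast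
  have "nrm n (\<lambda>y. c * (f - g) y) \<le> norm c * nrm n (f - g)"
    using g f X_fibre_l2 Cc_ge_subset_fibre_l2[OF kg] by (intro fibre_l2_scale(2) fibre_l2_diff) auto
  also have "\<dots> \<le> norm c * d" using g by (intro mult_left_mono) auto
  also have "\<dots> < e" by fact
  finally have "nrm n ((\<lambda>y. c * f y) - (\<lambda>y. c * g y)) < e"
    by (simp add: fun_diff_def algebra_simps)
  then show "\<exists>h\<in>X \<Lambda> n. nrm n ((\<lambda>y. c * f y) - h) < e"
    using Cc_ge_scale[OF g(1)] Cc_ge_subset_X[OF kg] by blast
qed

lemma X_diff: "f \<in> X \<Lambda> n \<Longrightarrow> g \<in> X \<Lambda> n \<Longrightarrow> f - g \<in> X \<Lambda> n"
  using X_add[OF _ X_scale[of g n "-1"], of f] by (simp add: fun_diff_def plus_fun_def)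

lemma zero_X: "(\<lambda>y. 0) \<in> X \<Lambda> n"
proof -
  have "(\<lambda>y. 0) \<in> Cc_ge \<Lambda> n" unfolding Cc_ge_def Cc_iff by (auto intro!: exI[of _ "{}"])
  then show ?thesis using Cc_ge_subset_X[OF kg] by blast
qed

lemma X_sum: "finite I \<Longrightarrow> (\<And>i. i \<in> I \<Longrightarrow> f i \<in> X \<Lambda> n) \<Longrightarrow> (\<lambda>y. \<Sum>i\<in>I. f i y) \<in> X \<Lambda> n"
proof (induction I rule: finite_induct)
  case (insert i I)
  then show ?case using X_add[of "f i" n "\<lambda>y. \<Sum>i\<in>I. f i y"] by (simp add: plus_fun_def)
qed (simp add: zero_X)

lemma Ccyl_X: "f \<in> Ccyl l \<Longrightarrow> l \<in> mor \<Lambda> \<Longrightarrow> n \<le> dg l \<Longrightarrow> f \<in> X \<Lambda> n"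
  using Ccyl_Cc_ge Cc_ge_subset_X[OF kg] by blast

text \<open>The bound carries an approximation of \<open>h\<close> from
  \<open>Cc_ge \<Lambda> n\<close> over to \<open>A h\<close>, and \<open>X_closed\<close>
  concludes. The sign of \<open>C\<close> is left open, hence the absolute value inside.\<close>

lemma X_bounded_operator:
  assumes A: "\<And>f g. A (f - g) = A f - A g"
    and C: "\<And>h. h \<in> fibre_l2 \<Lambda> n \<Longrightarrow> A h \<in> fibre_l2 \<Lambda> m \<and> nrm m (A h) \<le> C * nrm n h"
    and Cc: "\<And>h. h \<in> Cc_ge \<Lambda> n \<Longrightarrow> A h \<in> X \<Lambda> m" and h: "h \<in> X \<Lambda> n"
  shows "A h \<in> X \<Lambda> m"
proof (rule X_closed)
  show "A h \<in> fibre_l2 \<Lambda> m" using C X_fibre_l2[OF h] by blast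
  fix e :: real assume e: "e > 0"
  obtain d where d: "d > 0" "\<bar>C\<bar> * d < e" using small_factor[OF e] by blast
  then obtain g where g: "g \<in> Cc_ge \<Lambda> n" "nrm n (h - g) < d" using h unfolding X_def by blast
  have hg: "h - g \<in> fibre_l2 \<Lambda> n" using g h X_fibre_l2 Cc_ge_subset_fibre_l2[OF kg] by (intro fibre_l2_diff) auto
  have "nrm m (A h - A g) \<le> C * nrm n (h - g)" using C[OF hg] A by simp
  also have "\<dots> \<le> \<bar>C\<bar> * d" using g mod_norm_nonneg[OF hg] by (intro mult_mono) auto
  also have "\<dots> < e" by fact
  finally show "\<exists>k\<in>X \<Lambda> m. nrm m (A h - k) < e" using Cc[OF g(1)] by blast
qed

text \<open>Norm estimates relating two degrees sum over this partition: a fibre of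
  \<open>shift (m + n)\<close> is the disjoint union of the fibres of \<open>shift m\<close> over
  the points of a fibre of \<open>shift n\<close>.\<close>

lemma fibre_shift:
  "y \<in> fibre \<Lambda> (m + n) x \<longleftrightarrow> y \<in> boundary_ge \<Lambda> m \<and> shift m y \<in> fibre \<Lambda> n x"
proof -
  have "y \<in> boundary_ge \<Lambda> (m + n)" if "y \<in> boundary_ge \<Lambda> m" "shift m y \<in> boundary_ge \<Lambda> n"
    using that shift_eq(1)[OF that(1)] env_diff_le_iff[of m "fst y" n]
    by (auto simp: boundary_ge_def add.commute)
  then show ?thesis using shift_shift[of y m n] by (auto simp: fibre_def)
qed

lemma add_diff_fun: "p \<le> q \<Longrightarrow> p + (q - p) = (q :: 'k \<Rightarrow> nat)"
  by (auto simp: fun_eq_iff le_fun_def)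

text \<open>\<open>swap\<close> does not change \<open>shift p y\<close>, and \<open>shift q\<close>
  factors through \<open>shift p\<close>.\<close>

lemma swap_fibre:
  assumes "y \<in> cyl l" "m \<in> mor \<Lambda>" "src \<Lambda> l = src \<Lambda> m" "dg l = p" "dg m = p" "p \<le> q"
  shows "swap l m y \<in> fibre \<Lambda> q x \<longleftrightarrow> y \<in> fibre \<Lambda> q x"
  using fibre_shift[of _ p "q - p" x] add_diff_fun[OF assms(6)] swap_in[OF assms(1-3)]
    cylinderD(6)[OF assms(1)] cylinderD(6)[OF swap_in(1)[OF assms(1-3)]] assms(4,5) by simp

lemma fibre_ge: "y \<in> boundary_ge \<Lambda> q \<Longrightarrow> y \<in> fibre \<Lambda> q (shift q y)"
  by (simp add: fibre_def)

lemma swap_inj_on: "l \<in> mor \<Lambda> \<Longrightarrow> m \<in> mor \<Lambda> \<Longrightarrow> src \<Lambda> l = src \<Lambda> m \<Longrightarrow> inj_on (swap l m) (cyl l)"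
  by (rule inj_on_inverseI[where g = "swap m l"]) (simp add: swap_swap[where l = l and n = l] swap_self)

section \<open>Elementary compact operators\<close>

definition Op :: "'a \<Rightarrow> 'a \<Rightarrow> (('a, 'k) path \<Rightarrow> complex) \<Rightarrow> (('a, 'k) path \<Rightarrow> complex)
    \<Rightarrow> ('a, 'k) path \<Rightarrow> complex" where
  "Op l m c h y = c y * h (swap l m y)"

text \<open>The operators act on all functions and are not restricted to some
  \<open>X \<Lambda> q\<close>, so one member of \<open>ops p\<close> can be used for every
  \<open>q\<close> above \<open>p\<close>.\<close>

inductive_set ops :: "('k \<Rightarrow> nat) \<Rightarrow> ((('a, 'k) path \<Rightarrow> complex) \<Rightarrow> ('a, 'k) path \<Rightarrow> complex) set"
  for p where
  zero: "(\<lambda>h y. 0) \<in> ops p"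
| add: "A \<in> ops p \<Longrightarrow> l \<in> mor \<Lambda> \<Longrightarrow> m \<in> mor \<Lambda> \<Longrightarrow> src \<Lambda> l = src \<Lambda> m \<Longrightarrow> dg l = p \<Longrightarrow> dg m = p \<Longrightarrow>
    c \<in> Ccyl l \<Longrightarrow> (\<lambda>h y. A h y + Op l m c h y) \<in> ops p"

lemma ops_Op:
  assumes "l \<in> mor \<Lambda>" "m \<in> mor \<Lambda>" "src \<Lambda> l = src \<Lambda> m" "dg l = p" "dg m = p" "c \<in> Ccyl l"
  shows "Op l m c \<in> ops p"
  using ops.add[OF ops.zero assms] by simp

lemma ops_add: "B \<in> ops p \<Longrightarrow> A \<in> ops p \<Longrightarrow> (\<lambda>h y. A h y + B h y) \<in> ops p"
proof (induction rule: ops.induct)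
  case (add B l m c)
  then show ?case using ops.add[of "\<lambda>h y. A h y + B h y" p l m c] by (simp add: add.assoc)
qed simp

lemma ops_scale: "A \<in> ops p \<Longrightarrow> (\<lambda>h y. a * A h y) \<in> ops p"
proof (induction rule: ops.induct)
  case (add A l m c)
  then have "(\<lambda>h y. a * A h y + Op l m (\<lambda>y. a * c y) h y) \<in> ops p" by (intro ops.add Ccyl_scale) auto
  then show ?case by (simp add: Op_def algebra_simps)
qed (simp add: ops.zero)

lemma ops_sum: "finite I \<Longrightarrow> (\<And>i. i \<in> I \<Longrightarrow> A i \<in> ops p) \<Longrightarrow> (\<lambda>h y. \<Sum>i\<in>I. A i h y) \<in> ops p"
proof (induction I rule: finite_induct)
  case (insert i I)
  then show ?case using ops_add[of "\<lambda>h y. \<Sum>i\<in>I. A i h y" p "A i"] by simp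
qed (simp add: ops.zero)

lemma ops_diff: "A \<in> ops p \<Longrightarrow> B \<in> ops p \<Longrightarrow> (\<lambda>h y. A h y - B h y) \<in> ops p"
  using ops_add[OF ops_scale[of B p "-1"], of A] by simp

lemma ops_linear:
  assumes "A \<in> ops p"
  shows "A (f + g) = A f + A g" "A (f - g) = A f - A g" "A (\<lambda>y. c * f y) = (\<lambda>y. c * A f y)"
  using assms by (induction rule: ops.induct) (auto simp: Op_def fun_eq_iff algebra_simps)

text \<open>\<open>swap l m\<close> maps the part of a fibre inside \<open>cyl l\<close> injectively
  into the same fibre, so only the factor \<open>c\<close> can increase sums of squares.\<close>

lemma Op_bounded:
  assumes lm: "l \<in> mor \<Lambda>" "m \<in> mor \<Lambda>" "src \<Lambda> l = src \<Lambda> m" "dg l = p" "dg m = p" and c: "c \<in> Ccyl l"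
    and q: "p \<le> q" and B: "0 \<le> B" "\<And>y. norm (c y) \<le> B" and h: "h \<in> fibre_l2 \<Lambda> q"
  shows "Op l m c h \<in> fibre_l2 \<Lambda> q" "nrm q (Op l m c h) \<le> B * nrm q h"
proof -
  have le: "(\<Sum>y\<in>F. (norm (Op l m c h y))\<^sup>2) \<le> (B * nrm q h)\<^sup>2"
    if F: "finite F" "F \<subseteq> fibre \<Lambda> q x" for F x
  proof -
    let ?F = "F \<inter> cyl l"
    have "(\<Sum>y\<in>F. (norm (Op l m c h y))\<^sup>2) = (\<Sum>y\<in>?F. (norm (Op l m c h y))\<^sup>2)"
      using F Ccyl_zero[OF c] by (intro sum.mono_neutral_right) (auto simp: Op_def)
    also have "\<dots> \<le> (\<Sum>y\<in>?F. B\<^sup>2 * (norm (h (swap l m y)))\<^sup>2)"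
      unfolding Op_def using B by (intro sum_mono) (simp add: norm_mult power_mult_distrib mult_right_mono power_mono)
    also have "\<dots> = B\<^sup>2 * (\<Sum>z\<in>swap l m ` ?F. (norm (h z))\<^sup>2)"
      using inj_on_subset[OF swap_inj_on[OF lm(1-3)]] by (subst sum.reindex) (auto simp: sum_distrib_left)
    also have "swap l m ` ?F \<subseteq> fibre \<Lambda> q x" using F swap_fibre[OF _ lm(2-5) q] by blast
    then have "B\<^sup>2 * (\<Sum>z\<in>swap l m ` ?F. (norm (h z))\<^sup>2) \<le> B\<^sup>2 * (nrm q h)\<^sup>2"
      using F by (intro mult_left_mono fibre_l2_finite_sum_le[OF h]) simp_all
    finally show ?thesis by (simp add: power_mult_distrib)
  qed
  have z: "Op l m c h y = 0" if y: "y \<notin> boundary_ge \<Lambda> q" for y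
  proof (cases "y \<in> cyl l")
    case True
    have "swap l m y \<notin> boundary_ge \<Lambda> q"
    proof
      assume "swap l m y \<in> boundary_ge \<Lambda> q"
      then have "y \<in> fibre \<Lambda> q (shift q (swap l m y))" using swap_fibre[OF True lm(2-5) q] fibre_ge by blast
      then show False using y by (simp add: fibre_def)
    qed
    then show ?thesis using fibre_l2D(1)[OF h] by (simp add: Op_def)
  qed (use Ccyl_zero[OF c] in \<open>simp add: Op_def\<close>)
  have b: "0 \<le> B * nrm q h" using B mod_norm_nonneg[OF h] by simp
  show "Op l m c h \<in> fibre_l2 \<Lambda> q" "nrm q (Op l m c h) \<le> B * nrm q h"
    by (rule fibre_l2_leI[OF b z le]; assumption)+
qed

lemma ops_bounded:
  assumes "A \<in> ops p" "p \<le> q"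
  shows "\<exists>C\<ge>0. \<forall>h\<in>fibre_l2 \<Lambda> q. A h \<in> fibre_l2 \<Lambda> q \<and> nrm q (A h) \<le> C * nrm q h"
  using assms(1)
proof (induction rule: ops.induct)
  case zero
  then show ?case using fibre_l2_zero[of \<Lambda> q] by (intro exI[of _ 0]) auto
next
  case (add A l m c)
  then obtain C where C: "C \<ge> 0" "\<And>h. h \<in> fibre_l2 \<Lambda> q \<Longrightarrow> A h \<in> fibre_l2 \<Lambda> q \<and> nrm q (A h) \<le> C * nrm q h"
    by blast
  obtain B where B: "0 \<le> B" "\<And>y. norm (c y) \<le> B" using Ccyl_bounded[OF add.hyps(7)] by blast
  have eq: "(\<lambda>y. A h y + Op l m c h y) = A h + Op l m c h" for h by (simp add: plus_fun_def)
  have "A h + Op l m c h \<in> fibre_l2 \<Lambda> q \<and> nrm q (A h + Op l m c h) \<le> (C + B) * nrm q h"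
    if h: "h \<in> fibre_l2 \<Lambda> q" for h
    using fibre_l2_add[of "A h" \<Lambda> q "Op l m c h"] C(2)[OF h] Op_bounded[OF add.hyps(2-7) assms(2) B h]
    by (simp add: algebra_simps)
  then show ?case unfolding eq using C(1) B(1) by (intro exI[of _ "C + B"]) auto
qed

lemma ops_fibre_l2: "A \<in> ops p \<Longrightarrow> p \<le> q \<Longrightarrow> h \<in> fibre_l2 \<Lambda> q \<Longrightarrow> A h \<in> fibre_l2 \<Lambda> q"
  using ops_bounded by blast

text \<open>Write \<open>u = m' a\<close> with \<open>m'\<close> of degree \<open>p\<close>. If
  \<open>m'\<close> differs from \<open>m\<close>, the operator kills \<open>h\<close>; otherwise
  the result is supported in \<open>cyl (l a)\<close>, and \<open>l a\<close> has the same degree as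
  \<open>u\<close>.\<close>

lemma Op_Ccyl_X:
  assumes lm: "l \<in> mor \<Lambda>" "m \<in> mor \<Lambda>" "src \<Lambda> l = src \<Lambda> m" "dg l = p" "dg m = p" and c: "c \<in> Ccyl l"
    and u: "u \<in> mor \<Lambda>" "p \<le> dg u" and h: "h \<in> Ccyl u"
  shows "Op l m c h \<in> X \<Lambda> (dg u)"
proof -
  obtain m' a where a: "m' \<in> mor \<Lambda>" "a \<in> mor \<Lambda>" "dg m' = p" "src \<Lambda> m' = rng \<Lambda> a" "u = cmp \<Lambda> m' a"
    using factor_exists[OF u] by metis
  show ?thesis
  proof (cases "m' = m")
    case False
    have "Op l m c h y = 0" for y
    proof (rule ccontr)
      assume "Op l m c h y \<noteq> 0"
      then have "c y \<noteq> 0" "h (swap l m y) \<noteq> 0" by (auto simp: Op_def)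
      then have "y \<in> cyl l" "swap l m y \<in> cyl u" using Ccyl_zero c h by blast+
      then have "swap l m y \<in> cyl m" "swap l m y \<in> cyl m'"
        using swap_in(1)[OF _ lm(2,3)] cylinder_cmp[OF a(1,2,4)] a(5) by auto
      then show False using cylinderD(4) lm(5) a(3) False by metis
    qed
    then have "Op l m c h = (\<lambda>y. 0)" by (rule ext)
    then show ?thesis using zero_X by simp
  next
    case True
    note a = a[unfolded True]
    have la: "src \<Lambda> l = rng \<Lambda> a" using a lm by simp
    note r = cmp_rules[OF lm(1) a(2) la] note r' = cmp_rules[OF lm(2) a(2,4)]
    have "Op l m c h y = pull (cmp \<Lambda> l a) (cmp \<Lambda> m a) h y * c y" for y
    proof (cases "y \<in> cyl l")
      case True
      show ?thesis
        using swap_cmp[OF lm(1-3) a(2) la] cylinder_cmp_swap[OF lm(1-3) a(2) la True] Ccyl_zero[OF h] a(5)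
        by (auto simp: pull_def Op_def)
    qed (use Ccyl_zero[OF c] in \<open>simp add: Op_def\<close>)
    then have "Op l m c h = (\<lambda>y. pull (cmp \<Lambda> l a) (cmp \<Lambda> m a) h y * c y)" by (rule ext)
    moreover have "\<dots> \<in> Ccyl (cmp \<Lambda> l a)"
      using h a(5) r r' c by (intro Ccyl_mult pull_Ccyl) auto
    ultimately show ?thesis using Ccyl_X[of "Op l m c h" "cmp \<Lambda> l a" "dg u"] r r' a(5) lm by simp
  qed
qed

lemma ops_X:
  assumes "A \<in> ops p" "p \<le> q" "h \<in> X \<Lambda> q"
  shows "A h \<in> X \<Lambda> q"
proof -
  obtain C where C: "\<And>h. h \<in> fibre_l2 \<Lambda> q \<Longrightarrow> A h \<in> fibre_l2 \<Lambda> q \<and> nrm q (A h) \<le> C * nrm q h"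
    using ops_bounded[OF assms(1,2)] by blast
  have "A h \<in> X \<Lambda> q" if h: "h \<in> Cc_ge \<Lambda> q" for h
  proof -
    obtain L g where L: "finite L" "\<And>l. l \<in> L \<Longrightarrow> l \<in> mor \<Lambda> \<and> dg l = q \<and> g l \<in> Ccyl l" and hg: "h = (\<lambda>y. \<Sum>l\<in>L. g l y)"
      using Cc_ge_decompose[OF h] by metis
    show ?thesis using assms(1)
    proof (induction rule: ops.induct)
      case (add A l m c)
      have "Op l m c (g u) \<in> X \<Lambda> q" if "u \<in> L" for u
        using Op_Ccyl_X[OF add.hyps(2-7), of u "g u"] L(2)[OF that] assms(2) by auto
      then have "(\<lambda>y. \<Sum>u\<in>L. Op l m c (g u) y) \<in> X \<Lambda> q" by (rule X_sum[OF L(1)])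
      moreover have "Op l m c h = (\<lambda>y. \<Sum>u\<in>L. Op l m c (g u) y)"
        by (rule ext) (simp add: hg Op_def sum_distrib_left)
      ultimately have "Op l m c h \<in> X \<Lambda> q" by simp
      then show ?case using X_add[OF add.IH] by (simp add: plus_fun_def)
    qed (simp add: zero_X)
  qed
  then show ?thesis using X_bounded_operator[OF ops_linear(2)[OF assms(1)] C _ assms(3)] by blast
qed

text \<open>Substituting \<open>z = swap l m y\<close> turns a sum over the part of the fibre in
  \<open>cyl l\<close> into one over the part in \<open>cyl m\<close>, and the conjugated
  coefficient is carried along. Reindexing by a bijection respects \<open>infsum\<close> even
  without summability, so \<open>h\<close> and \<open>k\<close> are arbitrary.\<close>

lemma Op_adjoint:
  assumes lm: "l \<in> mor \<Lambda>" "m \<in> mor \<Lambda>" "src \<Lambda> l = src \<Lambda> m" "dg l = p" "dg m = p" and c: "c \<in> Ccyl l"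
    and q: "p \<le> q"
  shows "ip \<Lambda> q (Op l m c h) k x = ip \<Lambda> q h (Op m l (pull m l (\<lambda>y. cnj (c y))) k) x"
proof -
  let ?A = "fibre \<Lambda> q x \<inter> cyl l" let ?B = "fibre \<Lambda> q x \<inter> cyl m"
  let ?f = "\<lambda>z. cnj (h z) * Op m l (pull m l (\<lambda>y. cnj (c y))) k z"
  have inv: "swap m l (swap l m y) = y" if "y \<in> cyl l" for y
    using swap_swap[OF that lm(2,1,3)] lm(3) swap_self that by simp
  have bij: "bij_betw (swap l m) ?A ?B"
  proof (rule bij_betwI[where g = "swap m l"])
    show "swap l m \<in> ?A \<rightarrow> ?B" using swap_fibre[OF _ lm(2-5) q] swap_in(1)[OF _ lm(2,3)] by auto
    show "swap m l \<in> ?B \<rightarrow> ?A" using swap_fibre[OF _ lm(1) lm(3)[symmetric] lm(5,4) q] swap_in(1)[OF _ lm(1) lm(3)[symmetric]] by auto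
    show "swap m l (swap l m y) = y" if "y \<in> ?A" for y using inv that by simp
    show "swap l m (swap m l y) = y" if "y \<in> ?B" for y
      using swap_swap[of y m l m] lm swap_self that by simp
  qed
  have "ip \<Lambda> q (Op l m c h) k x = (\<Sum>\<^sub>\<infinity>y\<in>?A. cnj (Op l m c h y) * k y)"
    unfolding ip_def using Ccyl_zero[OF c] by (intro infsum_cong_neutral) (auto simp: Op_def)
  also have "\<dots> = (\<Sum>\<^sub>\<infinity>y\<in>?A. ?f (swap l m y))"
    using swap_in(1)[OF _ lm(2,3)] inv by (intro infsum_cong) (auto simp: Op_def pull_def)
  also have "\<dots> = (\<Sum>\<^sub>\<infinity>z\<in>?B. ?f z)" by (rule infsum_reindex_bij_betw[OF bij])
  also have "\<dots> = ip \<Lambda> q h (Op m l (pull m l (\<lambda>y. cnj (c y))) k) x"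
    unfolding ip_def by (intro infsum_cong_neutral) (auto simp: Op_def pull_def)
  finally show ?thesis .
qed

lemma ops_adjoint:
  assumes "A \<in> ops p"
  shows "\<exists>B\<in>ops p. \<forall>q\<ge>p. \<forall>h\<in>fibre_l2 \<Lambda> q. \<forall>k\<in>fibre_l2 \<Lambda> q. ip \<Lambda> q (A h) k = ip \<Lambda> q h (B k)"
  using assms
proof (induction rule: ops.induct)
  case zero
  then show ?case by (intro bexI[of _ "\<lambda>h y. 0"]) (auto simp: ip_def ops.zero)
next
  case (add A l m c)
  then obtain B where B: "B \<in> ops p" "\<And>q h k. p \<le> q \<Longrightarrow> h \<in> fibre_l2 \<Lambda> q \<Longrightarrow> k \<in> fibre_l2 \<Lambda> q \<Longrightarrow> ip \<Lambda> q (A h) k = ip \<Lambda> q h (B k)"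
    by blast
  let ?d = "pull m l (\<lambda>y. cnj (c y))"
  have d: "?d \<in> Ccyl m" using add.hyps by (intro pull_Ccyl Ccyl_cnj) auto
  have B': "(\<lambda>h y. B h y + Op m l ?d h y) \<in> ops p" using add.hyps B(1) d by (intro ops.add) auto
  have O: "Op l m c \<in> ops p" "Op m l ?d \<in> ops p" using add.hyps d by (auto intro: ops_Op)
  have "ip \<Lambda> q (\<lambda>y. A h y + Op l m c h y) k = ip \<Lambda> q h (\<lambda>y. B k y + Op m l ?d k y)"
    if q: "p \<le> q" and h: "h \<in> fibre_l2 \<Lambda> q" and k: "k \<in> fibre_l2 \<Lambda> q" for q h k
  proof
    fix x
    have "ip \<Lambda> q (A h + Op l m c h) k x = ip \<Lambda> q (A h) k x + ip \<Lambda> q (Op l m c h) k x"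
      using ops_fibre_l2[OF add.hyps(1) q h] ops_fibre_l2[OF O(1) q h] k by (rule ip_add_left)
    also have "\<dots> = ip \<Lambda> q h (B k) x + ip \<Lambda> q h (Op m l ?d k) x"
      using B(2)[OF q h k] Op_adjoint[OF add.hyps(2-7) q] by simp
    also have "\<dots> = ip \<Lambda> q h (B k + Op m l ?d k) x"
      using ip_add_right[OF h ops_fibre_l2[OF B(1) q k] ops_fibre_l2[OF O(2) q k]] by simp
    finally show "ip \<Lambda> q (\<lambda>y. A h y + Op l m c h y) k x = ip \<Lambda> q h (\<lambda>y. B k y + Op m l ?d k y) x"
      by (simp add: plus_fun_def)
  qed
  then show ?case using B' by (intro bexI[of _ "\<lambda>h y. B h y + Op m l ?d h y"]) auto
qed

text \<open>\<open>swap\<close> preserves \<open>shift p\<close>, so the factor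
  \<open>g (shift p y)\<close> passes through. This is the identity that characterises
  \<open>iota\<close>.\<close>

lemma ops_mult:
  assumes "A \<in> ops p" shows "A (mult p f g) = mult p (A f) g"
  using assms
proof (induction rule: ops.induct)
  case (add A l m c)
  have "Op l m c (mult p f g) y = mult p (Op l m c f) g y" for y
    using Ccyl_zero[OF add.hyps(7), of y] swap_in(2)[of y l m] add.hyps
    by (cases "y \<in> cyl l") (simp_all add: Op_def mult_def)
  then show ?case using add.IH by (simp add: mult_def fun_eq_iff algebra_simps)
qed (simp add: mult_def)

text \<open>On \<open>y = l1 \<alpha> w\<close> the exchanges read \<open>l1 \<alpha> w\<close>,
  then \<open>l2 \<alpha> w = l3 \<beta> w\<close>, then \<open>l4 \<beta> w\<close>, for the one
  pair in \<open>min_ext \<Lambda> l2 l3\<close> that fits \<open>y\<close>. So each pair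
  contributes an elementary operator from \<open>l1 \<alpha>\<close> to \<open>l4 \<beta>\<close>
  with coefficient \<open>c y * d (swap l1 l2 y)\<close>. Both morphisms have degree
  \<open>sup m n\<close> because \<open>l1\<close>, \<open>l2\<close> and \<open>l3\<close>,
  \<open>l4\<close> have equal degrees.\<close>

lemma Op_product:
  assumes l: "l1 \<in> mor \<Lambda>" "l2 \<in> mor \<Lambda>" "src \<Lambda> l1 = src \<Lambda> l2" "dg l1 = m" "dg l2 = m" and c: "c \<in> Ccyl l1"
    and l': "l3 \<in> mor \<Lambda>" "l4 \<in> mor \<Lambda>" "src \<Lambda> l3 = src \<Lambda> l4" "dg l3 = n" "dg l4 = n" and d: "d \<in> Ccyl l3"
  shows "(\<lambda>h. Op l1 l2 c (Op l3 l4 d h)) \<in> ops (sup m n)"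
proof -
  let ?M = "min_ext \<Lambda> l2 l3"
  \<comment> \<open>\<open>d\<close> is cut down to \<open>cyl (l2 \<alpha>)\<close> so that
    \<open>pull\<close> receives a member of \<open>Ccyl (l2 \<alpha>)\<close>.\<close>
  define e where "e = (\<lambda>(\<alpha> :: 'a, \<beta> :: 'a) y. pull (cmp \<Lambda> l1 \<alpha>) (cmp \<Lambda> l2 \<alpha>) (\<lambda>z. if z \<in> cyl (cmp \<Lambda> l2 \<alpha>) then d z else 0) y * c y)"
  define P where "P = (\<lambda>(\<alpha>, \<beta>). Op (cmp \<Lambda> l1 \<alpha>) (cmp \<Lambda> l4 \<beta>) (e (\<alpha>, \<beta>)))"
  have D: "\<alpha> \<in> mor \<Lambda>" "\<beta> \<in> mor \<Lambda>" "src \<Lambda> l1 = rng \<Lambda> \<alpha>" "src \<Lambda> l2 = rng \<Lambda> \<alpha>" "src \<Lambda> l3 = rng \<Lambda> \<beta>" "src \<Lambda> l4 = rng \<Lambda> \<beta>"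
    "cmp \<Lambda> l2 \<alpha> = cmp \<Lambda> l3 \<beta>" "src \<Lambda> \<alpha> = src \<Lambda> \<beta>" "dg (cmp \<Lambda> l1 \<alpha>) = sup m n" "dg (cmp \<Lambda> l4 \<beta>) = sup m n"
    "dg (cmp \<Lambda> l2 \<alpha>) = sup m n" if ab: "(\<alpha>, \<beta>) \<in> ?M" for \<alpha> \<beta>
  proof -
    note E = min_extD[OF ab]
    show *: "\<alpha> \<in> mor \<Lambda>" "\<beta> \<in> mor \<Lambda>" "src \<Lambda> l1 = rng \<Lambda> \<alpha>" "src \<Lambda> l2 = rng \<Lambda> \<alpha>" "src \<Lambda> l3 = rng \<Lambda> \<beta>" "src \<Lambda> l4 = rng \<Lambda> \<beta>"
      "cmp \<Lambda> l2 \<alpha> = cmp \<Lambda> l3 \<beta>" "dg (cmp \<Lambda> l2 \<alpha>) = sup m n" using E l l' by simp_all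
    show "src \<Lambda> \<alpha> = src \<Lambda> \<beta>" using cmp_rules(3)[OF l(2) *(1,4)] cmp_rules(3)[OF l'(1) *(2,5)] *(7) by simp
    show "dg (cmp \<Lambda> l1 \<alpha>) = sup m n" "dg (cmp \<Lambda> l4 \<beta>) = sup m n"
      using cmp_rules(4)[OF l(1) *(1,3)] cmp_rules(4)[OF l(2) *(1,4)] cmp_rules(4)[OF l'(1) *(2,5)] cmp_rules(4)[OF l'(2) *(2,6)]
        *(7,8) l l' by simp_all
  qed
  have "P ab \<in> ops (sup m n)" if "ab \<in> ?M" for ab
  proof -
    obtain \<alpha> \<beta> where ab: "ab = (\<alpha>, \<beta>)" by (cases ab)
    note D = D[OF that[unfolded ab]]
    note r = cmp_rules[OF l(1) D(1,3)] cmp_rules[OF l(2) D(1,4)] cmp_rules[OF l'(2) D(2,6)]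
    have "e (\<alpha>, \<beta>) \<in> Ccyl (cmp \<Lambda> l1 \<alpha>)" unfolding e_def prod.case
      by (rule Ccyl_mult[OF pull_Ccyl[OF _ _ _ Ccyl_restrict[OF d]] c]) (use r in auto)
    then show ?thesis unfolding ab P_def prod.case using r D by (intro ops_Op) auto
  qed
  then have "(\<lambda>h y. \<Sum>ab\<in>?M. P ab h y) \<in> ops (sup m n)" using ops_sum finite_min_ext[OF l(2) l'(1)] by blast
  moreover have "Op l1 l2 c (Op l3 l4 d h) y = (\<Sum>ab\<in>?M. P ab h y)" for h y
  proof (cases "c y = 0 \<or> d (swap l1 l2 y) = 0")
    case True
    have "P ab h y = 0" if "ab \<in> ?M" for ab
    proof -
      obtain \<alpha> \<beta> where ab: "ab = (\<alpha>, \<beta>)" by (cases ab)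
      note D = D[OF that[unfolded ab]]
      show ?thesis using True swap_cmp[OF l(1-3) D(1,3)] by (auto simp: ab P_def e_def Op_def pull_def)
    qed
    then show ?thesis using True by (auto simp: Op_def)
  next
    case False
    let ?z = "swap l1 l2 y"
    have y: "y \<in> cyl l1" using False Ccyl_zero[OF c] by blast
    have z: "?z \<in> cyl l2" "?z \<in> cyl l3" using swap_in(1)[OF y l(2,3)] False Ccyl_zero[OF d] by blast+
    then obtain \<alpha> \<beta> where ab: "(\<alpha>, \<beta>) \<in> ?M" "?z \<in> cyl (cmp \<Lambda> l2 \<alpha>)"
      using cylinder_Int[OF l(2) l'(1)] by blast
    note E = D[OF ab(1)]
    have ya: "y \<in> cyl (cmp \<Lambda> l1 \<alpha>)" using cylinder_cmp_swap[OF l(1-3) E(1,3) y] ab(2) by blast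
    have zb: "?z \<in> cyl (cmp \<Lambda> l3 \<beta>)" using ab(2) E(7) by simp
    \<comment> \<open>Two extensions \<open>l2 \<alpha>\<close> and \<open>l2 \<alpha>'\<close> of
      the same degree whose cylinders share \<open>?z\<close> coincide; cancelling
      \<open>l2\<close>, and likewise \<open>l3\<close>, identifies the pairs.\<close>
    have uniq: "P ab' h y = 0" if ab': "ab' \<in> ?M" "ab' \<noteq> (\<alpha>, \<beta>)" for ab'
    proof (rule ccontr)
      obtain \<alpha>' \<beta>' where e': "ab' = (\<alpha>', \<beta>')" by (cases ab')
      note E' = D[OF ab'(1)[unfolded e']]
      assume "P ab' h y \<noteq> 0"
      then have "y \<in> cyl (cmp \<Lambda> l1 \<alpha>')" by (auto simp: e' P_def e_def Op_def pull_def split: if_splits)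
      then have "?z \<in> cyl (cmp \<Lambda> l2 \<alpha>')" using cylinder_cmp_swap[OF l(1-3) E'(1,3) y] by blast
      then have eq: "cmp \<Lambda> l2 \<alpha>' = cmp \<Lambda> l2 \<alpha>" using cylinderD(4) ab(2) E(11) E'(11) by metis
      then have "\<alpha>' = \<alpha>" using factor_unique(2)[OF l(2) E'(1) l(2) E(1) refl E'(4) E(4)] by simp
      moreover have "\<beta>' = \<beta>" using factor_unique(2)[OF l'(1) E'(2) l'(1) E(2) refl E'(5) E(5)] eq E(7) E'(7) by simp
      ultimately show False using ab'(2) e' by simp
    qed
    have "(\<Sum>ab\<in>?M. P ab h y) = P (\<alpha>, \<beta>) h y"
      using sum.remove[OF finite_min_ext[OF l(2) l'(1)] ab(1), of "\<lambda>ab. P ab h y"] uniq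
        sum.neutral[of "?M - {(\<alpha>, \<beta>)}" "\<lambda>ab. P ab h y"] by simp
    also have "\<dots> = c y * d ?z * h (swap (cmp \<Lambda> l1 \<alpha>) (cmp \<Lambda> l4 \<beta>) y)"
      using ya swap_cmp[OF l(1-3) E(1,3) ya] ab(2) by (simp add: P_def e_def Op_def pull_def)
    also have "swap (cmp \<Lambda> l1 \<alpha>) (cmp \<Lambda> l4 \<beta>) y = swap l3 l4 ?z"
    proof -
      note r = cmp_rules[OF l(1) E(1,3)] cmp_rules[OF l(2) E(1,4)] cmp_rules[OF l'(2) E(2,6)]
      have "swap l3 l4 ?z = swap (cmp \<Lambda> l3 \<beta>) (cmp \<Lambda> l4 \<beta>) ?z" using swap_cmp[OF l'(1-3) E(2,5) zb] by simp
      also have "\<dots> = swap (cmp \<Lambda> l2 \<alpha>) (cmp \<Lambda> l4 \<beta>) (swap (cmp \<Lambda> l1 \<alpha>) (cmp \<Lambda> l2 \<alpha>) y)"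
        using swap_cmp[OF l(1-3) E(1,3) ya] E(7) by simp
      also have "\<dots> = swap (cmp \<Lambda> l1 \<alpha>) (cmp \<Lambda> l4 \<beta>) y"
        using swap_swap[OF ya] r E(8) by simp
      finally show ?thesis ..
    qed
    finally show ?thesis by (simp add: Op_def)
  qed
  then have "Op l1 l2 c (Op l3 l4 d h) = (\<lambda>y. \<Sum>ab\<in>?M. P ab h y)" for h by (rule ext)
  ultimately show ?thesis by simp
qed

lemma ops_product:
  assumes "A \<in> ops m" "B \<in> ops n" shows "(\<lambda>h. A (B h)) \<in> ops (sup m n)"
  using assms(1)
proof (induction rule: ops.induct)
  case zero
  show ?case by (rule ops.zero)
next
  case (add A l1 l2 c)
  have "(\<lambda>h. Op l1 l2 c (B h)) \<in> ops (sup m n)"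
    using assms(2)
  proof (induction rule: ops.induct)
    case zero
    have "Op l1 l2 c (\<lambda>y. 0) = (\<lambda>y. 0)" by (rule ext) (simp add: Op_def)
    then show ?case using ops.zero[of "sup m n"] by (simp only:)
  next
    case B: (add B l3 l4 d)
    have "Op l1 l2 c (\<lambda>y. B h y + Op l3 l4 d h y) = (\<lambda>y. Op l1 l2 c (B h) y + Op l1 l2 c (Op l3 l4 d h) y)" for h
      by (rule ext) (simp add: Op_def algebra_simps)
    then show ?case using ops_add[OF Op_product[OF add.hyps(2-7) B.hyps(2-7)] B.IH] by (simp only:)
  qed
  from ops_add[OF this add.IH] show ?case .
qed

end

section \<open>Two facts of analysis for the rank-one operators\<close>

lemma infsum_finite_sum:
  fixes f :: "'i \<Rightarrow> 'b \<Rightarrow> complex"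
  assumes "finite I" "\<And>i. i \<in> I \<Longrightarrow> f i summable_on S"
  shows "(\<lambda>x. \<Sum>i\<in>I. f i x) summable_on S \<and> infsum (\<lambda>x. \<Sum>i\<in>I. f i x) S = (\<Sum>i\<in>I. infsum (f i) S)"
  using assms by (induction I rule: finite_induct) (auto simp: infsum_add intro: summable_on_add)

text \<open>Allows a coefficient \<open>c\<close> to be split into \<open>c / sqrt |c|\<close> and
  \<open>sqrt |c|\<close> with both factors continuous. At 0 the quotient is 0 by convention, and
  its norm \<open>sqrt |z|\<close> tends to 0.\<close>

lemma continuous_on_div_sqrt_norm: "continuous_on UNIV (\<lambda>z::complex. z / of_real (sqrt (norm z)))"
  unfolding continuous_on_eq_continuous_at[OF open_UNIV]
proof
  fix z :: complex
  show "isCont (\<lambda>z. z / of_real (sqrt (norm z))) z"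
  proof (cases "z = 0")
    case True
    have "((\<lambda>z::complex. sqrt (norm z)) \<longlongrightarrow> sqrt (norm (0::complex))) (at 0)" by (intro tendsto_intros)
    then have "((\<lambda>z::complex. sqrt (norm z)) \<longlongrightarrow> 0) (at 0)" by simp
    then have "((\<lambda>z::complex. z / of_real (sqrt (norm z))) \<longlongrightarrow> 0) (at 0)"
    proof (rule Lim_null_comparison[rotated])
      have "norm (z / of_real (sqrt (norm z))) = sqrt (norm z)" for z :: complex
        by (simp add: norm_divide real_div_sqrt)
      then show "\<forall>\<^sub>F z::complex in at 0. norm (z / of_real (sqrt (norm z))) \<le> sqrt (norm z)" by simp
    qed
    then show ?thesis using True by (simp add: isCont_def)
  qed (auto intro!: continuous_intros)
qed

context aligned_kgraph
begin

section \<open>Operators fibre by fibre\<close>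

text \<open>The concatenation \<open>m w\<close>, seen as the exchange of the vertex
  \<open>src \<Lambda> m\<close>, a segment of degree 0, for \<open>m\<close>.\<close>

definition cat :: "'a \<Rightarrow> ('a, 'k) path \<Rightarrow> ('a, 'k) path" where
  "cat m w = swap (src \<Lambda> m) m w"

lemma cat_props:
  assumes "m \<in> mor \<Lambda>" "w \<in> cyl (src \<Lambda> m)"
  shows "cat m w \<in> cyl m" "shift (dg m) (cat m w) = w"
proof -
  note r = category_rules(6,10)[OF assms(1)]
  have "shift 0 w = w" using shift_zero cylinderD(2)[OF assms(2)] by blast
  then show "cat m w \<in> cyl m" "shift (dg m) (cat m w) = w"
    using swap_in[OF assms(2,1) r(1)] r(2) by (simp_all add: cat_def)
qed

lemma cat_eqI:
  assumes "y \<in> cyl m"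
  shows "cat m (shift (dg m) y) = y"
proof -
  have m: "m \<in> mor \<Lambda>" using cylinderD(5)[OF assms] .
  note w = shift_in_cylinder_src[OF assms]
  show ?thesis using inj_onD[OF shift_inj_on_cylinder[OF kg refl] cat_props(2)[OF m w] cat_props(1)[OF m w] assms] .
qed

lemma swap_eq_cat:
  assumes "y \<in> cyl l" "m \<in> mor \<Lambda>" "src \<Lambda> l = src \<Lambda> m"
  shows "swap l m y = cat m (shift (dg l) y)"
  using cat_eqI[OF swap_in(1)[OF assms]] swap_in(2)[OF assms] by simp

lemma source_unique:
  assumes "l \<in> mor \<Lambda>" "m \<in> mor \<Lambda>" "w \<in> cyl (src \<Lambda> l)" "w \<in> cyl (src \<Lambda> m)"
  shows "src \<Lambda> l = src \<Lambda> m"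
  using cylinderD(4)[OF assms(3)] cylinderD(4)[OF assms(4)] category_rules(10)[OF assms(1)] category_rules(10)[OF assms(2)] by simp

text \<open>At \<open>y = l w\<close> a summand reads \<open>h\<close> only in the point
  \<open>m w\<close>, so \<open>M\<close> collects the second morphisms of the summands. It depends
  neither on \<open>h\<close> nor on \<open>y\<close>.\<close>

lemma ops_local:
  assumes "A \<in> ops p"
  shows "\<exists>M. finite M \<and> (\<forall>m\<in>M. m \<in> mor \<Lambda> \<and> dg m = p) \<and>
    (\<forall>h h' y. (\<forall>m\<in>M. shift p y \<in> cyl (src \<Lambda> m) \<longrightarrow> h (cat m (shift p y)) = h' (cat m (shift p y))) \<longrightarrow> A h y = A h' y)"
  using assms
proof (induction rule: ops.induct)
  case zero
  then show ?case by (intro exI[of _ "{}"]) simp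
next
  case (add A l m c)
  then obtain M where M: "finite M" "\<forall>m\<in>M. m \<in> mor \<Lambda> \<and> dg m = p"
    "\<And>h h' y. (\<forall>m\<in>M. shift p y \<in> cyl (src \<Lambda> m) \<longrightarrow> h (cat m (shift p y)) = h' (cat m (shift p y))) \<Longrightarrow> A h y = A h' y"
    by blast
  have "A h y + Op l m c h y = A h' y + Op l m c h' y"
    if eq: "\<forall>m\<in>insert m M. shift p y \<in> cyl (src \<Lambda> m) \<longrightarrow> h (cat m (shift p y)) = h' (cat m (shift p y))" for h h' y
  proof -
    have "Op l m c h y = Op l m c h' y"
    proof (cases "y \<in> cyl l")
      case True
      then have "shift p y \<in> cyl (src \<Lambda> m)" using shift_in_cylinder_src[OF True] add.hyps by simp
      then show ?thesis using eq swap_eq_cat[OF True add.hyps(3,4)] add.hyps(5) by (simp add: Op_def)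
    qed (use Ccyl_zero[OF add.hyps(7)] in \<open>simp add: Op_def\<close>)
    moreover have "A h y = A h' y" using eq by (intro M(3)) blast
    ultimately show ?thesis by simp
  qed
  then show ?case using M(1,2) add.hyps by (intro exI[of _ "insert m M"] conjI allI impI) blast+
qed

text \<open>Some summand has a nonzero coefficient at \<open>y\<close>. That coefficient is the
  source of the compactly supported bump at \<open>y\<close> used below.\<close>

lemma ops_nonzero:
  assumes "A \<in> ops p" "A h y \<noteq> 0"
  shows "\<exists>l c. l \<in> mor \<Lambda> \<and> dg l = p \<and> c \<in> Ccyl l \<and> c y \<noteq> 0"
  using assms
proof (induction rule: ops.induct)
  case (add A l m c)
  then show ?case by (cases "c y = 0") (auto simp: Op_def)
qed simp

lemma Ccyl_bump:
  assumes "c \<in> Ccyl l" "c y0 \<noteq> 0"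
  shows "\<exists>b\<in>Ccyl l. b y0 = 1 \<and> (\<forall>y. norm (b y) \<le> 1)"
proof -
  let ?h = "\<lambda>z::complex. complex_of_real (min 1 (norm z / norm (c y0)))"
  have "continuous_on UNIV ?h" using assms(2) by (intro continuous_intros) auto
  then have "(\<lambda>y. ?h (c y)) \<in> Ccyl l" by (rule Ccyl_compose[OF assms(1)]) simp
  moreover have "?h (c y0) = 1" using assms(2) by simp
  moreover have "norm (?h (c y)) \<le> 1" for y by (simp only: norm_of_real) (simp add: abs_le_iff min_le_iff_disj)
  ultimately show ?thesis by (intro bexI[of _ "\<lambda>y. ?h (c y)"]) auto
qed

text \<open>Copies of the bump \<open>b\<close> are placed on the cylinders of the \<open>m\<close>
  in \<open>M\<close> and scaled by \<open>a m\<close>. A fibre of \<open>shift p\<close> meets each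
  \<open>cyl m\<close> in at most one point and \<open>b\<close> is bounded by 1, which gives the
  norm estimate.\<close>

lemma test_function:
  assumes M: "finite M" "\<And>m. m \<in> M \<Longrightarrow> m \<in> mor \<Lambda> \<and> dg m = p \<and> src \<Lambda> m = src \<Lambda> l"
    and l: "l \<in> mor \<Lambda>" "dg l = p" and b: "b \<in> Ccyl l" "\<And>y. norm (b y) \<le> 1"
    and w: "w \<in> cyl (src \<Lambda> l)" "b (cat l w) = 1"
  shows "\<exists>f\<in>X \<Lambda> p. (\<forall>m\<in>M. f (cat m w) = a m) \<and> (nrm p f)\<^sup>2 \<le> (\<Sum>m\<in>M. (norm (a m))\<^sup>2)"
proof -
  define f where "f y = (\<Sum>m\<in>M. a m * pull m l b y)" for y
  have "(\<lambda>y. a m * pull m l b y) \<in> X \<Lambda> p" if "m \<in> M" for m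
    using M(2)[OF that] l b(1) by (intro X_scale Ccyl_X[of _ m] pull_Ccyl) auto
  then have fX: "f \<in> X \<Lambda> p" unfolding f_def[abs_def] by (intro X_sum M(1)) blast
  have f_in: "f y = a m * b (swap m l y)" if m: "m \<in> M" and y: "y \<in> cyl m" for m y
  proof -
    have "pull m' l b y = 0" if "m' \<in> M - {m}" for m'
    proof -
      have "y \<notin> cyl m'" using that M(2)[of m'] M(2)[OF m] cylinderD(4)[OF y] cylinderD(4)[of y m'] by auto
      then show ?thesis by (simp add: pull_def)
    qed
    then show ?thesis unfolding f_def using sum.remove[OF M(1) m, of "\<lambda>m. a m * pull m l b y"] y
      by (simp add: pull_def)
  qed
  have f_out: "\<exists>m\<in>M. y \<in> cyl m" if "f y \<noteq> 0" for y
  proof (rule ccontr)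
    assume "\<not> ?thesis"
    then have "f y = 0" unfolding f_def pull_def by (intro sum.neutral) auto
    then show False using that by simp
  qed
  have val: "f (cat m w) = a m" if m: "m \<in> M" for m
  proof -
    note m' = M(2)[OF m]
    have wm: "w \<in> cyl (src \<Lambda> m)" using w m' by simp
    note c = cat_props[OF _ wm]
    have "swap m l (cat m w) = cat l w" using swap_eq_cat[OF c(1) l(1)] c(2) m' by simp
    then show ?thesis using f_in[OF m c(1)] m' w(2) by simp
  qed
  have "(\<Sum>y\<in>G. (norm (f y))\<^sup>2) \<le> (sqrt (\<Sum>m\<in>M. (norm (a m))\<^sup>2))\<^sup>2" if G: "finite G" "G \<subseteq> fibre \<Lambda> p x" for G x
  proof -
    define G' where "G' = {y \<in> G. f y \<noteq> 0}"
    \<comment> \<open>\<open>h y\<close> is the label of the cylinder containing \<open>y\<close>;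
      within one fibre it determines \<open>y\<close>, so the sum over \<open>G'\<close> can be
      moved to labels in \<open>M\<close>.\<close>
    define h where "h y = snd y (0, p)" for y :: "('a, 'k) path"
    have h: "h y \<in> M" "y \<in> cyl (h y)" if y: "y \<in> G'" for y
    proof -
      obtain m where m: "m \<in> M" "y \<in> cyl m" using y f_out unfolding G'_def by blast
      then have "h y = m" using cylinderD(4)[OF m(2)] M(2)[OF m(1)] by (simp add: h_def)
      then show "h y \<in> M" "y \<in> cyl (h y)" using m by auto
    qed
    have inj: "inj_on h G'"
    proof (rule inj_onI)
      fix y z assume yz: "y \<in> G'" "z \<in> G'" "h y = h z"
      have "shift p y = shift p z" using yz G unfolding G'_def fibre_def by blast
      then show "y = z" using cat_eqI[OF h(2)[OF yz(1)]] cat_eqI[OF h(2)[OF yz(2)]] M(2)[OF h(1)[OF yz(1)]] yz(3) by simp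
    qed
    have "(\<Sum>y\<in>G. (norm (f y))\<^sup>2) = (\<Sum>y\<in>G'. (norm (f y))\<^sup>2)"
      using G unfolding G'_def by (intro sum.mono_neutral_right) auto
    also have "\<dots> \<le> (\<Sum>y\<in>G'. (norm (a (h y)))\<^sup>2)"
    proof (rule sum_mono)
      fix y assume y: "y \<in> G'"
      have "norm (f y) \<le> norm (a (h y)) * 1"
        unfolding f_in[OF h[OF y]] norm_mult using b(2) by (intro mult_left_mono) auto
      then show "(norm (f y))\<^sup>2 \<le> (norm (a (h y)))\<^sup>2" by (intro power_mono) auto
    qed
    also have "\<dots> = (\<Sum>m\<in>h ` G'. (norm (a m))\<^sup>2)" by (simp add: sum.reindex[OF inj])
    also have "\<dots> \<le> (\<Sum>m\<in>M. (norm (a m))\<^sup>2)" using h M(1) by (intro sum_mono2) auto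
    finally show ?thesis by (simp add: sum_nonneg)
  qed
  from fibre_l2_leI(2)[OF _ _ this] have "nrm p f \<le> sqrt (\<Sum>m\<in>M. (norm (a m))\<^sup>2)"
    using fibre_l2D(1)[OF X_fibre_l2[OF fX]] by (simp add: sum_nonneg)
  then have "(nrm p f)\<^sup>2 \<le> (sqrt (\<Sum>m\<in>M. (norm (a m))\<^sup>2))\<^sup>2"
    by (intro power_mono mod_norm_nonneg X_fibre_l2 fX)
  then show ?thesis using fX val by (intro bexI[of _ f]) (auto simp: sum_nonneg)
qed

text \<open>On a given fibre, \<open>A\<close> sees only finitely many values of \<open>h\<close>; these are also the values of an
  element of \<open>X\<^bsub>p\<^esub>\<close> whose norm they bound, to which the hypothesis on \<open>A\<close> applies.\<close>

lemma ops_local_bound: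
  assumes A: "A \<in> ops p" and C: "0 \<le> C" "\<And>h. h \<in> X \<Lambda> p \<Longrightarrow> nrm p (A h) \<le> C * nrm p h"
    and F: "finite F" "F \<subseteq> fibre \<Lambda> p w"
  shows "\<exists>Z. finite Z \<and> Z \<subseteq> fibre \<Lambda> p w \<and> (\<Sum>y\<in>F. (norm (A h y))\<^sup>2) \<le> C\<^sup>2 * (\<Sum>z\<in>Z. (norm (h z))\<^sup>2)"
proof (cases "\<forall>y\<in>F. A h y = 0")
  case True
  then show ?thesis by (intro exI[of _ "{}"]) simp
next
  case False
  then obtain y0 where y0: "y0 \<in> F" "A h y0 \<noteq> 0" by blast
  obtain l c where l: "l \<in> mor \<Lambda>" "dg l = p" "c \<in> Ccyl l" "c y0 \<noteq> 0" using ops_nonzero[OF A y0(2)] by blast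
  obtain b where b: "b \<in> Ccyl l" "b y0 = 1" "\<And>y. norm (b y) \<le> 1" using Ccyl_bump[OF l(3,4)] by blast
  have yl: "y0 \<in> cyl l" using l Ccyl_zero by blast
  have ys: "shift p y = w" if "y \<in> F" for y using that F by (auto simp: fibre_def)
  have w: "w \<in> cyl (src \<Lambda> l)" "cat l w = y0"
    using shift_in_cylinder_src[OF yl] cat_eqI[OF yl] l(2) ys[OF y0(1)] by auto
  obtain M where M: "finite M" "\<forall>m\<in>M. m \<in> mor \<Lambda> \<and> dg m = p"
    "\<And>h h' y. (\<forall>m\<in>M. shift p y \<in> cyl (src \<Lambda> m) \<longrightarrow> h (cat m (shift p y)) = h' (cat m (shift p y))) \<Longrightarrow> A h y = A h' y"
    using ops_local[OF A] by blast
  \<comment> \<open>Only morphisms whose source is the starting vertex of \<open>w\<close> can be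
    followed by \<open>w\<close>; \<open>ops_local\<close> puts no condition on the others.\<close>
  define M' where "M' = {m \<in> M. src \<Lambda> m = src \<Lambda> l}"
  have M': "finite M'" "m \<in> M' \<Longrightarrow> m \<in> mor \<Lambda> \<and> dg m = p \<and> src \<Lambda> m = src \<Lambda> l" for m
    using M by (auto simp: M'_def)
  have bw: "b (cat l w) = 1" using w b by simp
  obtain f where f: "f \<in> X \<Lambda> p" "\<And>m. m \<in> M' \<Longrightarrow> f (cat m w) = h (cat m w)"
    "(nrm p f)\<^sup>2 \<le> (\<Sum>m\<in>M'. (norm (h (cat m w)))\<^sup>2)"
    using test_function[OF M' l(1,2) b(1,3) w(1) bw, of "\<lambda>m. h (cat m w)"] by blast
  have eq: "A h y = A f y" if "y \<in> F" for y
  proof (rule M(3), intro ballI impI)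
    fix m assume m: "m \<in> M" "shift p y \<in> cyl (src \<Lambda> m)"
    then have "m \<in> M'" using source_unique[OF _ l(1) _ w(1), of m] M(2) ys[OF that] by (simp add: M'_def)
    then show "h (cat m (shift p y)) = f (cat m (shift p y))" using f(2) ys[OF that] by simp
  qed
  have c: "cat m w \<in> cyl m" "shift p (cat m w) = w" if "m \<in> M'" for m
    using cat_props[of m w] M'(2)[OF that] w(1) by auto
  have inj: "inj_on (\<lambda>m. cat m w) M'"
  proof (rule inj_onI)
    fix m m' assume "m \<in> M'" "m' \<in> M'" "cat m w = cat m' w"
    then show "m = m'" using cylinderD(4)[OF c(1)[of m]] cylinderD(4)[OF c(1)[of m']] M'(2)[of m] M'(2)[of m'] by simp
  qed
  let ?Z = "(\<lambda>m. cat m w) ` M'"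
  have Z: "?Z \<subseteq> fibre \<Lambda> p w"
  proof (rule image_subsetI)
    fix m assume "m \<in> M'"
    then show "cat m w \<in> fibre \<Lambda> p w" using c[of m] cylinderD(6)[OF c(1)[of m]] M'(2)[of m] by (simp add: fibre_def)
  qed
  have "(\<Sum>y\<in>F. (norm (A h y))\<^sup>2) = (\<Sum>y\<in>F. (norm (A f y))\<^sup>2)" using eq by simp
  also have "\<dots> \<le> (nrm p (A f))\<^sup>2"
    by (rule fibre_l2_finite_sum_le[OF ops_fibre_l2[OF A order_refl X_fibre_l2[OF f(1)]] F])
  also have "\<dots> \<le> (C * nrm p f)\<^sup>2"
    using C(2)[OF f(1)] mod_norm_nonneg[OF ops_fibre_l2[OF A order_refl X_fibre_l2[OF f(1)]]] by (rule power_mono)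
  also have "\<dots> \<le> C\<^sup>2 * (\<Sum>m\<in>M'. (norm (h (cat m w)))\<^sup>2)"
    using f(3) by (simp add: power_mult_distrib mult_left_mono)
  also have "\<dots> = C\<^sup>2 * (\<Sum>z\<in>?Z. (norm (h z))\<^sup>2)" by (simp add: sum.reindex[OF inj])
  finally show ?thesis using Z M'(1) by blast
qed

text \<open>Plays the role of \<open>\<parallel>S \<otimes> 1\<parallel> \<le>
  \<parallel>S\<parallel>\<close>. A finite part of the \<open>q\<close>-fibre over \<open>x\<close>
  is split along \<open>shift p\<close>, \<open>ops_local_bound\<close> is applied on each
  \<open>p\<close>-fibre, and the results are added: the sets \<open>Z w\<close> lie in different
  \<open>p\<close>-fibres, hence are disjoint, and all lie in the \<open>q\<close>-fibre over
  \<open>x\<close>.\<close>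

lemma ops_transfer_bound:
  assumes A: "A \<in> ops p" and C: "0 \<le> C" "\<And>h. h \<in> X \<Lambda> p \<Longrightarrow> nrm p (A h) \<le> C * nrm p h"
    and q: "p \<le> q" and h: "h \<in> fibre_l2 \<Lambda> q"
  shows "nrm q (A h) \<le> C * nrm q h"
proof (rule fibre_l2_leI(2))
  show "0 \<le> C * nrm q h" using C(1) mod_norm_nonneg[OF h] by simp
  show "A h y = 0" if "y \<notin> boundary_ge \<Lambda> q" for y using fibre_l2D(1)[OF ops_fibre_l2[OF A q h] that] .
  fix x F assume F: "finite F" "F \<subseteq> fibre \<Lambda> q x"
  have fs: "y \<in> fibre \<Lambda> q x \<longleftrightarrow> y \<in> boundary_ge \<Lambda> p \<and> shift p y \<in> fibre \<Lambda> (q - p) x" for y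
    using fibre_shift[of y p "q - p" x] add_diff_fun[OF q] by simp
  let ?W = "shift p ` F"
  have "\<forall>w. \<exists>Z. finite Z \<and> Z \<subseteq> fibre \<Lambda> p w \<and>
      (\<Sum>y\<in>{y \<in> F. shift p y = w}. (norm (A h y))\<^sup>2) \<le> C\<^sup>2 * (\<Sum>z\<in>Z. (norm (h z))\<^sup>2)"
  proof (intro allI ops_local_bound[OF A C])
    fix w show "{y \<in> F. shift p y = w} \<subseteq> fibre \<Lambda> p w" using F(2) fs by (auto simp: fibre_def)
  qed (use F in auto)
  from choice[OF this] obtain Z where Z: "\<And>w. finite (Z w)" "\<And>w. Z w \<subseteq> fibre \<Lambda> p w"
    "\<And>w. (\<Sum>y\<in>{y \<in> F. shift p y = w}. (norm (A h y))\<^sup>2) \<le> C\<^sup>2 * (\<Sum>z\<in>Z w. (norm (h z))\<^sup>2)" by blast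
  have "(\<Sum>y\<in>F. (norm (A h y))\<^sup>2) = (\<Sum>w\<in>?W. \<Sum>y\<in>{y \<in> F. shift p y = w}. (norm (A h y))\<^sup>2)"
    by (rule sum.image_gen[OF F(1)])
  also have "\<dots> \<le> (\<Sum>w\<in>?W. C\<^sup>2 * (\<Sum>z\<in>Z w. (norm (h z))\<^sup>2))" by (intro sum_mono Z)
  also have "\<dots> = C\<^sup>2 * (\<Sum>w\<in>?W. \<Sum>z\<in>Z w. (norm (h z))\<^sup>2)" by (simp add: sum_distrib_left)
  also have "(\<Sum>w\<in>?W. \<Sum>z\<in>Z w. (norm (h z))\<^sup>2) = (\<Sum>z\<in>(\<Union>w\<in>?W. Z w). (norm (h z))\<^sup>2)"
  proof (rule sum.UNION_disjoint[symmetric])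
    have "Z w \<inter> Z w' = {}" if "w \<noteq> w'" for w w' using Z(2)[of w] Z(2)[of w'] that unfolding fibre_def by blast
    then show "\<forall>i\<in>?W. \<forall>j\<in>?W. i \<noteq> j \<longrightarrow> Z i \<inter> Z j = {}" by blast
  qed (use F Z in auto)
  also have "C\<^sup>2 * \<dots> \<le> C\<^sup>2 * (nrm q h)\<^sup>2"
  proof (intro mult_left_mono fibre_l2_finite_sum_le[OF h])
    show "(\<Union>w\<in>?W. Z w) \<subseteq> fibre \<Lambda> q x"
    proof (rule UN_least)
      fix w assume "w \<in> ?W"
      then have "w \<in> fibre \<Lambda> (q - p) x" using F(2) fs by blast
      then show "Z w \<subseteq> fibre \<Lambda> q x" using Z(2)[of w] fs unfolding fibre_def by blast
    qed
  qed (use F Z in auto)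
  finally show "(\<Sum>y\<in>F. (norm (A h y))\<^sup>2) \<le> (C * nrm q h)\<^sup>2" by (simp add: power_mult_distrib)
qed

section \<open>Approximation of compact operators\<close>

text \<open>If \<open>m w\<close> exists, it is the only point of the fibre over \<open>w\<close> in
  \<open>cyl m\<close>; otherwise there is none. So the sum has at most one nonzero term.\<close>

lemma ip_Ccyl:
  assumes g: "g \<in> Ccyl m" and m: "m \<in> mor \<Lambda>" "dg m = p"
  shows "ip \<Lambda> p g h w = (if w \<in> cyl (src \<Lambda> m) then cnj (g (cat m w)) * h (cat m w) else 0)"
proof -
  have eq: "cat m w = y" "w \<in> cyl (src \<Lambda> m)" if "y \<in> fibre \<Lambda> p w" "g y \<noteq> 0" for y
  proof -
    have y: "y \<in> cyl m" using that(2) Ccyl_zero[OF g] by blast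
    have "shift (dg m) y = w" using that(1) m by (simp add: fibre_def)
    then show "cat m w = y" "w \<in> cyl (src \<Lambda> m)" using cat_eqI[OF y] shift_in_cylinder_src[OF y] by simp_all
  qed
  show ?thesis
  proof (cases "w \<in> cyl (src \<Lambda> m)")
    case True
    note c = cat_props[OF m(1) True]
    have "cat m w \<in> fibre \<Lambda> p w" using c cylinderD(6)[OF c(1)] m(2) by (simp add: fibre_def)
    then have "ip \<Lambda> p g h w = (\<Sum>\<^sub>\<infinity>y\<in>{cat m w}. cnj (g y) * h y)"
      unfolding ip_def
    proof (intro infsum_cong_neutral)
      fix y assume y: "y \<in> fibre \<Lambda> p w - {cat m w}"
      then have "g y = 0" using eq(1) by blast
      then show "cnj (g y) * h y = 0" by simp
    qed auto
    then show ?thesis using True by simp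
  next
    case False
    have "ip \<Lambda> p g h w = (\<Sum>\<^sub>\<infinity>y\<in>fibre \<Lambda> p w. 0)" unfolding ip_def
    proof (rule infsum_cong)
      fix y assume "y \<in> fibre \<Lambda> p w"
      then have "g y = 0" using eq(2) False by blast
      then show "cnj (g y) * h y = 0" by simp
    qed
    then show ?thesis using False by simp
  qed
qed

text \<open>At \<open>y = l w\<close> the operator uses the one-term inner product at
  \<open>w\<close>, so it reads \<open>h\<close> at \<open>m w\<close>. A path starts at a single
  vertex, which is why different sources give 0.\<close>

lemma rank_one_Ccyl:
  assumes f: "f \<in> Ccyl l" "l \<in> mor \<Lambda>" "dg l = p" and g: "g \<in> Ccyl m" "m \<in> mor \<Lambda>" "dg m = p"
  shows "src \<Lambda> l = src \<Lambda> m \<Longrightarrow> right_act p f (ip \<Lambda> p g h) = Op l m (\<lambda>y. f y * cnj (pull l m g y)) h"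
    "src \<Lambda> l \<noteq> src \<Lambda> m \<Longrightarrow> right_act p f (ip \<Lambda> p g h) = (\<lambda>y. 0)"
proof -
  assume s: "src \<Lambda> l = src \<Lambda> m"
  show "right_act p f (ip \<Lambda> p g h) = Op l m (\<lambda>y. f y * cnj (pull l m g y)) h"
  proof
    fix y
    show "right_act p f (ip \<Lambda> p g h) y = Op l m (\<lambda>y. f y * cnj (pull l m g y)) h y"
    proof (cases "y \<in> cyl l")
      case True
      then have "shift p y \<in> cyl (src \<Lambda> m)" using shift_in_cylinder_src[OF True] f(3) s by simp
      then show ?thesis using ip_Ccyl[OF g] swap_eq_cat[OF True g(2) s] f(3) True
        by (simp add: right_act_def Op_def pull_def)
    qed (use Ccyl_zero[OF f(1)] in \<open>simp add: right_act_def Op_def\<close>)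
  qed
next
  assume s: "src \<Lambda> l \<noteq> src \<Lambda> m"
  show "right_act p f (ip \<Lambda> p g h) = (\<lambda>y. 0)"
  proof
    fix y
    show "right_act p f (ip \<Lambda> p g h) y = 0"
    proof (cases "y \<in> cyl l")
      case True
      then have "shift p y \<notin> cyl (src \<Lambda> m)"
        using shift_in_cylinder_src[OF True] f(3) s source_unique[OF f(2) g(2)] by metis
      then show ?thesis using ip_Ccyl[OF g] by (simp add: right_act_def)
    qed (use Ccyl_zero[OF f(1)] in \<open>simp add: right_act_def\<close>)
  qed
qed

lemma rank_one_ops:
  assumes f: "f \<in> Ccyl l" "l \<in> mor \<Lambda>" "dg l = p" and g: "g \<in> Ccyl m" "m \<in> mor \<Lambda>" "dg m = p"
  shows "(\<lambda>h. right_act p f (ip \<Lambda> p g h)) \<in> ops p"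
proof (cases "src \<Lambda> l = src \<Lambda> m")
  case True
  have "(\<lambda>y. f y * cnj (pull l m g y)) \<in> Ccyl l"
    by (rule Ccyl_mult[OF f(1) Ccyl_cnj[OF pull_Ccyl[OF f(2) g(2) True g(1)]]])
  then show ?thesis using rank_one_Ccyl(1)[OF assms True] ops_Op[OF f(2) g(2) True f(3) g(3)] by simp
next
  case False
  then show ?thesis using rank_one_Ccyl(2)[OF assms] ops.zero by simp
qed

text \<open>The coefficient is split as \<open>f * cnj (g \<circ> swap l m)\<close>, where
  \<open>f = c / sqrt |c|\<close> and \<open>g\<close> is \<open>sqrt |c|\<close> carried over to
  \<open>cyl m\<close>.\<close>

lemma Op_rank_one:
  assumes lm: "l \<in> mor \<Lambda>" "m \<in> mor \<Lambda>" "src \<Lambda> l = src \<Lambda> m" "dg l = p" "dg m = p" and c: "c \<in> Ccyl l"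
  shows "\<exists>f\<in>X \<Lambda> p. \<exists>g\<in>X \<Lambda> p. \<forall>h. Op l m c h = right_act p f (ip \<Lambda> p g h)"
proof -
  let ?f = "\<lambda>y. c y / of_real (sqrt (norm (c y)))" let ?s = "\<lambda>y. complex_of_real (sqrt (norm (c y)))"
  let ?g = "pull m l ?s"
  have f: "?f \<in> Ccyl l" by (rule Ccyl_compose[OF c continuous_on_div_sqrt_norm]) simp
  have "continuous_on UNIV (\<lambda>z::complex. complex_of_real (sqrt (norm z)))" by (intro continuous_intros)
  then have s: "?s \<in> Ccyl l" by (rule Ccyl_compose[OF c]) simp
  then have g: "?g \<in> Ccyl m" using lm by (intro pull_Ccyl) auto
  have eq: "?f y * cnj (pull l m ?g y) = c y" for y
  proof (cases "y \<in> cyl l")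
    case True
    then have "swap m l (swap l m y) = y" using swap_swap[OF True lm(2,1,3)] lm(3) swap_self by simp
    then have "pull l m ?g y = ?s y" using True swap_in(1)[OF True lm(2,3)] by (simp add: pull_def)
    then show ?thesis by (cases "c y = 0") auto
  qed (use Ccyl_zero[OF c] in simp)
  have "Op l m c h = right_act p ?f (ip \<Lambda> p ?g h)" for h
    using rank_one_Ccyl(1)[OF f lm(1,4) g lm(2,5,3), of h] unfolding eq by simp
  moreover have "?f \<in> X \<Lambda> p" "?g \<in> X \<Lambda> p" using Ccyl_X[OF f lm(1)] Ccyl_X[OF g lm(2)] lm(4,5) by simp_all
  ultimately show ?thesis by blast
qed

lemma ops_finite_rank:
  assumes "A \<in> ops p"
  shows "restrict A (X \<Lambda> p) \<in> finite_rank \<Lambda> p"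
  using assms
proof (induction rule: ops.induct)
  case zero
  have "restrict (\<lambda>h y. 0) (X \<Lambda> p) = restrict (\<lambda>h x. \<Sum>i<(0::nat). undefined i * rank_one \<Lambda> p (undefined i) (undefined i) h x) (X \<Lambda> p)"
    by simp
  then show ?case unfolding finite_rank_def by blast
next
  case (add A l m c)
  then obtain N a f g where N: "restrict A (X \<Lambda> p) = restrict (\<lambda>h x. \<Sum>i<(N::nat). a i * rank_one \<Lambda> p (f i) (g i) h x) (X \<Lambda> p)"
    "\<forall>i<N. f i \<in> X \<Lambda> p \<and> g i \<in> X \<Lambda> p" unfolding finite_rank_def by blast
  obtain f' g' where fg: "f' \<in> X \<Lambda> p" "g' \<in> X \<Lambda> p" "\<And>h. Op l m c h = right_act p f' (ip \<Lambda> p g' h)"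
    using Op_rank_one[OF add.hyps(2-7)] by blast
  let ?a = "a(N := 1)" let ?f = "f(N := f')" let ?g = "g(N := g')"
  have "restrict (\<lambda>h y. A h y + Op l m c h y) (X \<Lambda> p)
     = restrict (\<lambda>h x. \<Sum>i<Suc N. ?a i * rank_one \<Lambda> p (?f i) (?g i) h x) (X \<Lambda> p)"
  proof (rule restrict_ext)
    fix h assume h: "h \<in> X \<Lambda> p"
    show "(\<lambda>y. A h y + Op l m c h y) = (\<lambda>x. \<Sum>i<Suc N. ?a i * rank_one \<Lambda> p (?f i) (?g i) h x)"
    proof
      fix y
      have "A h y = (\<Sum>i<N. a i * rank_one \<Lambda> p (f i) (g i) h y)"
        using fun_cong[OF fun_cong[OF N(1), of h], of y] h by simp
      also have "\<dots> = (\<Sum>i<N. ?a i * rank_one \<Lambda> p (?f i) (?g i) h y)" by (rule sum.cong) auto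
      finally show "A h y + Op l m c h y = (\<Sum>i<Suc N. ?a i * rank_one \<Lambda> p (?f i) (?g i) h y)"
        using fg(3)[of h] h by (simp add: rank_one_def)
    qed
  qed
  moreover have "\<forall>i<Suc N. ?f i \<in> X \<Lambda> p \<and> ?g i \<in> X \<Lambda> p" using N(2) fg by (auto simp: less_Suc_eq)
  ultimately show ?case unfolding finite_rank_def by blast
qed

lemma Cc_ge_rank_one_ops:
  assumes f: "f \<in> Cc_ge \<Lambda> p" and g: "g \<in> Cc_ge \<Lambda> p"
  shows "\<exists>A\<in>ops p. \<forall>h. right_act p f (ip \<Lambda> p g h) = A h"
proof -
  obtain L F where L: "finite L" "\<And>l. l \<in> L \<Longrightarrow> l \<in> mor \<Lambda> \<and> dg l = p \<and> F l \<in> Ccyl l" "f = (\<lambda>y. \<Sum>l\<in>L. F l y)"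
    using Cc_ge_decompose[OF f] by metis
  obtain M G where M: "finite M" "\<And>l. l \<in> M \<Longrightarrow> l \<in> mor \<Lambda> \<and> dg l = p \<and> G l \<in> Ccyl l" "g = (\<lambda>y. \<Sum>l\<in>M. G l y)"
    using Cc_ge_decompose[OF g] by metis
  let ?A = "\<lambda>h y. \<Sum>l\<in>L. \<Sum>m\<in>M. right_act p (F l) (ip \<Lambda> p (G m) h) y"
  have ipg: "ip \<Lambda> p g h w = (\<Sum>m\<in>M. ip \<Lambda> p (G m) h w)" for h w
  proof -
    have "(\<lambda>y. cnj (G m y) * h y) summable_on fibre \<Lambda> p w" if "m \<in> M" for m
    proof -
      note m = M(2)[OF that]
      have "(\<lambda>y. cnj (G m y) * h y) summable_on {cat m w} \<inter> fibre \<Lambda> p w"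
        by (rule summable_on_finite) simp
      moreover have "cnj (G m y) * h y = 0" if y: "y \<in> fibre \<Lambda> p w - {cat m w} \<inter> fibre \<Lambda> p w" for y
      proof -
        have "y \<notin> cyl m"
        proof
          assume "y \<in> cyl m"
          from cat_eqI[OF this] y m show False by (auto simp: fibre_def)
        qed
        then show ?thesis using Ccyl_zero[of "G m" m y] m by simp
      qed
      ultimately show ?thesis
        using summable_on_cong_neutral[of "fibre \<Lambda> p w" "{cat m w} \<inter> fibre \<Lambda> p w" "\<lambda>y. cnj (G m y) * h y" "\<lambda>y. cnj (G m y) * h y"] by blast
    qed
    then have "(\<Sum>\<^sub>\<infinity>y\<in>fibre \<Lambda> p w. \<Sum>m\<in>M. cnj (G m y) * h y) = (\<Sum>m\<in>M. ip \<Lambda> p (G m) h w)"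
      unfolding ip_def using infsum_finite_sum[OF M(1), of "\<lambda>m y. cnj (G m y) * h y"] by blast
    then show ?thesis unfolding ip_def M(3) by (simp add: sum_distrib_right)
  qed
  have "?A \<in> ops p"
    by (intro ops_sum L(1) M(1)) (use L(2) M(2) rank_one_ops in blast)
  moreover have "right_act p f (ip \<Lambda> p g h) = ?A h" for h
    by (rule ext) (simp add: right_act_def ipg L(3) sum_product)
  ultimately show ?thesis by (intro bexI[of _ ?A]) auto
qed

section \<open>Norm approximation by elementary operators\<close>

lemma rank_one_bound:
  assumes "f \<in> fibre_l2 \<Lambda> n" "g \<in> fibre_l2 \<Lambda> n" "h \<in> fibre_l2 \<Lambda> n"
  shows "right_act n f (ip \<Lambda> n g h) \<in> fibre_l2 \<Lambda> n"
    "nrm n (right_act n f (ip \<Lambda> n g h)) \<le> nrm n f * nrm n g * nrm n h"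
  using right_act_fibre_l2[OF assms(1), of "ip \<Lambda> n g h" "nrm n g * nrm n h"]
    ip_cauchy_schwarz(2)[OF assms(2,3)] mod_norm_nonneg[OF assms(2)] mod_norm_nonneg[OF assms(3)]
  by (simp_all add: mult_ac)

text \<open>Two degrees are kept apart: \<open>p\<close> belongs to the approximating operators,
  \<open>q\<close> to the module in which norms are measured. A compact operator has
  \<open>p = q\<close>, its image under \<open>iota\<close> has \<open>p\<close> below
  \<open>q\<close>, and the theorem ends with both equal to \<open>sup m n\<close>.\<close>

definition approximable :: "('k \<Rightarrow> nat) \<Rightarrow> ('k \<Rightarrow> nat) \<Rightarrow> ((('a, 'k) path \<Rightarrow> complex) \<Rightarrow> ('a, 'k) path \<Rightarrow> complex) \<Rightarrow> bool" where
  "approximable p q R \<longleftrightarrow> (\<forall>h\<in>X \<Lambda> q. R h \<in> fibre_l2 \<Lambda> q) \<and>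
     (\<forall>e>0. \<exists>A\<in>ops p. \<forall>h\<in>X \<Lambda> q. nrm q (R h - A h) \<le> e * nrm q h)"

lemma approximable_closed:
  assumes R: "\<And>h. h \<in> X \<Lambda> q \<Longrightarrow> R h \<in> fibre_l2 \<Lambda> q" and q: "p \<le> q"
    and ap: "\<And>e. e > 0 \<Longrightarrow> \<exists>S. approximable p q S \<and> (\<forall>h\<in>X \<Lambda> q. nrm q (R h - S h) \<le> e * nrm q h)"
  shows "approximable p q R"
  unfolding approximable_def
proof (intro conjI ballI allI impI)
  fix e :: real assume e: "e > 0"
  obtain S where S: "approximable p q S" "\<And>h. h \<in> X \<Lambda> q \<Longrightarrow> nrm q (R h - S h) \<le> e / 2 * nrm q h"
    using ap[OF half_gt_zero[OF e]] by blast
  obtain A where A: "A \<in> ops p" "\<And>h. h \<in> X \<Lambda> q \<Longrightarrow> nrm q (S h - A h) \<le> e / 2 * nrm q h"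
    using S(1) half_gt_zero[OF e] unfolding approximable_def by blast
  have "nrm q (R h - A h) \<le> e * nrm q h" if h: "h \<in> X \<Lambda> q" for h
  proof -
    have "S h \<in> fibre_l2 \<Lambda> q" using S(1) h unfolding approximable_def by blast
    from mod_norm_triangle[OF R[OF h] this ops_fibre_l2[OF A(1) q X_fibre_l2[OF h]]]
    show ?thesis using S(2)[OF h] A(2)[OF h] by (simp add: field_simps)
  qed
  then show "\<exists>A\<in>ops p. \<forall>h\<in>X \<Lambda> q. nrm q (R h - A h) \<le> e * nrm q h" using A(1) by blast
qed (use R in blast)

lemma approximable_ops:
  assumes "A \<in> ops p" "p \<le> q" shows "approximable p q A"
proof -
  have "nrm q (A h - A h) \<le> e * nrm q h" if "0 < e" "h \<in> X \<Lambda> q" for e h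
    using that mod_norm_nonneg[OF X_fibre_l2[OF that(2)]] fibre_l2_zero(2)[of \<Lambda> q] by (simp add: zero_fun_def[abs_def])
  then show ?thesis using assms ops_fibre_l2[OF assms] X_fibre_l2 unfolding approximable_def by blast
qed

lemma approximable_add_scaled:
  assumes R: "approximable p q R" and S: "approximable p q S" and q: "p \<le> q"
  shows "approximable p q (\<lambda>h y. R h y + c * S h y)"
  unfolding approximable_def
proof (intro conjI ballI allI impI)
  have l2: "R h \<in> fibre_l2 \<Lambda> q" "S h \<in> fibre_l2 \<Lambda> q" if "h \<in> X \<Lambda> q" for h
    using R S that unfolding approximable_def by blast+
  have eq: "(\<lambda>y. R h y + c * S h y) = R h + (\<lambda>y. c * S h y)" for h by (simp add: plus_fun_def)
  show "(\<lambda>y. R h y + c * S h y) \<in> fibre_l2 \<Lambda> q" if "h \<in> X \<Lambda> q" for h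
    unfolding eq using l2[OF that] by (intro fibre_l2_add fibre_l2_scale)
  fix e :: real assume e: "e > 0"
  obtain d where d: "d > 0" "norm c * d < e / 2" using small_factor[OF half_gt_zero[OF e], of "norm c"] by auto
  obtain A where A: "A \<in> ops p" "\<And>h. h \<in> X \<Lambda> q \<Longrightarrow> nrm q (R h - A h) \<le> e / 2 * nrm q h"
    using R half_gt_zero[OF e] unfolding approximable_def by blast
  obtain B where B: "B \<in> ops p" "\<And>h. h \<in> X \<Lambda> q \<Longrightarrow> nrm q (S h - B h) \<le> d * nrm q h"
    using S d(1) unfolding approximable_def by blast
  have "nrm q ((\<lambda>y. R h y + c * S h y) - (\<lambda>y. A h y + c * B h y)) \<le> e * nrm q h" if h: "h \<in> X \<Lambda> q" for h
  proof -
    have AB: "A h \<in> fibre_l2 \<Lambda> q" "B h \<in> fibre_l2 \<Lambda> q" using ops_fibre_l2[OF _ q X_fibre_l2[OF h]] A(1) B(1) by blast+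
    have n: "0 \<le> nrm q h" using mod_norm_nonneg[OF X_fibre_l2[OF h]] .
    have "nrm q ((R h - A h) + (\<lambda>y. c * (S h - B h) y))
        \<le> nrm q (R h - A h) + nrm q (\<lambda>y. c * (S h - B h) y)"
      using l2[OF h] AB by (intro fibre_l2_add fibre_l2_diff fibre_l2_scale)
    also have "\<dots> \<le> e / 2 * nrm q h + norm c * nrm q (S h - B h)"
      using A(2)[OF h] l2[OF h] AB by (intro add_mono fibre_l2_scale fibre_l2_diff)
    also have "\<dots> \<le> e / 2 * nrm q h + norm c * (d * nrm q h)"
      using B(2)[OF h] by (intro add_left_mono mult_left_mono) auto
    also have "\<dots> \<le> e / 2 * nrm q h + e / 2 * nrm q h"
      using mult_right_mono[OF less_imp_le[OF d(2)] n] by (simp add: mult.assoc)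
    also have "\<dots> = e * nrm q h" by simp
    also have "(R h - A h) + (\<lambda>y. c * (S h - B h) y) = (\<lambda>y. R h y + c * S h y) - (\<lambda>y. A h y + c * B h y)"
      by (rule ext) (simp add: algebra_simps)
    finally show ?thesis .
  qed
  then show "\<exists>A\<in>ops p. \<forall>h\<in>X \<Lambda> q. nrm q ((\<lambda>y. R h y + c * S h y) - A h) \<le> e * nrm q h"
    using ops_add[OF ops_scale[OF B(1), of c] A(1)] by (intro bexI[of _ "\<lambda>h y. A h y + c * B h y"]) blast
qed

lemma approximable_rank_one:
  assumes f: "f \<in> X \<Lambda> p" and g: "g \<in> X \<Lambda> p"
  shows "approximable p p (\<lambda>h. right_act p f (ip \<Lambda> p g h))"
proof (rule approximable_closed[OF _ order_refl])
  show "right_act p f (ip \<Lambda> p g h) \<in> fibre_l2 \<Lambda> p" if "h \<in> X \<Lambda> p" for h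
    using rank_one_bound(1) X_fibre_l2 f g that by blast
  fix e :: real assume e: "e > 0"
  obtain d where d: "d > 0" "\<bar>nrm p g\<bar> * d < e / 2" using small_factor[OF half_gt_zero[OF e]] by blast
  obtain f' where f': "f' \<in> Cc_ge \<Lambda> p" "nrm p (f - f') < d" using f d unfolding X_def by blast
  \<comment> \<open>\<open>f'\<close> is fixed before \<open>d'\<close>, because the error caused by
    \<open>g - g'\<close> carries the factor \<open>nrm p f'\<close>.\<close>
  obtain d' where d': "d' > 0" "\<bar>nrm p f'\<bar> * d' < e / 2" using small_factor[OF half_gt_zero[OF e]] by blast
  obtain g' where g': "g' \<in> Cc_ge \<Lambda> p" "nrm p (g - g') < d'" using g d' unfolding X_def by blast
  obtain A where A: "A \<in> ops p" "\<And>h. right_act p f' (ip \<Lambda> p g' h) = A h" using Cc_ge_rank_one_ops[OF f'(1) g'(1)] by blast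
  have l2: "f \<in> fibre_l2 \<Lambda> p" "g \<in> fibre_l2 \<Lambda> p" "f' \<in> fibre_l2 \<Lambda> p" "g' \<in> fibre_l2 \<Lambda> p"
    using f g f' g' X_fibre_l2 Cc_ge_subset_fibre_l2[OF kg] by blast+
  have nn: "0 \<le> nrm p g" "0 \<le> nrm p f'" using mod_norm_nonneg l2 by blast+
  have df: "f - f' \<in> fibre_l2 \<Lambda> p" "g - g' \<in> fibre_l2 \<Lambda> p" using l2 fibre_l2_diff by blast+
  have "nrm p (right_act p f (ip \<Lambda> p g h) - A h) \<le> e * nrm p h" if h: "h \<in> X \<Lambda> p" for h
  proof -
    have hl: "h \<in> fibre_l2 \<Lambda> p" "0 \<le> nrm p h" using X_fibre_l2[OF h] mod_norm_nonneg by auto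
    have "right_act p f (ip \<Lambda> p g h) - A h = right_act p (f - f') (ip \<Lambda> p g h) + right_act p f' (ip \<Lambda> p (g - g') h)"
      unfolding A(2)[symmetric]
      by (rule ext) (simp add: right_act_def ip_diff_left[OF l2(2,4) hl(1)] algebra_simps)
    then have "nrm p (right_act p f (ip \<Lambda> p g h) - A h) \<le>
      nrm p (right_act p (f - f') (ip \<Lambda> p g h)) + nrm p (right_act p f' (ip \<Lambda> p (g - g') h))"
      using fibre_l2_add(2)[OF rank_one_bound(1)[OF df(1) l2(2) hl(1)] rank_one_bound(1)[OF l2(3) df(2) hl(1)]] by simp
    also have "\<dots> \<le> nrm p (f - f') * nrm p g * nrm p h + nrm p f' * nrm p (g - g') * nrm p h"
      by (intro add_mono rank_one_bound(2) df l2 hl)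
    also have "\<dots> \<le> e / 2 * nrm p h + e / 2 * nrm p h"
    proof (intro add_mono mult_right_mono hl(2))
      have "nrm p (f - f') * nrm p g \<le> d * nrm p g" using f' nn by (intro mult_right_mono) auto
      then show "nrm p (f - f') * nrm p g \<le> e / 2" using d nn by (simp add: mult.commute)
      have "nrm p f' * nrm p (g - g') \<le> nrm p f' * d'" using g' nn by (intro mult_left_mono) auto
      then show "nrm p f' * nrm p (g - g') \<le> e / 2" using d' nn by simp
    qed
    finally show ?thesis by simp
  qed
  then show "\<exists>S. approximable p p S \<and> (\<forall>h\<in>X \<Lambda> p. nrm p (right_act p f (ip \<Lambda> p g h) - S h) \<le> e * nrm p h)"
    using approximable_ops[OF A(1) order_refl] by blast
qed

lemma approximable_cong:
  "approximable p q R \<Longrightarrow> (\<And>h. h \<in> X \<Lambda> q \<Longrightarrow> S h = R h) \<Longrightarrow> approximable p q S"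
  unfolding approximable_def by simp

lemma finite_rank_approximable:
  assumes "R \<in> finite_rank \<Lambda> p" shows "approximable p p R"
proof -
  obtain N c f g where R: "R = restrict (\<lambda>h x. \<Sum>i<(N::nat). c i * rank_one \<Lambda> p (f i) (g i) h x) (X \<Lambda> p)"
    and fg: "\<forall>i<N. f i \<in> X \<Lambda> p \<and> g i \<in> X \<Lambda> p" using assms unfolding finite_rank_def by blast
  have "approximable p p (\<lambda>h x. \<Sum>i<N. c i * right_act p (f i) (ip \<Lambda> p (g i) h) x)" using fg
  proof (induction N)
    case 0
    then show ?case using approximable_ops[OF ops.zero[of p] order_refl] by simp
  next
    case (Suc N)
    then have "approximable p p (\<lambda>h x. \<Sum>i<N. c i * right_act p (f i) (ip \<Lambda> p (g i) h) x)" by simp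
    from approximable_add_scaled[OF this approximable_rank_one order_refl, of "f N" "g N" "c N"] Suc.prems
    show ?case by simp
  qed
  then show ?thesis by (rule approximable_cong) (simp add: R rank_one_def)
qed

lemma compact_ops_approximable:
  assumes "S \<in> compact_ops \<Lambda> p" shows "approximable p p S"
proof (rule approximable_closed[OF _ order_refl])
  show "S h \<in> fibre_l2 \<Lambda> p" if "h \<in> X \<Lambda> p" for h
    using assms that X_fibre_l2 unfolding compact_ops_def adjointable_def by blast
  show "\<exists>R. approximable p p R \<and> (\<forall>h\<in>X \<Lambda> p. nrm p (S h - R h) \<le> e * nrm p h)" if "e > 0" for e
    using assms that finite_rank_approximable unfolding compact_ops_def by blast
qed

end

lemma C0_cnj:
  assumes "f \<in> C0 T" shows "(\<lambda>y. cnj (f y)) \<in> C0 T"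
proof -
  have "continuous_map T euclidean (cnj \<circ> f)"
    using assms by (intro continuous_map_compose[of T euclidean f]) (auto simp: C0_def intro: continuous_intros)
  then show ?thesis using assms by (simp add: C0_def o_def)
qed

lemma mod_norm_cnj: "mod_norm \<Lambda> n (\<lambda>y. cnj (f y)) = mod_norm \<Lambda> n f"
  unfolding mod_norm_def ip_def by (simp add: mult.commute)

context aligned_kgraph
begin

section \<open>Multiplication in the product system\<close>

text \<open>Group a finite part of the fibre by \<open>w = shift p y\<close>: on each group the
  second factor is the constant \<open>g w\<close>, and the remaining sum of \<open>f\<close> runs
  within one \<open>p\<close>-fibre.\<close>

lemma mult_fibre_l2:
  assumes f: "f \<in> fibre_l2 \<Lambda> p" and g: "g \<in> fibre_l2 \<Lambda> n"
  shows "mult p f g \<in> fibre_l2 \<Lambda> (p + n)" "nrm (p + n) (mult p f g) \<le> nrm p f * nrm n g"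
proof -
  let ?c = "nrm p f" let ?d = "nrm n g"
  have nn: "0 \<le> ?c" "0 \<le> ?d" using mod_norm_nonneg f g by blast+
  have le: "(\<Sum>y\<in>F. (norm (mult p f g y))\<^sup>2) \<le> (?c * ?d)\<^sup>2" if F: "finite F" "F \<subseteq> fibre \<Lambda> (p + n) x" for F x
  proof -
    let ?W = "shift p ` F"
    have sub: "{y \<in> F. shift p y = w} \<subseteq> fibre \<Lambda> p w" for w
      using F(2) fibre_shift[of _ p n x] unfolding fibre_def by blast
    have "(\<Sum>y\<in>F. (norm (mult p f g y))\<^sup>2) = (\<Sum>w\<in>?W. \<Sum>y\<in>{y \<in> F. shift p y = w}. (norm (mult p f g y))\<^sup>2)"
      by (rule sum.image_gen[OF F(1)])
    also have "\<dots> \<le> (\<Sum>w\<in>?W. ?c\<^sup>2 * (norm (g w))\<^sup>2)"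
    proof (rule sum_mono)
      fix w assume "w \<in> ?W"
      have "(\<Sum>y\<in>{y \<in> F. shift p y = w}. (norm (mult p f g y))\<^sup>2) =
          (\<Sum>y\<in>{y \<in> F. shift p y = w}. (norm (f y))\<^sup>2) * (norm (g w))\<^sup>2"
        unfolding sum_distrib_right by (rule sum.cong) (auto simp: mult_def norm_mult power_mult_distrib)
      also have "\<dots> \<le> ?c\<^sup>2 * (norm (g w))\<^sup>2"
        using F(1) by (intro mult_right_mono fibre_l2_finite_sum_le[OF f _ sub]) auto
      finally show "(\<Sum>y\<in>{y \<in> F. shift p y = w}. (norm (mult p f g y))\<^sup>2) \<le> ?c\<^sup>2 * (norm (g w))\<^sup>2" .
    qed
    also have "\<dots> = ?c\<^sup>2 * (\<Sum>w\<in>?W. (norm (g w))\<^sup>2)" by (simp add: sum_distrib_left)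
    also have "\<dots> \<le> ?c\<^sup>2 * ?d\<^sup>2"
    proof (intro mult_left_mono fibre_l2_finite_sum_le[OF g])
      show "?W \<subseteq> fibre \<Lambda> n x" using F(2) fibre_shift[of _ p n x] by blast
    qed (use F in auto)
    finally show ?thesis by (simp add: power_mult_distrib)
  qed
  have z: "mult p f g y = 0" if y: "y \<notin> boundary_ge \<Lambda> (p + n)" for y
  proof (cases "y \<in> boundary_ge \<Lambda> p")
    case True
    have "shift p y \<notin> boundary_ge \<Lambda> n"
    proof
      assume "shift p y \<in> boundary_ge \<Lambda> n"
      then have "y \<in> fibre \<Lambda> (p + n) (shift n (shift p y))" using True fibre_shift fibre_ge by blast
      then show False using y by (simp add: fibre_def)
    qed
    then show ?thesis using fibre_l2D(1)[OF g] by (simp add: mult_def)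
  qed (use fibre_l2D(1)[OF f] in \<open>simp add: mult_def\<close>)
  have c: "0 \<le> ?c * ?d" using nn by simp
  show "mult p f g \<in> fibre_l2 \<Lambda> (p + n)" "nrm (p + n) (mult p f g) \<le> ?c * ?d"
    by (rule fibre_l2_leI[OF c z le]; assumption)+
qed

text \<open>On \<open>cyl (l m)\<close> the map \<open>shift p\<close> equals
  \<open>swap (l m) m\<close>, so the product is \<open>f\<close> times a pulled-back function. If
  \<open>l\<close> and \<open>m\<close> are not composable, no path of \<open>cyl l\<close> is
  shifted into \<open>cyl m\<close>.\<close>

lemma mult_Ccyl_X:
  assumes f: "f \<in> Ccyl l" "l \<in> mor \<Lambda>" "dg l = p" and g: "g \<in> Ccyl m" "m \<in> mor \<Lambda>" "dg m = n"
  shows "mult p f g \<in> X \<Lambda> (p + n)"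
proof (cases "src \<Lambda> l = rng \<Lambda> m")
  case True
  note r = cmp_rules[OF f(2) g(2) True] and c = cylinder_cmp[OF f(2) g(2) True]
  have "mult p f g y = f y * pull (cmp \<Lambda> l m) m g y" for y
  proof (cases "y \<in> cyl (cmp \<Lambda> l m)")
    case y: True
    then have s: "shift (dg l) y \<in> cyl m" using c by blast
    have "swap (cmp \<Lambda> l m) m y = shift (dg l) y"
      by (rule swap_eqI[OF s]) (simp add: shift_cmp[OF f(2) g(2) True y])
    then show ?thesis using y f(3) by (simp add: mult_def pull_def)
  next
    case False
    then have "f y = 0 \<or> g (shift p y) = 0" using c Ccyl_zero[OF f(1)] Ccyl_zero[OF g(1)] f(3) by blast
    then show ?thesis using False by (auto simp: mult_def pull_def)
  qed
  then have "mult p f g = (\<lambda>y. pull (cmp \<Lambda> l m) m g y * f y)" by (auto simp: mult.commute)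
  moreover have "\<dots> \<in> Ccyl (cmp \<Lambda> l m)"
    by (rule Ccyl_mult[OF pull_Ccyl[OF r(1) g(2) r(3) g(1)] f(1)])
  ultimately show ?thesis using Ccyl_X[of "mult p f g" "cmp \<Lambda> l m" "p + n"] r f(3) g(3) by simp
next
  case False
  have "mult p f g y = 0" for y
  proof (rule ccontr)
    assume "mult p f g y \<noteq> 0"
    then have "f y \<noteq> 0" "g (shift p y) \<noteq> 0" by (auto simp: mult_def)
    then have y: "y \<in> cyl l" "shift p y \<in> cyl m" using Ccyl_zero f(1) g(1) by blast+
    have "snd (shift p y) (0, 0) = src \<Lambda> l"
      using cylinderD(4)[OF shift_in_cylinder_src[OF y(1)]] category_rules(10)[OF f(2)] f(3) by simp
    then show False using cylinder_rng[OF y(2)] False by simp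
  qed
  then have "mult p f g = (\<lambda>y. 0)" by (rule ext)
  then show ?thesis using zero_X by simp
qed

lemma mult_Cc_ge_X:
  assumes f: "f \<in> Cc_ge \<Lambda> p" and g: "g \<in> Cc_ge \<Lambda> n"
  shows "mult p f g \<in> X \<Lambda> (p + n)"
proof -
  obtain L F where L: "finite L" "\<And>l. l \<in> L \<Longrightarrow> l \<in> mor \<Lambda> \<and> dg l = p \<and> F l \<in> Ccyl l" "f = (\<lambda>y. \<Sum>l\<in>L. F l y)"
    using Cc_ge_decompose[OF f] by metis
  obtain M G where M: "finite M" "\<And>l. l \<in> M \<Longrightarrow> l \<in> mor \<Lambda> \<and> dg l = n \<and> G l \<in> Ccyl l" "g = (\<lambda>y. \<Sum>l\<in>M. G l y)"
    using Cc_ge_decompose[OF g] by metis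
  have "(\<lambda>y. \<Sum>l\<in>L. \<Sum>m\<in>M. mult p (F l) (G m) y) \<in> X \<Lambda> (p + n)"
    by (intro X_sum L(1) M(1)) (use L(2) M(2) mult_Ccyl_X in blast)
  moreover have "mult p f g = (\<lambda>y. \<Sum>l\<in>L. \<Sum>m\<in>M. mult p (F l) (G m) y)"
    by (rule ext) (simp add: mult_def L(3) M(3) sum_product)
  ultimately show ?thesis by simp
qed

lemma mult_diff:
  "mult p (f - f') g = mult p f g - mult p f' g" "mult p f (g - g') = mult p f g - mult p f g'"
  by (auto simp: mult_def fun_eq_iff algebra_simps)

text \<open>Density is used in one factor at a time: first in \<open>g\<close> with
  \<open>f'\<close> of compact support, then in \<open>f\<close>.\<close>

lemma mult_X:
  assumes f: "f \<in> X \<Lambda> p" and g: "g \<in> X \<Lambda> n"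
  shows "mult p f g \<in> X \<Lambda> (p + n)"
proof -
  have left: "mult p f' g \<in> X \<Lambda> (p + n)" if f': "f' \<in> Cc_ge \<Lambda> p" for f'
  proof (rule X_bounded_operator[OF _ _ _ g])
    have l2: "f' \<in> fibre_l2 \<Lambda> p" using f' Cc_ge_subset_fibre_l2[OF kg] by blast
    show "mult p f' (g - h) = mult p f' g - mult p f' h" for g h :: "('a, 'k) path \<Rightarrow> complex" by (rule mult_diff)
    show "mult p f' h \<in> fibre_l2 \<Lambda> (p + n) \<and> nrm (p + n) (mult p f' h) \<le> nrm p f' * nrm n h"
      if "h \<in> fibre_l2 \<Lambda> n" for h using mult_fibre_l2[OF l2 that] by blast
    show "mult p f' h \<in> X \<Lambda> (p + n)" if "h \<in> Cc_ge \<Lambda> n" for h using mult_Cc_ge_X[OF f' that] .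
  qed
  show ?thesis
  proof (rule X_bounded_operator[OF _ _ _ f])
    show "mult p (f - h) g = mult p f g - mult p h g" for f h :: "('a, 'k) path \<Rightarrow> complex" by (rule mult_diff)
    show "mult p h g \<in> fibre_l2 \<Lambda> (p + n) \<and> nrm (p + n) (mult p h g) \<le> nrm n g * nrm p h"
      if "h \<in> fibre_l2 \<Lambda> p" for h using mult_fibre_l2[OF that X_fibre_l2[OF g]] by (simp add: mult.commute)
  qed (rule left)
qed

section \<open>The homomorphisms \<open>\<iota>\<close>\<close>

abbreviation rate :: "nat \<Rightarrow> real" where "rate i \<equiv> inverse (real (Suc i))"

text \<open>Completeness gives a limit for each \<open>h\<close> separately; the explicit rate makes
  the estimate for the limit uniform in \<open>h\<close>.\<close>

lemma operator_limit:
  assumes B: "\<And>i h. h \<in> X \<Lambda> q \<Longrightarrow> B i h \<in> X \<Lambda> q"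
    and c: "\<And>i j h. h \<in> X \<Lambda> q \<Longrightarrow> nrm q (B i h - B j h) \<le> (rate i + rate j) * nrm q h"
  shows "\<exists>R\<in>X \<Lambda> q \<rightarrow>\<^sub>E X \<Lambda> q. \<forall>i. \<forall>h\<in>X \<Lambda> q. nrm q (R h - B i h) \<le> rate i * nrm q h"
proof -
  have "\<exists>f\<in>X \<Lambda> q. \<forall>i. nrm q (f - B i h) \<le> rate i * nrm q h" if h: "h \<in> X \<Lambda> q" for h
  proof -
    let ?N = "nrm q h"
    have N: "0 \<le> ?N" using mod_norm_nonneg[OF X_fibre_l2[OF h]] .
    have cau: "\<exists>M. \<forall>i\<ge>M. \<forall>j\<ge>M. nrm q (B i h - B j h) < e" if e: "e > 0" for e
    proof -
      obtain d where d: "d > 0" "\<bar>?N\<bar> * d < e" using small_factor[OF e] by blast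
      have "(\<lambda>i. 2 * rate i) \<longlonglongrightarrow> 2 * 0" by (intro tendsto_intros LIMSEQ_inverse_real_of_nat)
      then have "\<forall>\<^sub>F i in sequentially. 2 * rate i < d" using d(1) by (intro order_tendstoD(2)) auto
      then obtain M where M: "\<And>i. i \<ge> M \<Longrightarrow> 2 * rate i < d" unfolding eventually_sequentially by blast
      have "nrm q (B i h - B j h) < e" if "i \<ge> M" "j \<ge> M" for i j
      proof -
        have "rate i + rate j \<le> d" using M[OF that(1)] M[OF that(2)] by linarith
        then have "(rate i + rate j) * ?N \<le> d * ?N" using N by (rule mult_right_mono)
        then show ?thesis using c[OF h, of i j] d(2) N by (simp add: mult.commute)
      qed
      then show ?thesis by blast
    qed
    obtain f where f: "f \<in> X \<Lambda> q" "(\<lambda>i. nrm q (B i h - f)) \<longlonglongrightarrow> 0"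
      using X_complete[OF kg, of "\<lambda>i. B i h" q, OF B[OF h] cau] by blast
    have "nrm q (f - B i h) \<le> rate i * ?N" for i
    proof -
      have "(\<lambda>j. nrm q (B j h - f) + (rate j + rate i) * ?N) \<longlonglongrightarrow> 0 + (0 + rate i) * ?N"
        by (intro tendsto_intros f(2) LIMSEQ_inverse_real_of_nat)
      moreover have "nrm q (f - B i h) \<le> nrm q (B j h - f) + (rate j + rate i) * ?N" for j
        using mod_norm_triangle[OF X_fibre_l2[OF f(1)] X_fibre_l2[OF B[OF h]] X_fibre_l2[OF B[OF h]], of i j]
          mod_norm_minus_commute[of \<Lambda> q f "B j h"] c[OF h, of j i] by linarith
      ultimately have "nrm q (f - B i h) \<le> 0 + (0 + rate i) * ?N" by (intro LIMSEQ_le_const) blast+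
      then show ?thesis by simp
    qed
    then show ?thesis using f(1) by blast
  qed
  then have "\<forall>h\<in>X \<Lambda> q. \<exists>f. f \<in> X \<Lambda> q \<and> (\<forall>i. nrm q (f - B i h) \<le> rate i * nrm q h)" by blast
  from bchoice[OF this] obtain R where R: "\<forall>h\<in>X \<Lambda> q. R h \<in> X \<Lambda> q \<and> (\<forall>i. nrm q (R h - B i h) \<le> rate i * nrm q h)" by blast
  then show ?thesis by (intro bexI[of _ "restrict R (X \<Lambda> q)"]) auto
qed

text \<open>The usual \<open>\<parallel>D' k\<parallel>\<^sup>2 = \<parallel>\<langle>D D' k,
  k\<rangle>\<parallel> \<le> C \<parallel>D' k\<parallel> \<parallel>k\<parallel>\<close>. It makes
  the adjoints of a Cauchy sequence Cauchy at the same rate.\<close>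

lemma ops_adjoint_bound:
  assumes D: "\<And>h. h \<in> fibre_l2 \<Lambda> q \<Longrightarrow> nrm q (D h) \<le> C * nrm q h" "0 \<le> C"
    and adj: "\<And>h k. h \<in> fibre_l2 \<Lambda> q \<Longrightarrow> k \<in> fibre_l2 \<Lambda> q \<Longrightarrow> ip \<Lambda> q (D h) k = ip \<Lambda> q h (D' k)"
    and l2: "\<And>h. h \<in> fibre_l2 \<Lambda> q \<Longrightarrow> D h \<in> fibre_l2 \<Lambda> q" "\<And>h. h \<in> fibre_l2 \<Lambda> q \<Longrightarrow> D' h \<in> fibre_l2 \<Lambda> q"
    and k: "k \<in> fibre_l2 \<Lambda> q"
  shows "nrm q (D' k) \<le> C * nrm q k"
proof (rule mod_norm_leI_self[OF l2(2)[OF k]])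
  have nk: "0 \<le> nrm q k" using mod_norm_nonneg[OF k] .
  then show "0 \<le> C * nrm q k" using D(2) by simp
  fix x
  have "norm (ip \<Lambda> q (D' k) (D' k) x) = norm (ip \<Lambda> q (D (D' k)) k x)" using adj[OF l2(2)[OF k] k] by simp
  also have "\<dots> \<le> nrm q (D (D' k)) * nrm q k"
    by (rule ip_cauchy_schwarz(2)[OF l2(1)[OF l2(2)[OF k]] k])
  also have "\<dots> \<le> C * nrm q (D' k) * nrm q k"
    using D(1)[OF l2(2)[OF k]] nk by (rule mult_right_mono)
  finally show "norm (ip \<Lambda> q (D' k) (D' k) x) \<le> C * nrm q k * nrm q (D' k)" by (simp add: mult_ac)
qed

lemma rate_le_zero:
  assumes "\<And>i. a \<le> rate i * c" shows "a \<le> 0"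
proof -
  have "(\<lambda>i. rate i * c) \<longlonglongrightarrow> 0 * c" by (intro tendsto_intros LIMSEQ_inverse_real_of_nat)
  then have "(\<lambda>i. rate i * c) \<longlonglongrightarrow> 0" by simp
  then show ?thesis by (rule LIMSEQ_le_const) (use assms in blast)
qed

text \<open>The differences of the elementary operators that approximate \<open>S\<close> lie in
  \<open>ops p\<close> again, so \<open>ops_transfer_bound\<close> turns their smallness on
  \<open>X \<Lambda> p\<close> into smallness on \<open>X \<Lambda> q\<close>. The limit there is
  \<open>R\<close>; the limit of the adjoints is an adjoint of \<open>R\<close>, and
  \<open>ops_mult\<close> passes to the limit.\<close>

lemma iota_exists:
  assumes S: "S \<in> compact_ops \<Lambda> p" and q: "p \<le> q"
  shows "\<exists>R\<in>adjointable \<Lambda> q. approximable p q R \<and>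
    (\<forall>f\<in>X \<Lambda> p. \<forall>g\<in>X \<Lambda> (q - p). R (mult p f g) = mult p (S f) g)"
proof -
  have SX: "S h \<in> X \<Lambda> p" if "h \<in> X \<Lambda> p" for h using S that unfolding compact_ops_def adjointable_def by blast
  have "\<forall>i. \<exists>A\<in>ops p. \<forall>h\<in>X \<Lambda> p. nrm p (S h - A h) \<le> rate i * nrm p h"
    using compact_ops_approximable[OF S] unfolding approximable_def by simp
  then have "\<forall>i. \<exists>A. A \<in> ops p \<and> (\<forall>h\<in>X \<Lambda> p. nrm p (S h - A h) \<le> rate i * nrm p h)" by blast
  from choice[OF this] obtain A where A: "\<And>i. A i \<in> ops p"
    "\<And>i h. h \<in> X \<Lambda> p \<Longrightarrow> nrm p (S h - A i h) \<le> rate i * nrm p h" by blast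
  have l2: "A i h \<in> fibre_l2 \<Lambda> q" if "h \<in> fibre_l2 \<Lambda> q" for i h using ops_fibre_l2[OF A(1) q that] .
  have D: "nrm q (A i h - A j h) \<le> (rate i + rate j) * nrm q h" if h: "h \<in> fibre_l2 \<Lambda> q" for i j h
  proof -
    have eq: "(\<lambda>y. A i h y - A j h y) = A i h - A j h" for h by (simp add: fun_diff_def)
    have "nrm p (A i h - A j h) \<le> (rate i + rate j) * nrm p h" if h: "h \<in> X \<Lambda> p" for h
      using mod_norm_triangle[OF ops_fibre_l2[OF A(1) order_refl X_fibre_l2[OF h]] X_fibre_l2[OF SX[OF h]]
          ops_fibre_l2[OF A(1) order_refl X_fibre_l2[OF h]], of i j]
        A(2)[OF h, of i] A(2)[OF h, of j] mod_norm_minus_commute[of \<Lambda> p "A i h" "S h"] by (simp add: algebra_simps)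
    then show ?thesis
      using ops_transfer_bound[OF ops_diff[OF A(1) A(1), of i j], of "rate i + rate j", OF _ _ q h] by (simp add: eq)
  qed
  have "\<forall>i. \<exists>B. B \<in> ops p \<and> (\<forall>q\<ge>p. \<forall>h\<in>fibre_l2 \<Lambda> q. \<forall>k\<in>fibre_l2 \<Lambda> q. ip \<Lambda> q (A i h) k = ip \<Lambda> q h (B k))"
    using ops_adjoint[OF A(1)] by blast
  from choice[OF this] obtain A' where A': "\<And>i. A' i \<in> ops p"
    "\<And>i h k. h \<in> fibre_l2 \<Lambda> q \<Longrightarrow> k \<in> fibre_l2 \<Lambda> q \<Longrightarrow> ip \<Lambda> q (A i h) k = ip \<Lambda> q h (A' i k)" using q by blast
  have l2': "A' i h \<in> fibre_l2 \<Lambda> q" if "h \<in> fibre_l2 \<Lambda> q" for i h using ops_fibre_l2[OF A'(1) q that] .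
  have D': "nrm q (A' i h - A' j h) \<le> (rate i + rate j) * nrm q h" if h: "h \<in> fibre_l2 \<Lambda> q" for i j h
  proof (rule ops_adjoint_bound[of q "\<lambda>h. A i h - A j h" "rate i + rate j" "\<lambda>h. A' i h - A' j h", OF D _ _ _ _ h])
    fix h k assume hk: "h \<in> fibre_l2 \<Lambda> q" "k \<in> fibre_l2 \<Lambda> q"
    show "ip \<Lambda> q (A i h - A j h) k = ip \<Lambda> q h (A' i k - A' j k)"
      by (rule ext) (simp only: ip_diff_left[OF l2[OF hk(1)] l2[OF hk(1)] hk(2)] ip_diff_right[OF hk(1) l2'[OF hk(2)] l2'[OF hk(2)]] A'(2)[OF hk])
  qed (auto intro: fibre_l2_diff l2 l2')
  obtain R where R: "R \<in> X \<Lambda> q \<rightarrow>\<^sub>E X \<Lambda> q" "\<And>i h. h \<in> X \<Lambda> q \<Longrightarrow> nrm q (R h - A i h) \<le> rate i * nrm q h"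
    using operator_limit[of q A, OF ops_X[OF A(1) q] D[OF X_fibre_l2]] by blast
  obtain R' where R': "R' \<in> X \<Lambda> q \<rightarrow>\<^sub>E X \<Lambda> q" "\<And>i h. h \<in> X \<Lambda> q \<Longrightarrow> nrm q (R' h - A' i h) \<le> rate i * nrm q h"
    using operator_limit[of q A', OF ops_X[OF A'(1) q] D'[OF X_fibre_l2]] by blast
  have RX: "R h \<in> fibre_l2 \<Lambda> q" "R' h \<in> fibre_l2 \<Lambda> q" if "h \<in> X \<Lambda> q" for h
    using R(1) R'(1) that X_fibre_l2 by blast+
  have "ip \<Lambda> q (R h) k = ip \<Lambda> q h (R' k)" if h: "h \<in> X \<Lambda> q" and k: "k \<in> X \<Lambda> q" for h k
  proof
    fix x
    note hl = X_fibre_l2[OF h] and kl = X_fibre_l2[OF k]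
    have nn: "0 \<le> nrm q h" "0 \<le> nrm q k" using mod_norm_nonneg hl kl by blast+
    have "norm (ip \<Lambda> q (R h) k x - ip \<Lambda> q h (R' k) x) \<le> rate i * (2 * nrm q h * nrm q k)" for i
    proof -
      have "ip \<Lambda> q (R h) k x - ip \<Lambda> q h (R' k) x = ip \<Lambda> q (R h - A i h) k x - ip \<Lambda> q h (R' k - A' i k) x"
        using ip_diff_left[OF RX(1)[OF h] l2[OF hl] kl] ip_diff_right[OF hl RX(2)[OF k] l2'[OF kl]] A'(2)[OF hl kl] by simp
      then have "norm (ip \<Lambda> q (R h) k x - ip \<Lambda> q h (R' k) x) \<le> norm (ip \<Lambda> q (R h - A i h) k x) + norm (ip \<Lambda> q h (R' k - A' i k) x)"
        using norm_triangle_ineq4 by metis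
      also have "\<dots> \<le> nrm q (R h - A i h) * nrm q k + nrm q h * nrm q (R' k - A' i k)"
        by (intro add_mono ip_cauchy_schwarz(2) fibre_l2_diff RX h k l2 l2' hl kl)
      also have "\<dots> \<le> (rate i * nrm q h) * nrm q k + nrm q h * (rate i * nrm q k)"
        by (intro add_mono mult_right_mono mult_left_mono R(2) R'(2) nn h k)
      finally show ?thesis by (simp add: algebra_simps)
    qed
    from rate_le_zero[OF this] show "ip \<Lambda> q (R h) k x = ip \<Lambda> q h (R' k) x" by simp
  qed
  then have "R \<in> adjointable \<Lambda> q" using R(1) R'(1) unfolding adjointable_def by blast
  moreover have "approximable p q R"
  proof (rule approximable_closed[OF RX(1) q])
    fix e :: real assume "e > 0"
    then obtain i where i: "rate i < e" using reals_Archimedean by blast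
    have "nrm q (R h - A i h) \<le> e * nrm q h" if "h \<in> X \<Lambda> q" for h
      using R(2)[OF that, of i] mult_right_mono[OF less_imp_le[OF i] mod_norm_nonneg[OF X_fibre_l2[OF that]]] by linarith
    then show "\<exists>S. approximable p q S \<and> (\<forall>h\<in>X \<Lambda> q. nrm q (R h - S h) \<le> e * nrm q h)"
      using approximable_ops[OF A(1) q] by blast
  qed
  moreover have "R (mult p f g) = mult p (S f) g" if f: "f \<in> X \<Lambda> p" and g: "g \<in> X \<Lambda> (q - p)" for f g
  proof -
    have pq: "p + (q - p) = q" using add_diff_fun[OF q] .
    have m: "mult p f g \<in> X \<Lambda> q" "mult p (S f) g \<in> X \<Lambda> q"
      using mult_X[OF f g] mult_X[OF SX[OF f] g] unfolding pq by auto
    note Sl = X_fibre_l2[OF SX[OF f]] and Al = ops_fibre_l2[OF A(1) order_refl X_fibre_l2[OF f]]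
    have "nrm q (R (mult p f g) - mult p (S f) g)
        \<le> rate i * (nrm q (mult p f g) + nrm p f * nrm (q - p) g)" for i
    proof -
      have 1: "nrm q (R (mult p f g) - mult p (S f) g) \<le>
        nrm q (R (mult p f g) - A i (mult p f g)) + nrm q (mult p (A i f - S f) g)"
        using mod_norm_triangle[OF RX(1)[OF m(1)] l2[OF X_fibre_l2[OF m(1)]] X_fibre_l2[OF m(2)], of i]
        unfolding ops_mult[OF A(1)] mult_diff(1) .
      have "nrm q (mult p (A i f - S f) g) \<le> nrm p (A i f - S f) * nrm (q - p) g"
        using mult_fibre_l2(2)[OF fibre_l2_diff(1)[OF Al Sl] X_fibre_l2[OF g]] unfolding pq .
      also have "\<dots> \<le> (rate i * nrm p f) * nrm (q - p) g"
        using A(2)[OF f, of i] mod_norm_minus_commute[of \<Lambda> p "A i f" "S f"] mod_norm_nonneg[OF X_fibre_l2[OF g]]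
        by (intro mult_right_mono) simp_all
      finally show ?thesis unfolding distrib_left mult.assoc using 1 R(2)[OF m(1), of i] by linarith
    qed
    from rate_le_zero[OF this]
    have "(R (mult p f g) - mult p (S f) g) y = 0" for y
      using mod_norm_zero_imp fibre_l2_diff(1)[OF RX(1)[OF m(1)] X_fibre_l2[OF m(2)]] by blast
    then show ?thesis by (intro ext) simp
  qed
  ultimately show ?thesis by blast
qed

lemma adjointableE:
  assumes "R \<in> adjointable \<Lambda> q"
  obtains R' where "R \<in> X \<Lambda> q \<rightarrow>\<^sub>E X \<Lambda> q" "R' \<in> X \<Lambda> q \<rightarrow>\<^sub>E X \<Lambda> q"
    "\<And>f g. f \<in> X \<Lambda> q \<Longrightarrow> g \<in> X \<Lambda> q \<Longrightarrow> ip \<Lambda> q (R f) g = ip \<Lambda> q f (R' g)"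
  using assms unfolding adjointable_def by blast

text \<open>Instead of density of the products, adjoints are compared. If \<open>R'\<close> and
  \<open>S'\<close> differ at \<open>k\<close>, then \<open>u = R' k - S' k\<close> is orthogonal to
  all products, but a product supported in one cylinder and nonzero at a point where
  \<open>u\<close> is nonzero contradicts this. Equal adjoints give equal operators.\<close>

lemma iota_unique:
  assumes R: "R \<in> adjointable \<Lambda> q" "S \<in> adjointable \<Lambda> q" and q: "p \<le> q"
    and eq: "\<And>f g. f \<in> X \<Lambda> p \<Longrightarrow> g \<in> X \<Lambda> (q - p) \<Longrightarrow> R (mult p f g) = S (mult p f g)"
  shows "R = S"
proof -
  obtain R' where RX: "R \<in> X \<Lambda> q \<rightarrow>\<^sub>E X \<Lambda> q" and R': "R' \<in> X \<Lambda> q \<rightarrow>\<^sub>E X \<Lambda> q"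
      "\<And>f g. f \<in> X \<Lambda> q \<Longrightarrow> g \<in> X \<Lambda> q \<Longrightarrow> ip \<Lambda> q (R f) g = ip \<Lambda> q f (R' g)"
    using adjointableE[OF R(1)] by metis
  obtain S' where SX: "S \<in> X \<Lambda> q \<rightarrow>\<^sub>E X \<Lambda> q" and S': "S' \<in> X \<Lambda> q \<rightarrow>\<^sub>E X \<Lambda> q"
      "\<And>f g. f \<in> X \<Lambda> q \<Longrightarrow> g \<in> X \<Lambda> q \<Longrightarrow> ip \<Lambda> q (S f) g = ip \<Lambda> q f (S' g)"
    using adjointableE[OF R(2)] by metis
  have pq: "p + (q - p) = q" using add_diff_fun[OF q] .
  have adj: "R' k = S' k" if k: "k \<in> X \<Lambda> q" for k
  proof (rule ccontr)
    assume "R' k \<noteq> S' k"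
    then obtain y where "R' k y \<noteq> S' k y" by (meson ext)
    define u where "u = R' k - S' k"
    have RS: "R' k \<in> X \<Lambda> q" "S' k \<in> X \<Lambda> q" using PiE_mem[OF R'(1) k] PiE_mem[OF S'(1) k] .
    have u: "u \<in> X \<Lambda> q" "u y \<noteq> 0" using X_diff[OF RS] \<open>R' k y \<noteq> S' k y\<close> unfolding u_def by simp_all
    have "norm (u y) > 0" using u by simp
    \<comment> \<open>Being closer to \<open>u\<close> than \<open>norm (u y)\<close>, the function
      \<open>v\<close> does not vanish at \<open>y\<close>; its decomposition yields a member of
      some \<open>Ccyl l\<close> that does not vanish there either.\<close>
    then obtain v where v: "v \<in> Cc_ge \<Lambda> q" "nrm q (u - v) < norm (u y)" using u(1) unfolding X_def by blast
    have "u - v \<in> fibre_l2 \<Lambda> q"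
      using v(1) Cc_ge_subset_fibre_l2[OF kg] by (intro fibre_l2_diff(1)[OF X_fibre_l2[OF u(1)]]) blast
    from norm_le_mod_norm[OF this, of y] have "v y \<noteq> 0" using v(2) by auto
    obtain L d where L: "finite L" "\<And>l. l \<in> L \<Longrightarrow> l \<in> mor \<Lambda> \<and> dg l = q \<and> d l \<in> Ccyl l" "v = (\<lambda>y. \<Sum>l\<in>L. d l y)"
      using Cc_ge_decompose[OF v(1)] by metis
    have "\<exists>l\<in>L. d l y \<noteq> 0"
    proof (rule ccontr)
      assume "\<not> ?thesis"
      then have "v y = 0" unfolding L(3) by (intro sum.neutral) auto
      then show False using \<open>v y \<noteq> 0\<close> by simp
    qed
    then obtain l where l: "l \<in> L" "d l y \<noteq> 0" by blast
    note l' = L(2)[OF l(1)]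
    obtain a b where ab: "a \<in> mor \<Lambda>" "b \<in> mor \<Lambda>" "dg a = p" "src \<Lambda> a = rng \<Lambda> b" "l = cmp \<Lambda> a b"
      using factor_exists[of l p] l' q by blast
    note r = cmp_rules[OF ab(1,2,4)]
    have "p + dg b = q" using r(4) ab(3,5) l' by simp
    then have db: "dg b = q - p" by (metis add_diff_cancel_left')
    \<comment> \<open>With \<open>l = a b\<close>, the function \<open>d l\<close> itself serves as
      element of \<open>X \<Lambda> p\<close> and its pull-back to \<open>cyl b\<close> as element
      of \<open>X \<Lambda> (q - p)\<close>; their product is the square of
      \<open>d l\<close>.\<close>
    let ?f = "d l" let ?g = "pull b l (d l)"
    have f: "?f \<in> X \<Lambda> p" using Ccyl_X[of "d l" l p] l' q by simp
    have g: "?g \<in> X \<Lambda> (q - p)" using Ccyl_X[OF pull_Ccyl[of b l "d l"], of "q - p"] ab r(3) l' db by simp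
    have m: "mult p ?f ?g z = d l z * d l z" for z
    proof (cases "z \<in> cyl l")
      case True
      have s: "shift p z \<in> cyl b" using True cylinder_cmp[OF ab(1,2,4)] ab(3,5) by simp
      have "swap b l (shift p z) = z"
        by (rule swap_eqI[OF True]) (use shift_cmp[OF ab(1,2,4), of z] True ab(3,5) in simp)
      then show ?thesis using s by (simp add: mult_def pull_def)
    qed (use Ccyl_zero[of "d l" l] l' in \<open>simp add: mult_def\<close>)
    have mX: "mult p ?f ?g \<in> X \<Lambda> q" using mult_X[OF f g] unfolding pq .
    have "ip \<Lambda> q (mult p ?f ?g) u x = 0" for x
      using R'(2)[OF mX k] S'(2)[OF mX k] eq[OF f g]
        ip_diff_right[OF X_fibre_l2[OF mX] X_fibre_l2[OF RS(1)] X_fibre_l2[OF RS(2)], of x]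
      unfolding u_def by simp
    moreover have "mult p ?f ?g = (\<lambda>z. d l z * d l z)" by (rule ext[OF m])
    then have "mult p ?f ?g \<in> Ccyl l" using Ccyl_mult[of "d l" l "d l" l] l' by simp
    moreover have yl: "y \<in> cyl l" using l(2) Ccyl_zero[of "d l" l y] l' by blast
    ultimately have "cnj (mult p ?f ?g y) * u y = 0"
      using ip_Ccyl[of "mult p ?f ?g" l q u "shift q y"] l' shift_in_cylinder_src[OF yl] cat_eqI[OF yl] by simp
    then show False using m[of y] l(2) u(2) by simp
  qed
  have "R h = S h" for h
  proof (cases "h \<in> X \<Lambda> q")
    case h: True
    have RS: "R h \<in> X \<Lambda> q" "S h \<in> X \<Lambda> q" using PiE_mem[OF RX h] PiE_mem[OF SX h] .
    then have d: "R h - S h \<in> X \<Lambda> q" using X_diff by blast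
    have "ip \<Lambda> q (R h - S h) (R h - S h) x = 0" for x
    proof -
      have "ip \<Lambda> q (R h) (R h - S h) = ip \<Lambda> q (S h) (R h - S h)"
        using R'(2)[OF h d] S'(2)[OF h d] adj[OF d] by simp
      then show ?thesis using ip_diff_left[OF X_fibre_l2[OF RS(1)] X_fibre_l2[OF RS(2)] X_fibre_l2[OF d], of x] by simp
    qed
    then have "nrm q (R h - S h) \<le> 0" by (intro mod_norm_leI) auto
    then have "(R h - S h) y = 0" for y using mod_norm_zero_imp[OF X_fibre_l2[OF d]] by blast
    then show ?thesis by (intro ext) simp
  next
    case False
    then show ?thesis using PiE_arb[OF RX False] PiE_arb[OF SX False] by simp
  qed
  then show ?thesis by (rule ext)
qed

section \<open>Degree zero: compact operators as multipliers\<close>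

lemma shift_zero_boundary: "y \<in> boundary \<Lambda> \<Longrightarrow> shift 0 y = y"
  by (rule shift_zero[of _ \<Lambda>]) (simp add: boundary_def)

lemma boundary_ge_zero: "boundary_ge \<Lambda> 0 = boundary \<Lambda>"
  using env_0 unfolding boundary_ge_def by blast

lemma ip_zero: "ip \<Lambda> 0 f g x = (if x \<in> boundary \<Lambda> then cnj (f x) * g x else 0)"
proof -
  have "fibre \<Lambda> 0 x = (if x \<in> boundary \<Lambda> then {x} else {})"
    using shift_zero_boundary unfolding fibre_def boundary_ge_zero by auto
  then show ?thesis by (simp add: ip_def)
qed

lemma mult_zero: "f \<in> X \<Lambda> 0 \<Longrightarrow> mult 0 f g = (\<lambda>y. f y * g y)"
proof
  fix y assume f: "f \<in> X \<Lambda> 0"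
  show "mult 0 f g y = f y * g y"
  proof (cases "y \<in> boundary_ge \<Lambda> 0")
    case True
    then have "shift 0 y = y" using shift_zero_boundary unfolding boundary_ge_zero by blast
    then show ?thesis by (simp add: mult_def)
  qed (use fibre_l2D(1)[OF X_fibre_l2[OF f]] in \<open>simp add: mult_def\<close>)
qed

text \<open>Morphisms of degree 0 are vertices, and \<open>l\<close>, \<open>m\<close> are equal
  because their sources agree; so every exchange is the identity on its cylinder.\<close>

lemma ops_zero_multiplier:
  assumes "A \<in> ops 0" shows "\<exists>a\<in>Cc_ge \<Lambda> 0. \<forall>h. A h = (\<lambda>y. a y * h y)"
  using assms
proof (induction rule: ops.induct)
  case zero
  have "(\<lambda>y. 0) \<in> Cc_ge \<Lambda> 0" unfolding Cc_ge_def Cc_iff by (auto intro!: exI[of _ "{}"])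
  then show ?case by (rule bexI[rotated]) simp
next
  case (add A l m c)
  then obtain a where a: "a \<in> Cc_ge \<Lambda> 0" "\<And>h. A h = (\<lambda>y. a y * h y)" by blast
  have "l = src \<Lambda> l" "m = src \<Lambda> m"
    using deg_zero_iff_identity[OF kg] add.hyps category_rules(4) by metis+
  then have lm: "l = m" using add.hyps(4) by simp
  have "Op l m c h y = c y * h y" for h y
    using Ccyl_zero[OF add.hyps(7), of y] swap_self[of y l] by (cases "y \<in> cyl l") (simp_all add: Op_def lm)
  then have "(\<lambda>y. A h y + Op l m c h y) = (\<lambda>y. (a + c) y * h y)" for h by (simp add: a(2) algebra_simps)
  moreover have "a + c \<in> Cc_ge \<Lambda> 0" using add.hyps by (intro Cc_ge_add a(1) Ccyl_Cc_ge[of _ l]) auto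
  ultimately show ?case by blast
qed

text \<open>\<open>X \<Lambda> 0\<close> need not contain the constant 1, so a multiplier cannot be
  read off there. The approximating multipliers are compared on \<open>h = cnj (a i - a j)\<close>
  instead, which bounds the supremum norm of \<open>a i - a j\<close> after one factor is cancelled.
  Uniqueness uses the same kind of test function.\<close>

lemma compact_ops_zero:
  assumes S: "S \<in> compact_ops \<Lambda> 0"
  shows "\<exists>!a. a \<in> C0 BT \<and> S = left_act \<Lambda> 0 a"
proof -
  note X0 = X_zero[OF kg]
  have SE: "S \<in> X \<Lambda> 0 \<rightarrow>\<^sub>E X \<Lambda> 0" using S unfolding compact_ops_def adjointable_def by blast
  have "\<forall>i. \<exists>A\<in>ops 0. \<forall>h\<in>X \<Lambda> 0. nrm 0 (S h - A h) \<le> rate i * nrm 0 h"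
    using compact_ops_approximable[OF S] unfolding approximable_def by simp
  note ap = this
  have "\<forall>i. \<exists>a. a \<in> Cc_ge \<Lambda> 0 \<and> (\<forall>h\<in>X \<Lambda> 0. nrm 0 (S h - (\<lambda>y. a y * h y)) \<le> rate i * nrm 0 h)"
  proof
    fix i
    obtain A where A: "A \<in> ops 0" "\<forall>h\<in>X \<Lambda> 0. nrm 0 (S h - A h) \<le> rate i * nrm 0 h"
      using ap by blast
    obtain a where "a \<in> Cc_ge \<Lambda> 0" "\<And>h. A h = (\<lambda>y. a y * h y)" using ops_zero_multiplier[OF A(1)] by blast
    then show "\<exists>a. a \<in> Cc_ge \<Lambda> 0 \<and> (\<forall>h\<in>X \<Lambda> 0. nrm 0 (S h - (\<lambda>y. a y * h y)) \<le> rate i * nrm 0 h)"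
      using A(2) by (intro exI[of _ a]) simp
  qed
  from choice[OF this] obtain a where a: "\<And>i. a i \<in> Cc_ge \<Lambda> 0"
    "\<And>i h. h \<in> X \<Lambda> 0 \<Longrightarrow> nrm 0 (S h - (\<lambda>y. a i y * h y)) \<le> rate i * nrm 0 h" by blast
  have aX: "a i \<in> X \<Lambda> 0" for i using a(1) Cc_ge_subset_X[OF kg] by blast
  have ah: "(\<lambda>y. a i y * h y) \<in> X \<Lambda> 0" if "h \<in> X \<Lambda> 0" for i h
    using mult_X[OF aX that] mult_zero[OF aX] by simp
  have d: "nrm 0 (a i - a j) \<le> rate i + rate j" for i j
  proof (rule mod_norm_leI_self)
    let ?b = "a i - a j" let ?h = "\<lambda>y. cnj (?b y)"
    have b: "?b \<in> X \<Lambda> 0" using X_diff aX by blast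
    then show "?b \<in> fibre_l2 \<Lambda> 0" by (rule X_fibre_l2)
    show "0 \<le> rate i + rate j" by simp
    have h: "?h \<in> X \<Lambda> 0" using C0_cnj[of ?b BT] b unfolding X0 by simp
    have SX: "S ?h \<in> X \<Lambda> 0" using SE h by blast
    have eq: "(\<lambda>y. ?b y * ?h y) = (\<lambda>y. a i y * ?h y) - (\<lambda>y. a j y * ?h y)" by (rule ext) (simp add: algebra_simps)
    have bh: "(\<lambda>y. ?b y * ?h y) \<in> X \<Lambda> 0" unfolding eq using ah[OF h] X_diff by blast
    have "nrm 0 (\<lambda>y. ?b y * ?h y) \<le> nrm 0 ((\<lambda>y. a i y * ?h y) - S ?h) + nrm 0 (S ?h - (\<lambda>y. a j y * ?h y))"
      unfolding eq by (rule mod_norm_triangle[OF X_fibre_l2[OF ah[OF h]] X_fibre_l2[OF SX] X_fibre_l2[OF ah[OF h]]])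
    also have "\<dots> \<le> rate i * nrm 0 ?h + rate j * nrm 0 ?h"
      unfolding mod_norm_minus_commute[of \<Lambda> 0 "\<lambda>y. a i y * ?h y"] by (intro add_mono a(2) h)
    also have "\<dots> = (rate i + rate j) * nrm 0 ?b"
      using mod_norm_cnj[of \<Lambda> 0 ?b] by (simp only: distrib_right)
    finally have le: "nrm 0 (\<lambda>y. ?b y * ?h y) \<le> (rate i + rate j) * nrm 0 ?b" .
    fix x
    have "norm (ip \<Lambda> 0 ?b ?b x) \<le> norm (?b x * ?h x)" by (simp only: ip_zero) (simp add: norm_mult)
    also have "\<dots> \<le> nrm 0 (\<lambda>y. ?b y * ?h y)" by (rule norm_le_mod_norm[OF X_fibre_l2[OF bh]])
    finally show "norm (ip \<Lambda> 0 ?b ?b x) \<le> (rate i + rate j) * nrm 0 ?b" using le by simp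
  qed
  have "\<exists>M. \<forall>i\<ge>M. \<forall>j\<ge>M. nrm 0 (a i - a j) < e" if e: "e > 0" for e
  proof -
    obtain M where M: "rate M < e / 2" using reals_Archimedean[OF half_gt_zero[OF e]] by blast
    have "nrm 0 (a i - a j) < e" if "i \<ge> M" "j \<ge> M" for i j
    proof -
      have "rate i \<le> rate M" "rate j \<le> rate M" using that by (auto intro!: le_imp_inverse_le)
      then show ?thesis using d[of i j] M by linarith
    qed
    then show ?thesis by blast
  qed
  from X_complete[OF kg aX this] obtain b where b: "b \<in> X \<Lambda> 0" "(\<lambda>i. nrm 0 (a i - b)) \<longlonglongrightarrow> 0" by blast
  have Sh: "S h = (\<lambda>y. b y * h y)" if h: "h \<in> X \<Lambda> 0" for h
  proof
    fix y
    have "norm (S h y - b y * h y) \<le> rate i * nrm 0 h + nrm 0 (a i - b) * norm (h y)" for i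
    proof -
      have SX: "S h \<in> X \<Lambda> 0" using SE h by blast
      let ?P = "(S h - (\<lambda>y. a i y * h y)) y" and ?Q = "(a i - b) y"
      have eq: "S h y - b y * h y = ?P + ?Q * h y" by (simp add: algebra_simps)
      have "norm (S h y - b y * h y) \<le> norm ?P + norm ?Q * norm (h y)"
        unfolding eq using norm_triangle_ineq[of ?P "?Q * h y"] by (simp only: norm_mult)
      also have "\<dots> \<le> nrm 0 (S h - (\<lambda>y. a i y * h y)) + nrm 0 (a i - b) * norm (h y)"
        by (intro add_mono mult_right_mono norm_ge_zero
            norm_le_mod_norm[OF X_fibre_l2[OF X_diff[OF SX ah[OF h]]]]
            norm_le_mod_norm[OF X_fibre_l2[OF X_diff[OF aX b(1)]]])
      finally show ?thesis using a(2)[OF h, of i] by linarith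
    qed
    moreover have "(\<lambda>i. rate i * nrm 0 h + nrm 0 (a i - b) * norm (h y)) \<longlonglongrightarrow> 0 * nrm 0 h + 0 * norm (h y)"
      by (intro tendsto_intros LIMSEQ_inverse_real_of_nat b(2))
    ultimately have "norm (S h y - b y * h y) \<le> 0 * nrm 0 h + 0 * norm (h y)" by (intro LIMSEQ_le_const) blast+
    then show "S h y = b y * h y" by simp
  qed
  have Sb: "S = left_act \<Lambda> 0 b"
  proof
    fix h show "S h = left_act \<Lambda> 0 b h"
    proof (cases "h \<in> X \<Lambda> 0")
      case True then show ?thesis using Sh by (simp add: left_act_def)
    next
      case False then show ?thesis using PiE_arb[OF SE False] by (simp add: left_act_def)
    qed
  qed
  show ?thesis
  proof (rule ex1I[of _ b])
    show "b \<in> C0 BT \<and> S = left_act \<Lambda> 0 b" using b(1) Sb X0 by blast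
    fix b' assume b': "b' \<in> C0 BT \<and> S = left_act \<Lambda> 0 b'"
    let ?h = "\<lambda>y. cnj ((b' - b) y)"
    have bX: "b' \<in> X \<Lambda> 0" using b' X0 by blast
    have h: "?h \<in> X \<Lambda> 0" using C0_cnj[of "b' - b" BT] X_diff[OF bX b(1)] unfolding X0 by blast
    have "left_act \<Lambda> 0 b' ?h = S ?h" using b' by blast
    then have eq: "(\<lambda>y. b y * ?h y) = (\<lambda>y. b' y * ?h y)"
      unfolding Sh[OF h] left_act_def restrict_apply'[OF h] by (rule sym)
    show "b' = b"
    proof
      fix y
      have "(b' y - b y) * cnj (b' y - b y) = 0" using fun_cong[OF eq, of y] by (simp add: algebra_simps)
      then show "b' y = b y" by simp
    qed
  qed
qed

lemma left_act_adjointable: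
  assumes a: "a \<in> C0 BT" shows "left_act \<Lambda> q a \<in> adjointable \<Lambda> q"
proof -
  have X0: "a \<in> X \<Lambda> 0" if "a \<in> C0 BT" for a using that X_zero[OF kg] by blast
  have *: "left_act \<Lambda> q a \<in> X \<Lambda> q \<rightarrow>\<^sub>E X \<Lambda> q" if "a \<in> C0 BT" for a
  proof -
    have "(\<lambda>y. a y * f y) \<in> X \<Lambda> q" if "f \<in> X \<Lambda> q" for f
      using mult_X[OF X0[OF \<open>a \<in> C0 BT\<close>] that] mult_zero[OF X0[OF \<open>a \<in> C0 BT\<close>]] by simp
    then show ?thesis by (auto simp: left_act_def)
  qed
  have "ip \<Lambda> q (left_act \<Lambda> q a f) g = ip \<Lambda> q f (left_act \<Lambda> q (\<lambda>y. cnj (a y)) g)"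
    if "f \<in> X \<Lambda> q" "g \<in> X \<Lambda> q" for f g
    using that by (intro ext) (simp add: left_act_def ip_def mult_ac)
  then show ?thesis using *[OF a] *[OF C0_cnj[OF a]] unfolding adjointable_def by blast
qed

text \<open>For \<open>p = 0\<close> the value of \<open>iota\<close> is left multiplication by the
  multiplier of \<open>S\<close>. It satisfies the same product identity as the limit
  \<open>R\<close> of \<open>iota_exists\<close>, so \<open>iota_unique\<close> identifies the two
  and the approximation of \<open>R\<close> is available in every degree.\<close>

lemma iota_approximable:
  assumes S: "S \<in> compact_ops \<Lambda> p" and q: "p \<le> q"
  shows "iota \<Lambda> p q S \<in> adjointable \<Lambda> q" "approximable p q (iota \<Lambda> p q S)"
proof -
  obtain R where R: "R \<in> adjointable \<Lambda> q" "approximable p q R"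
    "\<And>f g. f \<in> X \<Lambda> p \<Longrightarrow> g \<in> X \<Lambda> (q - p) \<Longrightarrow> R (mult p f g) = mult p (S f) g"
    using iota_exists[OF S q] by blast
  have "iota \<Lambda> p q S = R"
  proof (cases "p = 0")
    case True
    have S0: "S \<in> compact_ops \<Lambda> 0" using S unfolding True .
    define a where "a = (THE a. a \<in> C0 BT \<and> S = left_act \<Lambda> 0 a)"
    have a: "a \<in> C0 BT" "S = left_act \<Lambda> 0 a" using theI'[OF compact_ops_zero[OF S0]] unfolding a_def by blast+
    have aX: "a \<in> X \<Lambda> 0" using a(1) X_zero[OF kg] by blast
    have i: "iota \<Lambda> p q S = left_act \<Lambda> q a" unfolding iota_def a_def using True by simp
    have "left_act \<Lambda> q a = R"
    proof (rule iota_unique[OF left_act_adjointable[OF a(1)] R(1) q])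
      fix f g assume f: "f \<in> X \<Lambda> p" and g: "g \<in> X \<Lambda> (q - p)"
      have f0: "f \<in> X \<Lambda> 0" using f True by simp
      have m: "mult p f g \<in> X \<Lambda> q" using mult_X[OF f g] add_diff_fun[OF q] by simp
      have af: "(\<lambda>y. a y * f y) \<in> X \<Lambda> 0" using mult_X[OF aX f0] mult_zero[OF aX] by simp
      have "left_act \<Lambda> q a (mult p f g) = (\<lambda>y. a y * mult p f g y)" using m by (simp add: left_act_def)
      also have "\<dots> = mult p (S f) g" using f0 True af by (simp add: a(2) left_act_def mult_zero mult_ac)
      finally show "left_act \<Lambda> q a (mult p f g) = R (mult p f g)" using R(3)[OF f g] by simp
    qed
    then show ?thesis using i by simp
  next
    case False
    have "(THE R. R \<in> adjointable \<Lambda> q \<and> (\<forall>f\<in>X \<Lambda> p. \<forall>g\<in>X \<Lambda> (q - p). R (mult p f g) = mult p (S f) g)) = R"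
    proof (rule the_equality)
      show "R \<in> adjointable \<Lambda> q \<and> (\<forall>f\<in>X \<Lambda> p. \<forall>g\<in>X \<Lambda> (q - p). R (mult p f g) = mult p (S f) g)" using R by blast
      fix Q assume "Q \<in> adjointable \<Lambda> q \<and> (\<forall>f\<in>X \<Lambda> p. \<forall>g\<in>X \<Lambda> (q - p). Q (mult p f g) = mult p (S f) g)"
      then show "Q = R" using iota_unique[OF _ R(1) q, of Q] R(3) by simp
    qed
    then show ?thesis unfolding iota_def using False by simp
  qed
  then show "iota \<Lambda> p q S \<in> adjointable \<Lambda> q" "approximable p q (iota \<Lambda> p q S)" using R by simp_all
qed

section \<open>Compact alignment\<close>

lemma approximable_bounded:
  assumes R: "approximable p q R" and q: "p \<le> q"
  shows "\<exists>C\<ge>0. \<forall>h\<in>X \<Lambda> q. nrm q (R h) \<le> C * nrm q h"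
proof -
  obtain A where A: "A \<in> ops p" "\<And>h. h \<in> X \<Lambda> q \<Longrightarrow> nrm q (R h - A h) \<le> 1 * nrm q h"
    using R unfolding approximable_def by (meson zero_less_one)
  obtain C where C: "C \<ge> 0" "\<And>h. h \<in> fibre_l2 \<Lambda> q \<Longrightarrow> A h \<in> fibre_l2 \<Lambda> q \<and> nrm q (A h) \<le> C * nrm q h"
    using ops_bounded[OF A(1) q] by blast
  have "nrm q (R h) \<le> (1 + C) * nrm q h" if h: "h \<in> X \<Lambda> q" for h
  proof -
    have "R h \<in> fibre_l2 \<Lambda> q" "A h \<in> fibre_l2 \<Lambda> q" using R h C(2) X_fibre_l2 unfolding approximable_def by blast+
    from fibre_l2_add(2)[OF fibre_l2_diff(1)[OF this] this(2)]
    have "nrm q (R h) \<le> nrm q (R h - A h) + nrm q (A h)" by simp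
    then show ?thesis using A(2)[OF h] C(2)[OF X_fibre_l2[OF h]] by (simp add: algebra_simps)
  qed
  then show ?thesis using C(1) by (intro exI[of _ "1 + C"]) auto
qed

text \<open>The error is \<open>R S - A B = (R - A) S + A (S - B)\<close>, and \<open>A B\<close>
  lies in \<open>ops (sup m n)\<close> by \<open>ops_product\<close>.\<close>

lemma approximable_compose:
  assumes R: "approximable m q R" and S: "approximable n q S" and mn: "m \<le> q" "n \<le> q"
    and RX: "R \<in> X \<Lambda> q \<rightarrow> X \<Lambda> q" "S \<in> X \<Lambda> q \<rightarrow> X \<Lambda> q"
  shows "approximable (sup m n) q (\<lambda>h. R (S h))"
  unfolding approximable_def
proof (intro conjI ballI allI impI)
  show "R (S h) \<in> fibre_l2 \<Lambda> q" if "h \<in> X \<Lambda> q" for h using RX that X_fibre_l2 by blast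
  fix e :: real assume e: "e > 0"
  obtain K where K: "K \<ge> 0" "\<And>h. h \<in> X \<Lambda> q \<Longrightarrow> nrm q (S h) \<le> K * nrm q h"
    using approximable_bounded[OF S mn(2)] by blast
  obtain d where d: "d > 0" "\<bar>K\<bar> * d < e / 2" using small_factor[OF half_gt_zero[OF e]] by blast
  obtain A where A: "A \<in> ops m" "\<And>h. h \<in> X \<Lambda> q \<Longrightarrow> nrm q (R h - A h) \<le> d * nrm q h"
    using R d(1) unfolding approximable_def by blast
  obtain C where C: "C \<ge> 0" "\<And>h. h \<in> fibre_l2 \<Lambda> q \<Longrightarrow> A h \<in> fibre_l2 \<Lambda> q \<and> nrm q (A h) \<le> C * nrm q h"
    using ops_bounded[OF A(1) mn(1)] by blast
  \<comment> \<open>\<open>B\<close> is chosen after \<open>A\<close>, because its error is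
    multiplied by the bound \<open>C\<close> of \<open>A\<close>.\<close>
  obtain d' where d': "d' > 0" "\<bar>C\<bar> * d' < e / 2" using small_factor[OF half_gt_zero[OF e]] by blast
  obtain B where B: "B \<in> ops n" "\<And>h. h \<in> X \<Lambda> q \<Longrightarrow> nrm q (S h - B h) \<le> d' * nrm q h"
    using S d'(1) unfolding approximable_def by blast
  have "nrm q (R (S h) - A (B h)) \<le> e * nrm q h" if h: "h \<in> X \<Lambda> q" for h
  proof -
    have SX: "S h \<in> X \<Lambda> q" "R (S h) \<in> X \<Lambda> q" using RX h by blast+
    have BX: "B h \<in> X \<Lambda> q" using ops_X[OF B(1) mn(2) h] .
    have N: "0 \<le> nrm q h" using mod_norm_nonneg[OF X_fibre_l2[OF h]] .
    have "nrm q (R (S h) - A (B h)) \<le> nrm q (R (S h) - A (S h)) + nrm q (A (S h - B h))"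
      using mod_norm_triangle[of "R (S h)" \<Lambda> q "A (S h)" "A (B h)"] SX BX C(2) X_fibre_l2
      unfolding ops_linear(2)[OF A(1)] by blast
    moreover have "nrm q (R (S h) - A (S h)) \<le> d * (K * nrm q h)"
      using A(2)[OF SX(1)] mult_left_mono[OF K(2)[OF h] less_imp_le[OF d(1)]] by linarith
    moreover have "nrm q (A (S h - B h)) \<le> C * (d' * nrm q h)"
      using C(2)[OF X_fibre_l2[OF X_diff[OF SX(1) BX]]] mult_left_mono[OF B(2)[OF h] C(1)] by linarith
    moreover have "d * (K * nrm q h) \<le> e / 2 * nrm q h" "C * (d' * nrm q h) \<le> e / 2 * nrm q h"
    proof -
      have "K * d \<le> e / 2" "C * d' \<le> e / 2" using d(2) d'(2) K(1) C(1) by simp_all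
      from mult_right_mono[OF this(1) N] mult_right_mono[OF this(2) N]
      show "d * (K * nrm q h) \<le> e / 2 * nrm q h" "C * (d' * nrm q h) \<le> e / 2 * nrm q h"
        by (simp_all add: mult_ac)
    qed
    ultimately show ?thesis by linarith
  qed
  then show "\<exists>A\<in>ops (sup m n). \<forall>h\<in>X \<Lambda> q. nrm q (R (S h) - A h) \<le> e * nrm q h"
    using ops_product[OF A(1) B(1)] by (intro bexI[of _ "\<lambda>h. A (B h)"]) blast
qed

lemma adjointable_compose:
  assumes "R \<in> adjointable \<Lambda> q" "S \<in> adjointable \<Lambda> q"
  shows "compose (X \<Lambda> q) R S \<in> adjointable \<Lambda> q"
proof -
  obtain R' where RX: "R \<in> X \<Lambda> q \<rightarrow>\<^sub>E X \<Lambda> q" and R': "R' \<in> X \<Lambda> q \<rightarrow>\<^sub>E X \<Lambda> q"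
      "\<And>f g. f \<in> X \<Lambda> q \<Longrightarrow> g \<in> X \<Lambda> q \<Longrightarrow> ip \<Lambda> q (R f) g = ip \<Lambda> q f (R' g)"
    using adjointableE[OF assms(1)] by metis
  obtain S' where SX: "S \<in> X \<Lambda> q \<rightarrow>\<^sub>E X \<Lambda> q" and S': "S' \<in> X \<Lambda> q \<rightarrow>\<^sub>E X \<Lambda> q"
      "\<And>f g. f \<in> X \<Lambda> q \<Longrightarrow> g \<in> X \<Lambda> q \<Longrightarrow> ip \<Lambda> q (S f) g = ip \<Lambda> q f (S' g)"
    using adjointableE[OF assms(2)] by metis
  have c: "compose (X \<Lambda> q) P Q \<in> X \<Lambda> q \<rightarrow>\<^sub>E X \<Lambda> q" if "P \<in> X \<Lambda> q \<rightarrow>\<^sub>E X \<Lambda> q" "Q \<in> X \<Lambda> q \<rightarrow>\<^sub>E X \<Lambda> q" for P Q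
    using PiE_mem[OF that(1)] PiE_mem[OF that(2)] unfolding compose_def
    by (intro restrict_PiE_iff[THEN iffD2] ballI) blast
  have "ip \<Lambda> q (compose (X \<Lambda> q) R S f) g = ip \<Lambda> q f (compose (X \<Lambda> q) S' R' g)" if f: "f \<in> X \<Lambda> q" and g: "g \<in> X \<Lambda> q" for f g
  proof -
    have "S f \<in> X \<Lambda> q" "R' g \<in> X \<Lambda> q" using PiE_mem[OF SX f] PiE_mem[OF R'(1) g] .
    then show ?thesis using R'(2)[of "S f" g] S'(2)[of f "R' g"] f g by (simp add: compose_eq)
  qed
  then show ?thesis using c[OF RX SX] c[OF S'(1) R'(1)] unfolding adjointable_def by blast
qed

lemma approximable_compact:
  assumes "R \<in> adjointable \<Lambda> q" "approximable q q R" shows "R \<in> compact_ops \<Lambda> q"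
  unfolding compact_ops_def
proof (intro CollectI conjI allI impI)
  show "R \<in> adjointable \<Lambda> q" by fact
  fix e :: real assume "e > 0"
  then obtain A where A: "A \<in> ops q" "\<forall>h\<in>X \<Lambda> q. nrm q (R h - A h) \<le> e * nrm q h"
    using assms(2) unfolding approximable_def by blast
  then show "\<exists>B\<in>finite_rank \<Lambda> q. \<forall>h\<in>X \<Lambda> q. nrm q (R h - B h) \<le> e * nrm q h"
    by (intro bexI[OF _ ops_finite_rank[OF A(1)]]) simp
qed

text \<open>With \<open>q = sup m n\<close> the degree of the product operators equals that of the
  module, so they are of finite rank there. On a larger \<open>q\<close>, approximation by
  \<open>ops (sup m n)\<close> would not by itself give compactness.\<close>

lemma compactly_aligned:
  assumes S: "S \<in> compact_ops \<Lambda> m" and T: "T \<in> compact_ops \<Lambda> n"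
  shows "compose (X \<Lambda> (sup m n)) (iota \<Lambda> m (sup m n) S) (iota \<Lambda> n (sup m n) T) \<in> compact_ops \<Lambda> (sup m n)"
proof -
  let ?q = "sup m n" let ?S = "iota \<Lambda> m ?q S" let ?T = "iota \<Lambda> n ?q T"
  note i = iota_approximable[OF S sup_ge1[of m n]] iota_approximable[OF T sup_ge2[of n m]]
  have "?S \<in> X \<Lambda> ?q \<rightarrow> X \<Lambda> ?q" "?T \<in> X \<Lambda> ?q \<rightarrow> X \<Lambda> ?q" using i(1,3) unfolding adjointable_def by blast+
  from approximable_compose[OF i(2,4) sup_ge1 sup_ge2 this]
  have "approximable ?q ?q (compose (X \<Lambda> ?q) ?S ?T)" by (rule approximable_cong) (simp add: compose_eq)
  then show ?thesis using approximable_compact[OF adjointable_compose[OF i(1,3)]] by blast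
qed

end

theorem proposition6p1:
  fixes \<Lambda> :: "('a, 'k::finite) kgraph"
  assumes "k_graph \<Lambda>" and "finitely_aligned \<Lambda>"
  shows "\<forall>m n. \<forall>S\<in>compact_ops \<Lambda> m. \<forall>T\<in>compact_ops \<Lambda> n.
    compose (X \<Lambda> (sup m n)) (iota \<Lambda> m (sup m n) S) (iota \<Lambda> n (sup m n) T)
      \<in> compact_ops \<Lambda> (sup m n)"
proof -
  interpret aligned_kgraph \<Lambda> using assms by unfold_locales
  show ?thesis using compactly_aligned by blast
qed

end
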